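(* If $j+k<n$, then for functions $h:\mathbb R^n\to\mathbb C$, $$R_k^*\,\mathcal R_{j,k}R_jh=R_j^*\,\mathcal R_{k,j}R_kh=c\,I_n^{j+k}h,\qquad c=\frac{2^{j+k}\pi^{(j+k)/2}\,\Gamma(n/2)}{\Gamma((n-j-k)/2)},$$ provided that the Riesz potential $I_n^{j+k}h$ exists in the Lebesgue sense.
   Context: Throughout, $n,j,k$ are integers with $j>0$, $k>0$, $j+k<n$. $G_{n,j}$ is the Grassmannian of $j$-dimensional linear subspaces of $\mathbb R^n$; $G(n,j)$ is the manifold of $j$-dimensional unoriented affine planes in $\mathbb R^n$. Every $\tau\in G(n,j)$ is written uniquely as $\tau=\xi+u$ with $\xi\in G_{n,j}$, $u\in\xi^\perp$; similarly $\zeta=\eta+v\in G(n,k)$, $\eta\in G_{n,k}$, $v\in\eta^\perp$. The $k$-plane transform of $h$ on $\mathbb R^n$ is $(R_kh)(\zeta)=\int_\zeta h(x)\,d_\zeta x$, $\zeta\in G(n,k)$ (Euclidean measure on $\zeta$). The dual $k$-plane transform of $\varphi$ on $G(n,k)$ is $(R_k^*\varphi)(x)=\int_{O(n)}\varphi(\gamma\eta_0+x)\,d\gamma$, where $\eta_0\in G_{n,k}$ is arbitrary and fixed and $d\gamma$ is the invariant probability measure on $O(n)$. $R_j$, $R_j^*$ are defined in the same way with $j$ in place of $k$. The mixed Radon transforms are $$(\mathcal R_{j,k}f)(\eta+v)=\int_{G_j(\eta^\perp)}d\xi\int_\eta f(\xi+u+v)\,du,\qquad (\mathcal R_{k,j}\varphi)(\xi+u)=\int_{G_k(\xi^\perp)}d\eta\int_\xi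 \varphi(\eta+u+v)\,dv,$$ where $G_j(\eta^\perp)$, $G_k(\xi^\perp)$ are the Grassmannians of linear subspaces of $\eta^\perp$, $\xi^\perp$ of dimension $j$, $k$ with their invariant probability measures, and the inner integrals are with respect to Lebesgue measure on $\eta$ and $\xi$. The Riesz potential is $$(I_n^\alpha h)(x)=\frac{1}{\gamma_n(\alpha)}\int_{\mathbb R^n}\frac{h(y)\,dy}{|x-y|^{n-\alpha}},\qquad \gamma_n(\alpha)=\frac{2^\alpha\pi^{n/2}\Gamma(\alpha/2)}{\Gamma((n-\alpha)/2)}.$$ *)

theory Defs
  imports "HOL-Analysis.Analysis" "HOL-Probability.Probability"
begin

section \<open>Grassmannians and affine planes\<close>

text \<open>The \<open>k\<close>-dimensional linear subspaces of the linear subspace \<open>W\<close>; \<open>W = UNIV\<close> gives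
  the Grassmannian of \<open>\<real>\<^sup>n\<close>.\<close>

definition grassmannian_in :: "nat \<Rightarrow> (real^'n) set \<Rightarrow> (real^'n) set set" where
  "grassmannian_in k W = {\<xi>. subspace \<xi> \<and> \<xi> \<subseteq> W \<and> dim \<xi> = k}"

abbreviation grassmannian :: "nat \<Rightarrow> (real^'n) set set" where
  "grassmannian k \<equiv> grassmannian_in k UNIV"

definition affine_planes :: "nat \<Rightarrow> (real^'n) set set" where
  "affine_planes k = {\<zeta>. affine \<zeta> \<and> aff_dim \<zeta> = int k}"

text \<open>The two components of the unique decomposition \<open>\<zeta> = \<eta> + v\<close> of an affine plane, with \<open>\<eta>\<close> a
  linear subspace and \<open>v \<in> \<eta>\<^sup>\<bottom>\<close>.\<close>

definition direction :: "(real^'n) set \<Rightarrow> (real^'n) set" where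
  "direction \<zeta> = (THE \<eta>. subspace \<eta> \<and> (\<exists>v\<in>\<eta>\<^sup>\<bottom>. \<zeta> = (\<lambda>y. y + v) ` \<eta>))"

definition offset :: "(real^'n) set \<Rightarrow> real^'n" where
  "offset \<zeta> = (THE v. v \<in> (direction \<zeta>)\<^sup>\<bottom> \<and> \<zeta> = (\<lambda>y. y + v) ` direction \<zeta>)"


section \<open>Measures\<close>

text \<open>All integrals below are taken with respect to complete measures, so that they are Lebesgue
  integrals in the usual sense: an integrand need only agree almost everywhere with a
  Borel function.\<close>

definition orthonormal_basis_of :: "(real^'n) set \<Rightarrow> (real^'n) set \<Rightarrow> bool" where
  "orthonormal_basis_of B \<eta> \<longleftrightarrow> pairwise orthogonal B \<and> (\<forall>b\<in>B. norm b = 1) \<and> span B = \<eta>"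

text \<open>Euclidean (Lebesgue) measure on an affine plane: the image of Lebesgue measure on the coordinate
  space \<open>\<real>\<^sup>B\<close> under the isometry given by an orthonormal basis \<open>B\<close> of the direction. It does not
  depend on the choice of \<open>B\<close>.\<close>

definition plane_measure :: "(real^'n) set \<Rightarrow> (real^'n) measure" where
  "plane_measure \<zeta> =
    (let B = (SOME B. orthonormal_basis_of B (direction \<zeta>))
     in completion (distr (Pi\<^sub>M B (\<lambda>_. lborel)) (restrict_space borel \<zeta>)
          (\<lambda>c. (\<Sum>b\<in>B. c b *\<^sub>R b) + offset \<zeta>)))"

definition orthogonal_group_borel :: "(real^'n^'n) measure" where
  "orthogonal_group_borel = restrict_space borel {\<gamma>. orthogonal_matrix \<gamma>}"

text \<open>The invariant probability measure on \<open>O(n)\<close>.\<close>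

definition orthogonal_haar_borel :: "(real^'n^'n) measure" where
  "orthogonal_haar_borel = (THE \<mu>. prob_space \<mu> \<and> sets \<mu> = sets orthogonal_group_borel \<and>
     (\<forall>\<gamma>. orthogonal_matrix \<gamma> \<longrightarrow>
        distr \<mu> \<mu> (\<lambda>\<rho>. \<gamma> ** \<rho>) = \<mu> \<and> distr \<mu> \<mu> (\<lambda>\<rho>. \<rho> ** \<gamma>) = \<mu>))"

definition orthogonal_haar :: "(real^'n^'n) measure" where
  "orthogonal_haar = completion orthogonal_haar_borel"

text \<open>The Grassmannian carries the topology obtained by identifying a subspace with the matrix of the
  orthogonal projection onto it; this is its usual manifold topology, and we use its
  Borel sets.\<close>

definition grassmannian_borel :: "nat \<Rightarrow> (real^'n) set \<Rightarrow> (real^'n) set measure" where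
  "grassmannian_borel k W =
     vimage_algebra (grassmannian_in k W) (\<lambda>\<xi>. matrix (closest_point \<xi>)) borel"

text \<open>The probability measure on the Grassmannian of \<open>W\<close> invariant under the orthogonal group of \<open>W\<close>.
  Orthogonal maps of \<open>W\<close> are the restrictions to \<open>W\<close> of those orthogonal maps of the ambient space
  that preserve \<open>W\<close>.\<close>

definition grassmannian_measure_borel :: "nat \<Rightarrow> (real^'n) set \<Rightarrow> (real^'n) set measure" where
  "grassmannian_measure_borel k W =
     (THE \<mu>. prob_space \<mu> \<and> sets \<mu> = sets (grassmannian_borel k W) \<and>
        (\<forall>\<gamma>. orthogonal_matrix \<gamma> \<and> (*v) \<gamma> ` W = W \<longrightarrow> distr \<mu> \<mu> (\<lambda>\<xi>. (*v) \<gamma> ` \<xi>) = \<mu>))"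

definition grassmannian_measure :: "nat \<Rightarrow> (real^'n) set \<Rightarrow> (real^'n) set measure" where
  "grassmannian_measure k W = completion (grassmannian_measure_borel k W)"


section \<open>Radon transforms and Riesz potentials\<close>

text \<open>Functions on the manifold of affine \<open>k\<close>-planes are functions on sets, left undefined outside
  \<^term>\<open>affine_planes k\<close>.\<close>

definition plane_transform ::
    "nat \<Rightarrow> (real^'n \<Rightarrow> complex) \<Rightarrow> (real^'n) set \<Rightarrow> complex" where
  "plane_transform k h = (\<lambda>\<zeta>\<in>affine_planes k. \<integral>y. h y \<partial>plane_measure \<zeta>)"

text \<open>The \<open>k\<close>-dimensional linear subspace \<open>\<eta>\<^sub>0\<close>, whose choice is immaterial, is a parameter.\<close>

definition dual_plane_transform ::
    "(real^'n) set \<Rightarrow> ((real^'n) set \<Rightarrow> complex) \<Rightarrow> real^'n \<Rightarrow> complex" where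
  "dual_plane_transform \<eta>\<^sub>0 \<phi> x = (\<integral>\<gamma>. \<phi> ((\<lambda>y. \<gamma> *v y + x) ` \<eta>\<^sub>0) \<partial>orthogonal_haar)"

text \<open>Maps functions on affine \<open>j\<close>-planes to functions on affine \<open>k\<close>-planes.\<close>

definition mixed_radon_transform ::
    "nat \<Rightarrow> nat \<Rightarrow> ((real^'n) set \<Rightarrow> complex) \<Rightarrow> (real^'n) set \<Rightarrow> complex" where
  "mixed_radon_transform j k f = (\<lambda>\<zeta>\<in>affine_planes k.
     let \<eta> = direction \<zeta>; v = offset \<zeta>
     in \<integral>\<xi>. (\<integral>u. f ((\<lambda>y. y + u + v) ` \<xi>) \<partial>plane_measure \<eta>) \<partial>grassmannian_measure j (\<eta>\<^sup>\<bottom>))"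

definition riesz_kernel :: "real \<Rightarrow> real^'n \<Rightarrow> real" where
  "riesz_kernel \<alpha> y = 1 / norm y powr (real CARD('n) - \<alpha>)"

definition riesz_constant :: "nat \<Rightarrow> real \<Rightarrow> real" where
  "riesz_constant n \<alpha> =
     2 powr \<alpha> * pi powr (real n / 2) * Gamma (\<alpha> / 2) / Gamma ((real n - \<alpha>) / 2)"

definition riesz_potential_exists ::
    "real \<Rightarrow> (real^'n \<Rightarrow> complex) \<Rightarrow> real^'n \<Rightarrow> bool" where
  "riesz_potential_exists \<alpha> h x \<longleftrightarrow> integrable lebesgue (\<lambda>y. riesz_kernel \<alpha> (x - y) *\<^sub>R h y)"

definition riesz_potential ::
    "real \<Rightarrow> (real^'n \<Rightarrow> complex) \<Rightarrow> real^'n \<Rightarrow> complex" where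
  "riesz_potential \<alpha> h x =
     (1 / riesz_constant CARD('n) \<alpha>) *\<^sub>R (\<integral>y. riesz_kernel \<alpha> (x - y) *\<^sub>R h y \<partial>lebesgue)"

end

theory Submission
  imports Defs
begin

text \<open>
  Unfolding the transforms at \<open>x\<close> yields an average over \<open>\<gamma> \<in> O(n)\<close> and over
  \<open>\<xi> \<in> G\<^sub>j(\<eta>\<^sub>0\<^sup>\<bottom>)\<close> of the integral of \<open>h(x + \<gamma>z)\<close> over the \<open>(j + k)\<close>-dimensional subspace
  \<open>\<eta>\<^sub>0 + \<xi>\<close>. For fixed \<open>\<xi>\<close>, averaging over \<open>\<gamma>\<close> first leaves a radial function of \<open>z\<close>, and in polar
  coordinates the Lebesgue measure of a \<open>d\<close>-dimensional subspace and \<open>|y|\<^sup>d\<^sup>-\<^sup>n dy\<close> on \<open>\<real>\<^sup>n\<close> have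
  proportional radial parts, with ratio \<open>d \<omega>\<^sub>d / (n \<omega>\<^sub>n)\<close> for the unit ball volumes \<open>\<omega>\<close>. The result
  depends neither on \<open>\<xi>\<close> nor on the roles of \<open>j\<close> and \<open>k\<close>.

  Haar measure on the orthogonal maps fixing a set \<open>V\<close> pointwise is built by adding one unit vector
  \<open>e \<bottom> V\<close> at a time: if \<open>v\<close> is uniform on the unit sphere of \<open>V\<^sup>\<bottom>\<close> and \<open>\<rho>\<close> is a Haar random element
  of the stabilizer of \<open>e\<close>, then \<open>\<rho>\<close> followed by the reflection exchanging \<open>e\<close> and \<open>v\<close> is a Haar
  random element.
\<close>

section \<open>Orthogonal projections\<close>

text \<open>Three obstacles shape the argument. The Haar and Grassmannian measures are definite
  descriptions, so existence and uniqueness must be proved before anything can be said of them. The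
  Grassmannian in the mixed transform sits in the orthogonal complement of the rotated plane and so
  moves with the rotation; covariance brings it back to
  \<open>\<eta>\<^sub>0\<^sup>\<bottom>\<close>, and only then is there one product space on which
  Fubini applies, joint measurability coming from projection matrices. Finally, \<open>h\<close>
  need not be Borel, and a Lebesgue null set of the whole space may contain entire planes. So
  \<open>h\<close> is replaced by a Borel \<open>h0\<close> off a Borel null set \<open>N\<close>,
  and the averaging identity is first applied to a function that is \<infinity> on \<open>N\<close>:
  finiteness shows that almost every one of the averaged planes through \<open>x\<close> meets
  \<open>N\<close> in a null set and integrates \<open>h0\<close> absolutely. The constant
  \<open>c\<close> is the ratio from polar coordinates at d = j + k times the normalization of the
  Riesz potential.\<close>

lemma closest_point_subspace:
  fixes S :: "'a::euclidean_space set"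
  assumes "subspace S"
  shows "closest_point S z \<in> S" and "z - closest_point S z \<in> S\<^sup>\<bottom>"
proof -
  have S: "closed S" "convex S" "S \<noteq> {}"
    using assms closed_subspace subspace_imp_convex subspace_0 by auto
  show mem: "closest_point S z \<in> S"
    using S by (simp add: closest_point_in_set)
  let ?p = "closest_point S z"
  have "inner y (z - ?p) = 0" if "y \<in> S" for y
  proof -
    \<comment> \<open>The variational inequality for the nearest point, tested at
      \<open>?p + y\<close> and \<open>?p - y\<close>, bounds the inner product from both
      sides.\<close>
    have "inner (z - ?p) ((?p + y) - ?p) \<le> 0" "inner (z - ?p) ((?p - y) - ?p) \<le> 0"
      using S that mem by (intro closest_point_dot subspace_add[OF assms] subspace_diff[OF assms]; simp)+
    then show ?thesis by (simp add: inner_commute)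
  qed
  then show "z - ?p \<in> S\<^sup>\<bottom>"
    by (simp add: orthogonal_comp_def orthogonal_def)
qed

lemma closest_point_subspace_unique:
  fixes S :: "'a::euclidean_space set"
  assumes "subspace S" "a \<in> S" "z - a \<in> S\<^sup>\<bottom>"
  shows "closest_point S z = a"
proof -
  let ?p = "closest_point S z"
  have 1: "?p - a \<in> S"
    using assms closest_point_subspace subspace_diff by blast
  have "(z - a) - (z - ?p) \<in> S\<^sup>\<bottom>"
    using assms closest_point_subspace subspace_diff subspace_orthogonal_comp by blast
  then have "?p - a \<in> S\<^sup>\<bottom>" by simp
  with 1 have "orthogonal (?p - a) (?p - a)"
    by (auto simp: orthogonal_comp_def)
  then show ?thesis by (simp add: orthogonal_self)
qed

lemma linear_closest_point:
  fixes S :: "'a::euclidean_space set"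
  assumes "subspace S"
  shows "linear (closest_point S)"
proof (rule linearI)
  note p = closest_point_subspace[OF assms] and o = subspace_orthogonal_comp[of S]
  fix x y :: 'a and c :: real
  have "(x - closest_point S x) + (y - closest_point S y) \<in> S\<^sup>\<bottom>"
    by (intro subspace_add o p)
  then show "closest_point S (x + y) = closest_point S x + closest_point S y"
    by (intro closest_point_subspace_unique assms subspace_add p) (simp add: algebra_simps)
  have "c *\<^sub>R (x - closest_point S x) \<in> S\<^sup>\<bottom>"
    by (intro subspace_scale o p)
  then show "closest_point S (c *\<^sub>R x) = c *\<^sub>R closest_point S x"
    by (intro closest_point_subspace_unique assms subspace_scale p) (simp add: algebra_simps)
qed

lemma matrix_closest_point:
  fixes S :: "(real^'n) set"
  shows "subspace S \<Longrightarrow> matrix (closest_point S) *v z = closest_point S z"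
  by (simp add: linear_closest_point matrix_works)

lemma closest_point_sum:
  fixes S :: "'a::euclidean_space set"
  assumes "subspace S" "a \<in> S" "b \<in> S\<^sup>\<bottom>"
  shows "closest_point S (a + b) = a"
  using assms by (intro closest_point_subspace_unique) auto

lemma subspace_set_plus:
  fixes S :: "'a::euclidean_space set"
  shows "subspace S \<Longrightarrow> subspace T \<Longrightarrow> subspace (S + T)"
proof -
  assume "subspace S" "subspace T"
  moreover have "S + T = {x + y |x y. x \<in> S \<and> y \<in> T}"
    by (auto simp: set_plus_def)
  ultimately show ?thesis using subspace_sums by simp
qed

lemma closest_point_set_plus:
  fixes S :: "'a::euclidean_space set"
  assumes S: "subspace S" and T: "subspace T" and ST: "T \<subseteq> S\<^sup>\<bottom>"
  shows "closest_point (S + T) z = closest_point S z + closest_point T z"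
proof (rule closest_point_subspace_unique)
  show "subspace (S + T)" using S T by (rule subspace_set_plus)
  note p = closest_point_subspace[OF S, of z] and q = closest_point_subspace[OF T, of z]
  show "closest_point S z + closest_point T z \<in> S + T"
    using p q by auto
  show "z - (closest_point S z + closest_point T z) \<in> (S + T)\<^sup>\<bottom>"
    unfolding orthogonal_comp_def
  proof (intro CollectI ballI)
    fix y assume "y \<in> S + T"
    then obtain s t where st: "s \<in> S" "t \<in> T" "y = s + t" by (auto elim: set_plus_elim)
    have "orthogonal s (z - closest_point S z)" "orthogonal t (z - closest_point T z)"
      "orthogonal s (closest_point T z)" "orthogonal (closest_point S z) t"
      using st p q ST by (auto simp: orthogonal_comp_def)
    then show "orthogonal y (z - (closest_point S z + closest_point T z))"
      by (simp add: st orthogonal_def algebra_simps inner_commute)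
  qed
qed

lemma orthogonal_comp_image:
  fixes f :: "'a::euclidean_space \<Rightarrow> 'a"
  assumes f: "orthogonal_transformation f"
  shows "(f ` S)\<^sup>\<bottom> = f ` (S\<^sup>\<bottom>)"
proof
  show "f ` (S\<^sup>\<bottom>) \<subseteq> (f ` S)\<^sup>\<bottom>"
    using f by (auto simp: orthogonal_comp_def orthogonal_def orthogonal_transformation_def)
  show "(f ` S)\<^sup>\<bottom> \<subseteq> f ` (S\<^sup>\<bottom>)"
  proof
    fix x assume "x \<in> (f ` S)\<^sup>\<bottom>"
    obtain z where z: "x = f z"
      using orthogonal_transformation_surj[OF f] by (metis surjD)
    have "orthogonal y z" if "y \<in> S" for y
      using \<open>x \<in> (f ` S)\<^sup>\<bottom>\<close> that f
      by (auto simp: z orthogonal_comp_def orthogonal_def orthogonal_transformation_def)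
    then show "x \<in> f ` (S\<^sup>\<bottom>)" by (auto simp: z orthogonal_comp_def)
  qed
qed

lemma closest_point_image:
  fixes f :: "'a::euclidean_space \<Rightarrow> 'a"
  assumes f: "orthogonal_transformation f" and S: "subspace S"
  shows "closest_point (f ` S) (f z) = f (closest_point S z)"
proof (rule closest_point_subspace_unique)
  have l: "linear f" using f by (simp add: orthogonal_transformation_def)
  show "subspace (f ` S)" using l S by (rule linear_subspace_image)
  show "f (closest_point S z) \<in> f ` S" using closest_point_subspace[OF S] by blast
  show "f z - f (closest_point S z) \<in> (f ` S)\<^sup>\<bottom>"
    using closest_point_subspace[OF S] l by (auto simp: orthogonal_comp_image[OF f] linear_diff[symmetric])
qed

section \<open>Lebesgue measure on a subspace\<close>

text \<open>Normalized Haar measure of \<open>S\<close>, stored as a Borel measure on the ambient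
  space so that all subspaces share one \<sigma>-algebra. Prescribing balls of every positive radius
  fixes the scale, yields \<sigma>-finiteness and later the radial distribution.\<close>

definition subspace_haar :: "'a::euclidean_space set \<Rightarrow> 'a measure \<Rightarrow> bool" where
  "subspace_haar S \<mu> \<longleftrightarrow> sets \<mu> = sets borel \<and> (AE x in \<mu>. x \<in> S) \<and>
     (\<forall>a\<in>S. distr \<mu> borel ((+) a) = \<mu>) \<and>
     (\<forall>r>0. emeasure \<mu> (cball 0 r) = ennreal (unit_ball_vol (real (dim S)) * r ^ dim S))"

section \<open>Uniqueness of the invariant measure on a subspace\<close>

lemma subspace_haar_sigma_finite:
  assumes "subspace_haar S \<mu>"
  shows "sigma_finite_measure \<mu>"
proof
  have sets: "sets \<mu> = sets borel" and fin: "\<And>r. r > 0 \<Longrightarrow> emeasure \<mu> (cball 0 r) \<noteq> \<infinity>"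
    using assms by (auto simp: subspace_haar_def)
  let ?A = "range (\<lambda>n. cball 0 (real (Suc n)) :: 'a set)"
  have "\<exists>n. norm x \<le> real (Suc n)" for x :: 'a
    by (meson Suc_leD of_nat_mono order.trans reals_Archimedean2 less_imp_le le_SucI nle_le)
  then have "\<Union> ?A = space \<mu>"
    using sets_eq_imp_space_eq[OF sets] by auto
  then show "\<exists>A. countable A \<and> A \<subseteq> sets \<mu> \<and> \<Union> A = space \<mu> \<and> (\<forall>a\<in>A. emeasure \<mu> a \<noteq> \<infinity>)"
    using fin sets by (intro exI[of _ ?A]) auto
qed

text \<open>The Fubini argument behind uniqueness of Haar measure: \<open>y\<close> is shifted by
  \<open>x\<close>, the order is exchanged, \<open>x\<close> is shifted by \<open>- y\<close>, and
  after a second exchange evenness turns \<open>f (x - y)\<close> into \<open>f (y - x)\<close>,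
  where \<open>y\<close> is shifted back. Each shift uses the invariance of one measure
  only.\<close>

lemma translation_invariant_exchange:
  fixes \<mu> \<nu> :: "'a::euclidean_space measure"
  assumes "sigma_finite_measure \<mu>" "sigma_finite_measure \<nu>"
    and sets [measurable_cong]: "sets \<mu> = sets borel" "sets \<nu> = sets borel"
    and AE: "AE x in \<mu>. x \<in> S" "AE x in \<nu>. x \<in> S"
    and tr: "\<And>a. a \<in> S \<Longrightarrow> distr \<mu> borel ((+) a) = \<mu>" "\<And>a. a \<in> S \<Longrightarrow> distr \<nu> borel ((+) a) = \<nu>"
    and S: "\<And>a. a \<in> S \<Longrightarrow> - a \<in> S"
    and f [measurable]: "f \<in> borel_measurable borel" and g [measurable]: "g \<in> borel_measurable borel"
    and even: "\<And>x. f (- x) = f x"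
  shows "(\<integral>\<^sup>+x. f x \<partial>\<mu>) * (\<integral>\<^sup>+x. g x \<partial>\<nu>) = (\<integral>\<^sup>+x. g x \<partial>\<mu>) * (\<integral>\<^sup>+x. f x \<partial>\<nu>)"
proof -
  interpret \<mu>: sigma_finite_measure \<mu> by fact
  interpret \<nu>: sigma_finite_measure \<nu> by fact
  interpret pair_sigma_finite \<mu> \<nu> ..
  have t\<mu>: "(\<integral>\<^sup>+x. F (x + a) \<partial>\<mu>) = (\<integral>\<^sup>+x. F x \<partial>\<mu>)" if "a \<in> S" and [measurable]: "F \<in> borel_measurable borel" for F a
    by (subst tr(1)[OF \<open>a \<in> S\<close>, symmetric], subst nn_integral_distr) (auto simp: add.commute)
  have t\<nu>: "(\<integral>\<^sup>+x. F (x + a) \<partial>\<nu>) = (\<integral>\<^sup>+x. F x \<partial>\<nu>)" if "a \<in> S" and [measurable]: "F \<in> borel_measurable borel" for F a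
    by (subst tr(2)[OF \<open>a \<in> S\<close>, symmetric], subst nn_integral_distr) (auto simp: add.commute)
  have "(\<integral>\<^sup>+x. f x \<partial>\<mu>) * (\<integral>\<^sup>+x. g x \<partial>\<nu>) = (\<integral>\<^sup>+x. (\<integral>\<^sup>+y. f x * g y \<partial>\<nu>) \<partial>\<mu>)"
    by (simp add: nn_integral_cmult nn_integral_multc)
  also have "\<dots> = (\<integral>\<^sup>+x. (\<integral>\<^sup>+y. f x * g (y + x) \<partial>\<nu>) \<partial>\<mu>)"
  proof (rule nn_integral_cong_AE)
    show "AE x in \<mu>. (\<integral>\<^sup>+y. f x * g y \<partial>\<nu>) = (\<integral>\<^sup>+y. f x * g (y + x) \<partial>\<nu>)"
      using AE(1) by eventually_elim (rule t\<nu>[symmetric], auto)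
  qed
  also have "\<dots> = (\<integral>\<^sup>+y. (\<integral>\<^sup>+x. f x * g (y + x) \<partial>\<mu>) \<partial>\<nu>)"
    by (rule Fubini'[symmetric]) measurable
  also have "\<dots> = (\<integral>\<^sup>+y. (\<integral>\<^sup>+x. f (x - y) * g x \<partial>\<mu>) \<partial>\<nu>)"
  proof (rule nn_integral_cong_AE)
    show "AE y in \<nu>. (\<integral>\<^sup>+x. f x * g (y + x) \<partial>\<mu>) = (\<integral>\<^sup>+x. f (x - y) * g x \<partial>\<mu>)"
      using AE(2)
    proof eventually_elim
      case (elim y)
      have "(\<integral>\<^sup>+x. f (x - y) * g x \<partial>\<mu>) = (\<integral>\<^sup>+x. (\<lambda>x. f x * g (y + x)) (x + - y) \<partial>\<mu>)" by simp
      also have "\<dots> = (\<integral>\<^sup>+x. f x * g (y + x) \<partial>\<mu>)" using S[OF elim] by (intro t\<mu>) auto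
      finally show ?case ..
    qed
  qed
  also have "\<dots> = (\<integral>\<^sup>+x. (\<integral>\<^sup>+y. f (x - y) * g x \<partial>\<nu>) \<partial>\<mu>)"
    by (rule Fubini') measurable
  also have "\<dots> = (\<integral>\<^sup>+x. (\<integral>\<^sup>+y. f y * g x \<partial>\<nu>) \<partial>\<mu>)"
  proof (rule nn_integral_cong_AE)
    show "AE x in \<mu>. (\<integral>\<^sup>+y. f (x - y) * g x \<partial>\<nu>) = (\<integral>\<^sup>+y. f y * g x \<partial>\<nu>)"
      using AE(1)
    proof eventually_elim
      case (elim x)
      have "(\<integral>\<^sup>+y. f (x - y) * g x \<partial>\<nu>) = (\<integral>\<^sup>+y. (\<lambda>y. f y * g x) (y + - x) \<partial>\<nu>)"
        using even by (metis (no_types, lifting) minus_diff_eq diff_conv_add_uminus)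
      also have "\<dots> = (\<integral>\<^sup>+y. f y * g x \<partial>\<nu>)" using S[OF elim] by (intro t\<nu>) auto
      finally show ?case .
    qed
  qed
  also have "\<dots> = (\<integral>\<^sup>+x. g x \<partial>\<mu>) * (\<integral>\<^sup>+x. f x \<partial>\<nu>)"
    by (simp add: nn_integral_cmult nn_integral_multc mult.commute)
  finally show ?thesis .
qed

text \<open>With the indicator of the unit ball as the even function, the exchange identity
  multiplies both measures by the same positive finite number, which cancels.\<close>

lemma subspace_haar_unique:
  assumes S: "subspace S" and \<mu>: "subspace_haar S \<mu>" and \<nu>: "subspace_haar S \<nu>"
  shows "\<mu> = \<nu>"
proof (rule measure_eqI)
  show sets: "sets \<mu> = sets \<nu>" using \<mu> \<nu> by (simp add: subspace_haar_def)
  fix A assume "A \<in> sets \<mu>"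
  then have A [measurable]: "A \<in> sets borel" using \<mu> by (simp add: subspace_haar_def)
  let ?w = "ennreal (unit_ball_vol (real (dim S)))"
  let ?f = "indicator (cball 0 1) :: 'a \<Rightarrow> ennreal"
  have eq: "(\<integral>\<^sup>+x. ?f x \<partial>\<mu>) * (\<integral>\<^sup>+x. indicator A x \<partial>\<nu>) = (\<integral>\<^sup>+x. indicator A x \<partial>\<mu>) * (\<integral>\<^sup>+x. ?f x \<partial>\<nu>)"
    using \<mu> \<nu> S subspace_haar_sigma_finite
    by (intro translation_invariant_exchange[where S = S])
       (auto simp: subspace_haar_def subspace_neg indicator_def)
  have "(\<integral>\<^sup>+x. ?f x \<partial>\<mu>) = ?w" "(\<integral>\<^sup>+x. ?f x \<partial>\<nu>) = ?w"
    using \<mu> \<nu> by (auto simp: subspace_haar_def)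
  with eq have "?w * emeasure \<nu> A = ?w * emeasure \<mu> A"
    using \<mu> \<nu> by (simp add: subspace_haar_def mult.commute)
  moreover have "?w \<noteq> 0" "?w \<noteq> top"
    using unit_ball_vol_pos[of "real (dim S)"] by (auto simp: ennreal_eq_0_iff not_le simp del: unit_ball_vol_pos)
  ultimately show "emeasure \<mu> A = emeasure \<nu> A"
    by (simp add: ennreal_mult_cancel_left)
qed

text \<open>Translation by \<open>f a\<close> after \<open>f\<close> is \<open>f\<close> after
  translation by \<open>a\<close>, and \<open>f\<close> preserves centred balls and
  dimension.\<close>

lemma subspace_haar_image:
  fixes f :: "'a::euclidean_space \<Rightarrow> 'a"
  assumes f: "orthogonal_transformation f" and S: "subspace S" and \<mu>: "subspace_haar S \<mu>"
  shows "subspace_haar (f ` S) (distr \<mu> borel f)"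
proof -
  have l: "linear f" using f by (simp add: orthogonal_transformation_def)
  have [measurable]: "f \<in> borel_measurable borel"
    using l by (intro borel_measurable_continuous_onI linear_continuous_on) (simp add: linear_conv_bounded_linear)
  have sets [measurable_cong]: "sets \<mu> = sets borel" using \<mu> by (simp add: subspace_haar_def)
  have inj: "inj f" using f orthogonal_transformation_inj by blast
  have d: "dim (f ` S) = dim S" using l inj dim_image_eq by (metis inj_on_subset top_greatest)
  have "distr (distr \<mu> borel f) borel ((+) (f a)) = distr \<mu> borel f" if "a \<in> S" for a
  proof -
    have "distr (distr \<mu> borel f) borel ((+) (f a)) = distr (distr \<mu> borel ((+) a)) borel f"
      by (subst (1 2) distr_distr) (auto simp: o_def linear_add[OF l] cong: distr_cong)
    then show ?thesis using \<mu> that by (simp add: subspace_haar_def)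
  qed
  moreover have "emeasure (distr \<mu> borel f) (cball 0 r) = emeasure \<mu> (cball 0 r)" for r
  proof -
    have "f -` cball 0 r = cball 0 r"
      using orthogonal_transformation_norm[OF f] by auto
    then show ?thesis using sets_eq_imp_space_eq[OF sets] by (subst emeasure_distr) auto
  qed
  moreover have "AE y in distr \<mu> borel f. y \<in> f ` S"
  proof -
    have [measurable]: "f ` S \<in> sets borel"
      using l S by (intro borel_closed closed_subspace linear_subspace_image)
    have "AE x in \<mu>. f x \<in> f ` S"
      using \<mu> by (auto simp: subspace_haar_def)
    then show ?thesis by (subst AE_distr_iff) auto
  qed
  ultimately show ?thesis
    using \<mu> by (auto simp: subspace_haar_def d)
qed

lemma subspace_haar_lborel: "subspace_haar UNIV (lborel :: 'a::euclidean_space measure)"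
  unfolding subspace_haar_def
  by (auto simp: lborel_distr_plus emeasure_cball dim_UNIV)

lemma distr_lborel_orthogonal_transformation:
  fixes f :: "'a::euclidean_space \<Rightarrow> 'a"
  assumes "orthogonal_transformation f"
  shows "distr lborel borel f = lborel"
proof -
  have "subspace_haar UNIV (distr lborel borel f)"
    using subspace_haar_image[OF assms subspace_UNIV subspace_haar_lborel]
    by (simp add: orthogonal_transformation_surj[OF assms])
  then show ?thesis
    by (rule subspace_haar_unique[OF subspace_UNIV _ subspace_haar_lborel])
qed

section \<open>Orthonormal coordinates on a subspace\<close>

definition basis_lborel :: "(real^'n) set \<Rightarrow> (real^'n) measure" where
  "basis_lborel B = distr (Pi\<^sub>M B (\<lambda>_. lborel)) borel (\<lambda>c. \<Sum>b\<in>B. c b *\<^sub>R b)"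

text \<open>The choice of basis is the one made in \<open>plane_measure\<close>, so that the two
  measures match directly; by uniqueness every other orthonormal basis gives the same
  measure.\<close>

definition subspace_lborel :: "(real^'n) set \<Rightarrow> (real^'n) measure" where
  "subspace_lborel S = basis_lborel (SOME B. orthonormal_basis_of B S)"

lemma orthonormal_basis_of_exists:
  assumes "subspace S"
  shows "\<exists>B. orthonormal_basis_of B S"
  using orthonormal_basis_subspace[OF assms] unfolding orthonormal_basis_of_def by metis

lemma orthonormal_basis_of_card:
  assumes "orthonormal_basis_of B S"
  shows "finite B" and "card B = dim S"
proof -
  have "independent B"
    using assms pairwise_orthogonal_independent[of B] by (force simp: orthonormal_basis_of_def)
  then show "finite B" "card B = dim S"
    using assms by (auto simp: orthonormal_basis_of_def independent_imp_finite dim_eq_card_independent)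
qed

lemma orthonormal_basis_of_inner:
  assumes "orthonormal_basis_of B S" "b \<in> B" "c \<in> B"
  shows "b \<bullet> c = (if b = c then 1 else 0)"
  using assms by (auto simp: orthonormal_basis_of_def pairwise_def orthogonal_def norm_eq_1)

lemma orthonormal_basis_of_expansion:
  assumes B: "orthonormal_basis_of B S" and "x \<in> S"
  shows "(\<Sum>b\<in>B. (x \<bullet> b) *\<^sub>R b) = x"
proof -
  have fin: "finite B" using orthonormal_basis_of_card[OF B] by simp
  then obtain u where u: "x = (\<Sum>b\<in>B. u b *\<^sub>R b)"
    using assms span_finite[OF fin] by (auto simp: orthonormal_basis_of_def)
  have "x \<bullet> b = u b" if "b \<in> B" for b
  proof -
    have "x \<bullet> b = (\<Sum>c\<in>B. if c = b then u c else 0)"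
      unfolding u inner_sum_left using orthonormal_basis_of_inner[OF B _ that]
      by (intro sum.cong) auto
    then show ?thesis using fin that by (simp add: sum.delta')
  qed
  then have "(\<Sum>b\<in>B. (x \<bullet> b) *\<^sub>R b) = (\<Sum>b\<in>B. u b *\<^sub>R b)"
    by (intro sum.cong) auto
  then show ?thesis using u by metis
qed

lemma orthonormal_basis_of_norm:
  assumes B: "orthonormal_basis_of B S"
  shows "norm (\<Sum>b\<in>B. c b *\<^sub>R b) = sqrt (\<Sum>b\<in>B. (c b)\<^sup>2)"
proof -
  have fin: "finite B" using orthonormal_basis_of_card[OF B] by simp
  have "(norm (\<Sum>b\<in>B. c b *\<^sub>R b))\<^sup>2 = (\<Sum>b\<in>B. (norm (c b *\<^sub>R b))\<^sup>2)"
  proof (rule norm_sum_Pythagorean[OF fin])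
    show "pairwise (\<lambda>i j. orthogonal (c i *\<^sub>R i) (c j *\<^sub>R j)) B"
      using orthonormal_basis_of_inner[OF B] by (simp add: pairwise_def orthogonal_def)
  qed
  also have "\<dots> = (\<Sum>b\<in>B. (c b)\<^sup>2)"
    using orthonormal_basis_of_inner[OF B] by (intro sum.cong) (auto simp: norm_eq_sqrt_inner)
  finally show ?thesis by (simp add: real_sqrt_unique)
qed

interpretation lborel_product: product_sigma_finite "\<lambda>_. lborel :: real measure" ..

text \<open>Boxes determine the product measure. The restriction to \<open>B\<close> keeps the
  shifted tuple extensional, as points of the product space must be.\<close>

lemma PiM_lborel_translation:
  assumes "finite B"
  shows "distr (Pi\<^sub>M B (\<lambda>_. lborel)) (Pi\<^sub>M B (\<lambda>_. lborel)) (\<lambda>c. \<lambda>b\<in>B. a b + c b) = Pi\<^sub>M B (\<lambda>_. lborel :: real measure)"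
proof (rule lborel_product.PiM_eqI)
  fix A :: "'a \<Rightarrow> real set" assume A: "\<And>i. i \<in> B \<Longrightarrow> A i \<in> sets lborel"
  have *: "(+) (a i) -` A i \<in> sets lborel" if "i \<in> B" for i
    using measurable_sets_borel[of "(+) (a i)" borel "A i"] A[OF that] by auto
  have "(\<lambda>c. \<lambda>b\<in>B. a b + c b) -` Pi\<^sub>E B A \<inter> space (Pi\<^sub>M B (\<lambda>_. lborel)) = Pi\<^sub>E B (\<lambda>b. (+) (a b) -` A b)"
    by (auto simp: space_PiM PiE_iff)
  then have "emeasure (distr (Pi\<^sub>M B (\<lambda>_. lborel)) (Pi\<^sub>M B (\<lambda>_. lborel)) (\<lambda>c. \<lambda>b\<in>B. a b + c b)) (Pi\<^sub>E B A)
      = emeasure (Pi\<^sub>M B (\<lambda>_. lborel)) (Pi\<^sub>E B (\<lambda>b. (+) (a b) -` A b))"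
    using A assms by (subst emeasure_distr) (auto intro!: sets_PiM_I_finite)
  also have "\<dots> = (\<Prod>b\<in>B. emeasure lborel ((+) (a b) -` A b))"
    using * assms by (intro lborel_product.emeasure_PiM) auto
  also have "\<dots> = (\<Prod>b\<in>B. emeasure lborel (A b))"
  proof (intro prod.cong refl)
    fix b assume "b \<in> B"
    then have "emeasure (distr lborel borel ((+) (a b))) (A b) = emeasure lborel ((+) (a b) -` A b)"
      using A by (subst emeasure_distr) auto
    then show "emeasure lborel ((+) (a b) -` A b) = emeasure lborel (A b)"
      by (simp add: lborel_distr_plus)
  qed
  finally show "emeasure (distr (Pi\<^sub>M B (\<lambda>_. lborel)) (Pi\<^sub>M B (\<lambda>_. lborel)) (\<lambda>c. \<lambda>b\<in>B. a b + c b)) (Pi\<^sub>E B A)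
      = (\<Prod>b\<in>B. emeasure lborel (A b))" .
qed (use assms in auto)

text \<open>In orthonormal coordinates a translation along \<open>S\<close> is a shift of the
  coordinate tuple, and the norm is the Euclidean norm of the tuple, so invariance and ball volumes
  come from the product measure.\<close>

lemma subspace_haar_basis_lborel:
  assumes B: "orthonormal_basis_of B S"
  shows "subspace_haar S (basis_lborel B)"
proof -
  have fin: "finite B" and card: "card B = dim S" using orthonormal_basis_of_card[OF B] by auto
  have S: "S = span B" using B by (simp add: orthonormal_basis_of_def)
  let ?P = "Pi\<^sub>M B (\<lambda>_. lborel :: real measure)"
  let ?s = "\<lambda>c. \<Sum>b\<in>B. c b *\<^sub>R b"
  have [measurable]: "?s \<in> borel_measurable ?P" by measurable
  have [measurable]: "S \<in> sets borel" unfolding S by (intro borel_closed closed_span)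
  have "AE x in basis_lborel B. x \<in> S"
    unfolding basis_lborel_def
    by (subst AE_distr_iff) (auto simp: S intro!: AE_I2 span_sum intro: span_scale span_base)
  moreover have "distr (basis_lborel B) borel ((+) a) = basis_lborel B" if "a \<in> S" for a
  proof -
    have "?s (\<lambda>b\<in>B. a \<bullet> b + c b) = a + ?s c" for c
    proof -
      have "?s (\<lambda>b\<in>B. a \<bullet> b + c b) = ?s (\<lambda>b. a \<bullet> b) + ?s c"
        by (simp add: sum.distrib[symmetric] scaleR_add_left[symmetric])
      then show ?thesis using orthonormal_basis_of_expansion[OF B that] by simp
    qed
    then have "distr (basis_lborel B) borel ((+) a) = distr (distr ?P ?P (\<lambda>c. \<lambda>b\<in>B. a \<bullet> b + c b)) borel ?s"
      unfolding basis_lborel_def by (subst (1 2) distr_distr) (auto simp: o_def)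
    then show ?thesis
      unfolding PiM_lborel_translation[OF fin] basis_lborel_def .
  qed
  moreover have "emeasure (basis_lborel B) (cball 0 r) = ennreal (unit_ball_vol (real (dim S)) * r ^ dim S)"
    if "r > 0" for r
  proof -
    have "emeasure (basis_lborel B) (cball 0 r) = emeasure ?P (?s -` cball 0 r \<inter> space ?P)"
      unfolding basis_lborel_def by (subst emeasure_distr) auto
    also have "?s -` cball 0 r \<inter> space ?P = {c. sqrt (\<Sum>b\<in>B. (c b)\<^sup>2) \<le> r} \<inter> space ?P"
      by (auto simp: orthonormal_basis_of_norm[OF B])
    finally show ?thesis using emeasure_cball_aux[OF fin that] card by simp
  qed
  moreover have "sets (basis_lborel B) = sets borel" by (simp add: basis_lborel_def)
  ultimately show ?thesis by (simp add: subspace_haar_def)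
qed

lemma subspace_haar_subspace_lborel: "subspace S \<Longrightarrow> subspace_haar S (subspace_lborel S)"
  unfolding subspace_lborel_def
  by (rule subspace_haar_basis_lborel, rule someI_ex, rule orthonormal_basis_of_exists)

lemma subspace_lborel_eqI: "subspace S \<Longrightarrow> subspace_haar S \<mu> \<Longrightarrow> subspace_lborel S = \<mu>"
  by (metis subspace_haar_unique subspace_haar_subspace_lborel)

lemma sets_subspace_lborel [simp, measurable_cong]: "sets (subspace_lborel S) = sets borel"
  by (simp add: subspace_lborel_def basis_lborel_def)

lemma space_subspace_lborel [simp]: "space (subspace_lborel S) = UNIV"
  by (simp add: subspace_lborel_def basis_lborel_def)

lemma AE_subspace_lborel_mem: "subspace S \<Longrightarrow> AE x in subspace_lborel S. x \<in> S"
  using subspace_haar_subspace_lborel by (auto simp: subspace_haar_def)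

lemma distr_subspace_lborel_translation:
  "subspace S \<Longrightarrow> a \<in> S \<Longrightarrow> distr (subspace_lborel S) borel ((+) a) = subspace_lborel S"
  using subspace_haar_subspace_lborel by (auto simp: subspace_haar_def)

lemma emeasure_subspace_lborel_cball:
  "subspace S \<Longrightarrow> r > 0 \<Longrightarrow> emeasure (subspace_lborel S) (cball 0 r) = ennreal (unit_ball_vol (real (dim S)) * r ^ dim S)"
  using subspace_haar_subspace_lborel by (auto simp: subspace_haar_def)

lemma sigma_finite_subspace_lborel: "subspace S \<Longrightarrow> sigma_finite_measure (subspace_lborel S)"
  by (metis subspace_haar_sigma_finite subspace_haar_subspace_lborel)

lemma subspace_lborel_UNIV: "subspace_lborel UNIV = lborel"
  by (intro subspace_lborel_eqI subspace_haar_lborel subspace_UNIV)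

lemma distr_subspace_lborel_image:
  fixes f :: "real^'n \<Rightarrow> real^'n"
  assumes "orthogonal_transformation f" "subspace S"
  shows "distr (subspace_lborel S) borel f = subspace_lborel (f ` S)"
proof (rule subspace_lborel_eqI[symmetric])
  show "subspace (f ` S)"
    using assms by (auto intro: linear_subspace_image simp: orthogonal_transformation_def)
  show "subspace_haar (f ` S) (distr (subspace_lborel S) borel f)"
    by (rule subspace_haar_image[OF assms subspace_haar_subspace_lborel[OF assms(2)]])
qed

text \<open>Orthonormal bases of orthogonal subspaces unite to an orthonormal basis of the sum, and
  a product measure over a disjoint union of index sets folds into an iterated integral.\<close>

lemma nn_integral_subspace_lborel_set_plus:
  assumes S: "subspace S" and T: "subspace T" and ST: "T \<subseteq> S\<^sup>\<bottom>"
    and [measurable]: "g \<in> borel_measurable borel"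
  shows "(\<integral>\<^sup>+z. g z \<partial>subspace_lborel (S + T)) = (\<integral>\<^sup>+x. (\<integral>\<^sup>+y. g (x + y) \<partial>subspace_lborel T) \<partial>subspace_lborel S)"
proof -
  obtain B C where B: "orthonormal_basis_of B S" and C: "orthonormal_basis_of C T"
    using orthonormal_basis_of_exists S T by blast
  have fin: "finite B" "finite C" using orthonormal_basis_of_card B C by auto
  have sub: "B \<subseteq> S" "C \<subseteq> T" using B C span_superset unfolding orthonormal_basis_of_def by blast+
  have orth: "orthogonal b c" if "b \<in> B" "c \<in> C" for b c
    using that ST sub unfolding orthogonal_comp_def by blast
  have disj: "B \<inter> C = {}"
  proof (rule ccontr)
    assume "B \<inter> C \<noteq> {}"
    then obtain b where "b \<in> B" "b \<in> C" by blast
    with orth[of b b] orthonormal_basis_of_inner[OF B, of b b] show False by (simp add: orthogonal_def)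
  qed
  have "S + T = span (B \<union> C)"
  proof -
    have "span B = S" "span C = T" using B C by (simp_all add: orthonormal_basis_of_def)
    then show ?thesis by (auto simp: span_Un set_plus_def)
  qed
  moreover have "pairwise orthogonal (B \<union> C)"
    using B C orth unfolding orthonormal_basis_of_def pairwise_def by (metis Un_iff orthogonal_commute)
  ultimately have BC: "orthonormal_basis_of (B \<union> C) (S + T)"
    using B C unfolding orthonormal_basis_of_def by blast
  have eq: "subspace_lborel (S + T) = basis_lborel (B \<union> C)" "subspace_lborel S = basis_lborel B"
    "subspace_lborel T = basis_lborel C"
    by (rule subspace_lborel_eqI subspace_set_plus subspace_haar_basis_lborel S T B C BC)+
  have m: "(\<Sum>b\<in>B \<union> C. merge B C (x, y) b *\<^sub>R b) = (\<Sum>b\<in>B. x b *\<^sub>R b) + (\<Sum>b\<in>C. y b *\<^sub>R b)" for x y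
  proof -
    have "(\<Sum>b\<in>B. merge B C (x, y) b *\<^sub>R b) = (\<Sum>b\<in>B. x b *\<^sub>R b)"
      "(\<Sum>b\<in>C. merge B C (x, y) b *\<^sub>R b) = (\<Sum>b\<in>C. y b *\<^sub>R b)"
      using disj by (auto intro!: sum.cong simp: merge_def)
    then show ?thesis using fin disj by (simp add: sum.union_disjoint)
  qed
  have [measurable]: "(\<lambda>x. (\<integral>\<^sup>+y. g (x + y) \<partial>basis_lborel C)) \<in> borel_measurable borel"
  proof -
    interpret sigma_finite_measure "basis_lborel C"
      using sigma_finite_subspace_lborel[OF T] by (simp add: eq)
    have [measurable_cong]: "sets (basis_lborel C) = sets borel" by (simp add: basis_lborel_def)
    show ?thesis by measurable
  qed
  have "(\<integral>\<^sup>+z. g z \<partial>basis_lborel (B \<union> C)) = (\<integral>\<^sup>+c. g (\<Sum>b\<in>B \<union> C. c b *\<^sub>R b) \<partial>Pi\<^sub>M (B \<union> C) (\<lambda>_. lborel))"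
    unfolding basis_lborel_def by (subst nn_integral_distr) auto
  also have "\<dots> = (\<integral>\<^sup>+x. (\<integral>\<^sup>+y. g ((\<Sum>b\<in>B. x b *\<^sub>R b) + (\<Sum>b\<in>C. y b *\<^sub>R b)) \<partial>Pi\<^sub>M C (\<lambda>_. lborel)) \<partial>Pi\<^sub>M B (\<lambda>_. lborel))"
    by (subst lborel_product.product_nn_integral_fold[OF disj fin]) (auto simp: m)
  also have "\<dots> = (\<integral>\<^sup>+x. (\<integral>\<^sup>+y. g ((\<Sum>b\<in>B. x b *\<^sub>R b) + y) \<partial>basis_lborel C) \<partial>Pi\<^sub>M B (\<lambda>_. lborel))"
    unfolding basis_lborel_def by (subst nn_integral_distr) auto
  also have "\<dots> = (\<integral>\<^sup>+x. (\<integral>\<^sup>+y. g (x + y) \<partial>basis_lborel C) \<partial>basis_lborel B)"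
    by (subst (2) basis_lborel_def, subst nn_integral_distr) auto
  finally show ?thesis by (simp add: eq)
qed

lemma dim_orthogonal_comp:
  fixes S :: "(real^'n) set"
  assumes "subspace S"
  shows "dim S + dim (S\<^sup>\<bottom>) = CARD('n)"
  using dim_subspace_orthogonal_to_vectors[OF assms subspace_UNIV]
  by (simp add: orthogonal_comp_def add.commute)

text \<open>Integrating over a cylinder around \<open>S\<close> exhibits the measure on \<open>S\<close> through the orthogonal
  projection alone, which makes its dependence on \<open>S\<close> measurable.\<close>

lemma nn_integral_subspace_lborel_eq_lborel:
  fixes S :: "(real^'n) set"
  assumes S: "subspace S" and g [measurable]: "g \<in> borel_measurable borel"
  shows "(\<integral>\<^sup>+z. g (closest_point S z) * indicator (cball 0 1) (z - closest_point S z) \<partial>lborel)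
    = ennreal (unit_ball_vol (real (CARD('n) - dim S))) * (\<integral>\<^sup>+x. g x \<partial>subspace_lborel S)"
proof -
  note o = subspace_orthogonal_comp[of S]
  have U: "S + S\<^sup>\<bottom> = UNIV" by (rule subspace_sum_orthogonal_comp[OF S])
  have [measurable]: "closest_point S \<in> borel_measurable borel"
    using linear_closest_point[OF S]
    by (intro borel_measurable_continuous_onI linear_continuous_on) (simp add: linear_conv_bounded_linear)
  have [measurable]: "(cball 0 1 :: (real^'n) set) \<in> sets borel" by simp
  have [measurable]: "(\<lambda>z. g (closest_point S z) * indicator (cball 0 1) (z - closest_point S z)) \<in> borel_measurable borel"
    by measurable
  have "(\<integral>\<^sup>+z. g (closest_point S z) * indicator (cball 0 1) (z - closest_point S z) \<partial>lborel)
     = (\<integral>\<^sup>+z. g (closest_point S z) * indicator (cball 0 1) (z - closest_point S z) \<partial>subspace_lborel (S + S\<^sup>\<bottom>))"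
    by (simp add: U subspace_lborel_UNIV)
  also have "\<dots> = (\<integral>\<^sup>+x. (\<integral>\<^sup>+y. g (closest_point S (x + y)) * indicator (cball 0 1) (x + y - closest_point S (x + y))
      \<partial>subspace_lborel (S\<^sup>\<bottom>)) \<partial>subspace_lborel S)"
    using S o by (subst nn_integral_subspace_lborel_set_plus) auto
  also have "\<dots> = (\<integral>\<^sup>+x. (\<integral>\<^sup>+y. g x * indicator (cball 0 1) y \<partial>subspace_lborel (S\<^sup>\<bottom>)) \<partial>subspace_lborel S)"
  proof (rule nn_integral_cong_AE)
    show "AE x in subspace_lborel S. (\<integral>\<^sup>+y. g (closest_point S (x + y)) * indicator (cball 0 1) (x + y - closest_point S (x + y)) \<partial>subspace_lborel (S\<^sup>\<bottom>))
       = (\<integral>\<^sup>+y. g x * indicator (cball 0 1) y \<partial>subspace_lborel (S\<^sup>\<bottom>))"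
      using AE_subspace_lborel_mem[OF S]
    proof eventually_elim
      case (elim x)
      show ?case
        using AE_subspace_lborel_mem[OF o]
        by (intro nn_integral_cong_AE) (auto elim!: eventually_mono simp: closest_point_sum[OF S elim])
    qed
  qed
  also have "\<dots> = (\<integral>\<^sup>+x. g x * ennreal (unit_ball_vol (real (CARD('n) - dim S))) \<partial>subspace_lborel S)"
  proof -
    have "dim (S\<^sup>\<bottom>) = CARD('n) - dim S" using dim_orthogonal_comp[OF S] by simp
    then show ?thesis
      using emeasure_subspace_lborel_cball[OF o, of 1] by (simp add: nn_integral_cmult)
  qed
  also have "\<dots> = ennreal (unit_ball_vol (real (CARD('n) - dim S))) * (\<integral>\<^sup>+x. g x \<partial>subspace_lborel S)"
    by (subst nn_integral_multc) (auto simp: mult.commute)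
  finally show ?thesis .
qed

section \<open>Haar measure on groups of orthogonal matrices\<close>

lemma orthogonal_matrix_imp_transformation:
  fixes \<gamma> :: "real^'n^'n"
  shows "orthogonal_matrix \<gamma> \<Longrightarrow> orthogonal_transformation ((*v) \<gamma>)"
  by (simp add: orthogonal_transformation_matrix)

section \<open>Measurable matrix operations and reflections\<close>

lemma borel_measurable_matrix_mult [measurable (raw)]:
  fixes f g :: "'a \<Rightarrow> real^'n^'n"
  assumes "f \<in> borel_measurable M" "g \<in> borel_measurable M"
  shows "(\<lambda>x. f x ** g x) \<in> borel_measurable M"
  using assms
proof (rule borel_measurable_continuous_Pair)
  show "continuous_on UNIV (\<lambda>x :: (real^'n^'n) \<times> (real^'n^'n). fst x ** snd x)"
    unfolding matrix_matrix_mult_def by (intro continuous_intros)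
qed

lemma borel_measurable_matrix_vector_mult [measurable (raw)]:
  fixes f :: "'a \<Rightarrow> real^'n^'n" and g :: "'a \<Rightarrow> real^'n"
  assumes "f \<in> borel_measurable M" "g \<in> borel_measurable M"
  shows "(\<lambda>x. f x *v g x) \<in> borel_measurable M"
  using assms
proof (rule borel_measurable_continuous_Pair)
  show "continuous_on UNIV (\<lambda>x :: (real^'n^'n) \<times> (real^'n). fst x *v snd x)"
    unfolding matrix_vector_mult_def by (intro continuous_intros)
qed

lemma borel_measurable_transpose [measurable (raw)]:
  fixes f :: "'a \<Rightarrow> real^'n^'n"
  assumes "f \<in> borel_measurable M"
  shows "(\<lambda>x. transpose (f x)) \<in> borel_measurable M"
proof -
  have "transpose \<in> borel_measurable (borel :: (real^'n^'n) measure)"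
    unfolding transpose_def by (intro borel_measurable_continuous_onI continuous_intros)
  then show ?thesis using assms by measurable
qed

text \<open>Householder reflection. For \<open>a = 0\<close> division by zero makes it the identity,
  so \<open>reflection (e - v)\<close> also covers \<open>e = v\<close>.\<close>

definition reflection :: "real^'n \<Rightarrow> real^'n^'n" where
  "reflection a = mat 1 - (2 / (a \<bullet> a)) *\<^sub>R (\<chi> i j. a $ i * a $ j)"

lemma reflection_mult: "reflection a *v z = z - (2 * (a \<bullet> z) / (a \<bullet> a)) *\<^sub>R a"
proof -
  have "(\<chi> i j. a $ i * a $ j) *v z = (a \<bullet> z) *\<^sub>R a"
    by (simp add: vec_eq_iff matrix_vector_mult_def inner_vec_def sum_distrib_left mult_ac)
  then show ?thesis
    by (simp add: reflection_def matrix_vector_mult_diff_rdistrib scaleR_matrix_vector_assoc[symmetric])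
qed

lemma orthogonal_matrix_reflection: "orthogonal_matrix (reflection a)"
proof -
  have "(reflection a *v v) \<bullet> (reflection a *v w) = v \<bullet> w" for v w
    by (cases "a = 0") (simp_all add: reflection_mult inner_diff_left inner_diff_right inner_commute field_simps)
  then have "orthogonal_transformation ((*v) (reflection a))"
    by (simp add: orthogonal_transformation_def)
  then show ?thesis by (simp add: orthogonal_transformation_matrix)
qed

lemma reflection_involution: "reflection a ** reflection a = mat 1"
proof -
  have "reflection a *v (reflection a *v z) = z" for z
    by (cases "a = 0") (simp_all add: reflection_mult inner_diff_right field_simps)
  then show ?thesis
    by (simp add: matrix_eq matrix_vector_mul_assoc[symmetric])
qed

text \<open>Equal norms make the squared norm of \<open>e - v\<close> twice its inner product with
  \<open>e\<close>, so the subtracted multiple of \<open>e - v\<close> has coefficient 1.\<close>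

lemma reflection_swap:
  assumes "norm e = norm v"
  shows "reflection (e - v) *v e = v" and "reflection (e - v) *v v = e"
proof -
  show 1: "reflection (e - v) *v e = v"
  proof (cases "e = v")
    case False
    have "e \<bullet> e = v \<bullet> v" using assms by (simp add: norm_eq)
    then have "(e - v) \<bullet> (e - v) = 2 * ((e - v) \<bullet> e)"
      by (simp add: inner_diff_left inner_diff_right inner_commute)
    moreover have "(e - v) \<bullet> (e - v) \<noteq> 0" using False by simp
    ultimately have "2 * ((e - v) \<bullet> e) / ((e - v) \<bullet> (e - v)) = 1" by (metis divide_self)
    then have "reflection (e - v) *v e = e - 1 *\<^sub>R (e - v)" unfolding reflection_mult by (simp only:)
    then show ?thesis by simp
  qed (simp add: reflection_mult)
  show "reflection (e - v) *v v = e"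
    by (subst 1[symmetric]) (simp add: matrix_vector_mul_assoc reflection_involution)
qed

lemma reflection_fixes: "orthogonal a z \<Longrightarrow> reflection a *v z = z"
  by (simp add: reflection_mult orthogonal_def)

lemma borel_measurable_reflection [measurable (raw)]:
  assumes [measurable]: "f \<in> borel_measurable M"
  shows "(\<lambda>x. reflection (f x)) \<in> borel_measurable M"
proof -
  have "(\<lambda>a :: real^'n. (\<chi> i j. a $ i * a $ j)) \<in> borel_measurable borel"
    by (intro borel_measurable_continuous_onI continuous_intros)
  note this[measurable]
  show ?thesis unfolding reflection_def by measurable
qed

text \<open>\<open>V = {}\<close> gives all of O(n), and \<open>V = W\<^sup>\<bottom>\<close> gives
  the orthogonal group of \<open>W\<close> extended by the identity; one construction serves
  both.\<close>

definition fixing_group :: "(real^'n) set \<Rightarrow> (real^'n^'n) set" where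
  "fixing_group V = {\<gamma>. orthogonal_matrix \<gamma> \<and> (\<forall>z\<in>V. \<gamma> *v z = z)}"

lemma fixing_group_mult: "\<gamma> \<in> fixing_group V \<Longrightarrow> \<rho> \<in> fixing_group V \<Longrightarrow> \<gamma> ** \<rho> \<in> fixing_group V"
  by (auto simp: fixing_group_def orthogonal_matrix_mul matrix_vector_mul_assoc[symmetric])

lemma orthogonal_matrix_cancel:
  assumes "orthogonal_matrix \<gamma>"
  shows "transpose \<gamma> ** (\<gamma> ** A) = A" "\<gamma> ** (transpose \<gamma> ** A) = A"
    "A ** \<gamma> ** transpose \<gamma> = A" "A ** transpose \<gamma> ** \<gamma> = A"
    "transpose \<gamma> *v (\<gamma> *v z) = z" "\<gamma> *v (transpose \<gamma> *v z) = z"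
  using assms
  by (simp_all add: orthogonal_matrix_def matrix_mul_assoc matrix_vector_mul_assoc matrix_mul_assoc[symmetric, of A])

lemma fixing_group_transpose: "\<gamma> \<in> fixing_group V \<Longrightarrow> transpose \<gamma> \<in> fixing_group V"
proof -
  assume \<gamma>: "\<gamma> \<in> fixing_group V"
  then have "transpose \<gamma> *v z = z" if "z \<in> V" for z
    using orthogonal_matrix_cancel(5)[of \<gamma> z] that unfolding fixing_group_def by force
  with \<gamma> show ?thesis
    by (simp add: fixing_group_def del: transpose_matrix_vector)
qed

lemma fixing_group_borel [measurable]:
  fixes V :: "(real^'n) set"
  shows "fixing_group V \<in> sets borel"
proof -
  have "continuous_on UNIV (\<lambda>\<gamma> :: real^'n^'n. transpose \<gamma> ** \<gamma>)"
    unfolding matrix_matrix_mult_def transpose_def by (intro continuous_intros)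
  moreover have "continuous_on UNIV (\<lambda>\<gamma> :: real^'n^'n. \<gamma> *v z)" for z
    unfolding matrix_vector_mult_def by (intro continuous_intros)
  ultimately have "closed ({\<gamma> :: real^'n^'n. transpose \<gamma> ** \<gamma> = mat 1} \<inter> (\<Inter>z\<in>V. {\<gamma>. \<gamma> *v z = z}))"
    by (intro closed_Int closed_INT ballI closed_Collect_eq) auto
  also have "{\<gamma> :: real^'n^'n. transpose \<gamma> ** \<gamma> = mat 1} \<inter> (\<Inter>z\<in>V. {\<gamma>. \<gamma> *v z = z}) = fixing_group V"
    by (auto simp: fixing_group_def orthogonal_matrix)
  finally show ?thesis by simp
qed

lemma fixing_group_image_orthogonal_comp:
  assumes "\<gamma> \<in> fixing_group V"
  shows "(*v) \<gamma> ` (V\<^sup>\<bottom>) = V\<^sup>\<bottom>"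
proof -
  have "(*v) \<gamma> ` V = V" using assms by (force simp: fixing_group_def)
  then show ?thesis
    using orthogonal_comp_image[OF orthogonal_matrix_imp_transformation, of \<gamma> V] assms
    by (simp add: fixing_group_def)
qed

text \<open>Normalized Lebesgue measure on the shell between the radii 1 and 2 in \<open>W\<close>,
  pushed radially to the unit sphere; both operations are compatible with orthogonal maps preserving
  \<open>W\<close>.\<close>

lemma sphere_measure_exists:
  fixes W :: "(real^'n) set"
  assumes W: "subspace W" and d: "dim W > 0"
  shows "\<exists>\<sigma>. prob_space \<sigma> \<and> sets \<sigma> = sets borel \<and> (AE v in \<sigma>. v \<in> W \<and> norm v = 1) \<and>
    (\<forall>f. orthogonal_transformation f \<and> f ` W = W \<longrightarrow> distr \<sigma> borel f = \<sigma>)"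
proof -
  let ?L = "subspace_lborel W"
  define A :: "(real^'n) set" where "A = cball 0 2 - cball 0 1"
  have A [measurable]: "A \<in> sets borel" by (simp add: A_def)
  let ?w = "unit_ball_vol (real (dim W))"
  have w: "?w > 0" by simp
  have "emeasure ?L A = emeasure ?L (cball 0 2) - emeasure ?L (cball 0 1)"
    unfolding A_def using emeasure_subspace_lborel_cball[OF W, of 1]
    by (intro emeasure_Diff) auto
  also have "\<dots> = ennreal (?w * 2 ^ dim W) - ennreal ?w"
    using emeasure_subspace_lborel_cball[OF W] by simp
  also have "\<dots> = ennreal (?w * 2 ^ dim W - ?w)"
    by (rule ennreal_minus) simp
  finally have eA: "emeasure ?L A = ennreal (?w * 2 ^ dim W - ?w)" .
  \<comment> \<open>Positive dimension makes the shell have positive measure.\<close>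
  have "(2::real) ^ dim W > 1" using d by (simp add: one_less_power)
  then have "?w * 1 < ?w * 2 ^ dim W" using w by (rule mult_strict_left_mono)
  then have "?w * 2 ^ dim W - ?w > 0" by simp
  then have pos: "emeasure ?L A \<noteq> 0" and fin: "emeasure ?L A \<noteq> \<infinity>"
    unfolding eA by (metis ennreal_eq_0_iff not_le, metis ennreal_neq_top infinity_ennreal_def)
  define M where "M = uniform_measure ?L A"
  have sM [measurable_cong]: "sets M = sets borel" by (simp add: M_def)
  interpret M: prob_space M unfolding M_def by (rule prob_space_uniform_measure[OF pos fin])
  define \<sigma> where "\<sigma> = distr M borel (\<lambda>z. z /\<^sub>R norm z)"
  have "prob_space \<sigma>" unfolding \<sigma>_def by (rule M.prob_space_distr) measurable
  moreover have "AE v in \<sigma>. v \<in> W \<and> norm v = 1"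
  proof -
    have [measurable]: "W \<in> sets borel" using W by (simp add: borel_closed closed_subspace)
    have "AE z in M. z /\<^sub>R norm z \<in> W \<and> norm (z /\<^sub>R norm z) = 1"
      unfolding M_def
    proof (rule AE_uniform_measureI)
      show "AE z in ?L. z \<in> A \<longrightarrow> z /\<^sub>R norm z \<in> W \<and> norm (z /\<^sub>R norm z) = 1"
        using AE_subspace_lborel_mem[OF W]
        by eventually_elim (auto simp: A_def subspace_scale[OF W] intro!: left_inverse)
    qed simp
    then show ?thesis unfolding \<sigma>_def by (subst AE_distr_iff) auto
  qed
  moreover have "distr \<sigma> borel f = \<sigma>" if f: "orthogonal_transformation f" and fW: "f ` W = W" for f
  proof -
    have l: "linear f" using f by (simp add: orthogonal_transformation_def)
    have [measurable]: "f \<in> borel_measurable borel"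
      using l by (intro borel_measurable_continuous_onI linear_continuous_on) (simp add: linear_conv_bounded_linear)
    have nf: "norm (f z) = norm z" for z by (rule orthogonal_transformation_norm[OF f])
    have "distr M borel f = M"
    proof (rule measure_eqI)
      fix B assume "B \<in> sets (distr M borel f)"
      then have [measurable]: "B \<in> sets borel" by simp
      have "f -` B \<in> sets borel" using measurable_sets_borel[of f borel B] by simp
      then have "emeasure (distr M borel f) B = emeasure ?L (A \<inter> f -` B) / emeasure ?L A"
        unfolding M_def by (subst emeasure_distr) auto
      also have "A \<inter> f -` B = f -` (A \<inter> B)" using nf by (auto simp: A_def)
      also have "emeasure ?L (f -` (A \<inter> B)) = emeasure (distr ?L borel f) (A \<inter> B)"
        by (subst emeasure_distr) auto
      also have "distr ?L borel f = ?L"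
        using distr_subspace_lborel_image[OF f W] by (simp add: fW)
      finally show "emeasure (distr M borel f) B = emeasure M B"
        unfolding M_def by simp
    qed (simp add: sM)
    moreover have "distr \<sigma> borel f = distr (distr M borel f) borel (\<lambda>z. z /\<^sub>R norm z)"
      unfolding \<sigma>_def by (subst (1 2) distr_distr) (auto simp: o_def nf linear_scale[OF l])
    ultimately show ?thesis by (simp add: \<sigma>_def)
  qed
  ultimately show ?thesis by (intro exI[of _ \<sigma>]) (auto simp: \<sigma>_def)
qed

text \<open>Induction on the codimension of \<open>V\<close>. The reflections represent the cosets
  of the stabilizer of \<open>e\<close>; as they stand on the left of the product, left invariance
  is what comes out, and two-sidedness is recovered later. The measure is kept on the space of all
  matrices, where measurability is ambient Borel measurability.\<close>

lemma fixing_group_measure_exists: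
  fixes V :: "(real^'n) set"
  shows "\<exists>\<mu>. prob_space \<mu> \<and> sets \<mu> = sets borel \<and> (AE \<gamma> in \<mu>. \<gamma> \<in> fixing_group V) \<and>
    (\<forall>\<gamma>\<in>fixing_group V. distr \<mu> borel ((**) \<gamma>) = \<mu>)"
proof (induction "CARD('n) - dim V" arbitrary: V rule: less_induct)
  case less
  show ?case
  proof (cases "span V = UNIV")
    case True
    \<comment> \<open>If \<open>V\<close> spans the space, the group is trivial and a point mass
      serves.\<close>
    have "\<gamma> = mat 1" if "\<gamma> \<in> fixing_group V" for \<gamma>
    proof -
      have "\<gamma> *v z = z" for z
      proof (rule linear_eq_on_span[where f = "(*v) \<gamma>" and g = "\<lambda>z. z" and B = V])
        show "linear (\<lambda>z :: real^'n. z)" by (rule linear_ident)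
        show "z \<in> span V" using True by simp
      qed (use that in \<open>simp_all add: fixing_group_def\<close>)
      then show ?thesis by (simp add: matrix_eq)
    qed
    moreover have "mat 1 \<in> fixing_group V" by (simp add: fixing_group_def orthogonal_matrix_id)
    ultimately have K: "fixing_group V = {mat 1}" by blast
    have "AE \<gamma> in return borel (mat 1 :: real^'n^'n). \<gamma> \<in> {mat 1}"
      by (subst AE_return) auto
    then show ?thesis
      unfolding K
      by (intro exI[of _ "return borel (mat 1)"] conjI)
         (simp_all add: prob_space_return distr_return matrix_mul_lid[abs_def])
  next
    case False
    then have dV: "dim V < CARD('n)"
      using dim_eq_full[of V] dim_subset_UNIV[of V] by (simp add: less_le)
    obtain e0 :: "real^'n" where e0: "e0 \<noteq> 0" "\<And>z. z \<in> V \<Longrightarrow> orthogonal e0 z"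
      using orthogonal_to_subspace_exists[of V] dV span_base by (metis DIM_cart DIM_real mult.right_neutral)
    define e where "e = e0 /\<^sub>R norm e0"
    have e: "norm e = 1" "\<And>z. z \<in> V \<Longrightarrow> orthogonal e z"
      using e0 by (auto simp: e_def orthogonal_clauses)
    let ?K = "fixing_group V" and ?KU = "fixing_group (insert e V)"
    have eV: "e \<in> V\<^sup>\<bottom>" using e by (auto simp: orthogonal_comp_def orthogonal_commute)
    have W: "subspace (V\<^sup>\<bottom>)" by (rule subspace_orthogonal_comp)
    have "e \<notin> span V"
      using e orthogonal_to_span[of e V e] by (metis norm_zero orthogonal_self orthogonal_commute zero_neq_one)
    then have "CARD('n) - dim (insert e V) < CARD('n) - dim V"
      using dV by (simp add: dim_insert)
    from less[OF this] obtain \<nu> where \<nu>: "prob_space \<nu>" and [measurable_cong]: "sets \<nu> = sets borel"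
      and \<nu>K: "AE \<gamma> in \<nu>. \<gamma> \<in> ?KU" and \<nu>inv: "\<And>\<gamma>. \<gamma> \<in> ?KU \<Longrightarrow> distr \<nu> borel ((**) \<gamma>) = \<nu>" by blast
    have "dim (V\<^sup>\<bottom>) > 0"
      using eV e by (metis dim_eq_0 gr0I norm_zero singletonD subsetD zero_neq_one)
    from sphere_measure_exists[OF W this] obtain \<sigma> where \<sigma>: "prob_space \<sigma>" and [measurable_cong]: "sets \<sigma> = sets borel"
      and \<sigma>S: "AE v in \<sigma>. v \<in> V\<^sup>\<bottom> \<and> norm v = 1"
      and \<sigma>inv: "\<And>f. orthogonal_transformation f \<Longrightarrow> f ` (V\<^sup>\<bottom>) = V\<^sup>\<bottom> \<Longrightarrow> distr \<sigma> borel f = \<sigma>" by blast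
    interpret \<nu>: prob_space \<nu> by fact
    interpret \<sigma>: prob_space \<sigma> by fact
    interpret P: pair_prob_space \<sigma> \<nu> ..
    let ?r = "\<lambda>v. reflection (e - v)"
    have r: "?r v \<in> ?K" if "v \<in> V\<^sup>\<bottom>" for v
    proof -
      have "e - v \<in> V\<^sup>\<bottom>" using eV that by (rule subspace_diff[OF W])
      then show ?thesis
        by (auto simp: fixing_group_def orthogonal_matrix_reflection orthogonal_comp_def orthogonal_commute intro!: reflection_fixes)
    qed
    have sub: "?KU \<subseteq> ?K" by (auto simp: fixing_group_def)
    define \<mu> where "\<mu> = distr (\<sigma> \<Otimes>\<^sub>M \<nu>) borel (\<lambda>(v, \<rho>). ?r v ** \<rho>)"
    have "prob_space \<mu>" unfolding \<mu>_def by (rule P.prob_space_distr) measurable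
    moreover have "AE \<gamma> in \<mu>. \<gamma> \<in> ?K"
    proof -
      have "AE x in \<sigma> \<Otimes>\<^sub>M \<nu>. (case x of (v, \<rho>) \<Rightarrow> ?r v ** \<rho> \<in> ?K)"
      proof (rule P.AE_pair_measure)
        show "AE v in \<sigma>. AE \<rho> in \<nu>. (case (v, \<rho>) of (v, \<rho>) \<Rightarrow> ?r v ** \<rho> \<in> ?K)"
          using \<sigma>S
        proof eventually_elim
          case (elim v)
          show ?case using \<nu>K by eventually_elim (use elim r sub in \<open>auto intro!: fixing_group_mult\<close>)
        qed
      qed measurable
      then show ?thesis unfolding \<mu>_def by (subst AE_distr_iff) (auto simp: case_prod_beta)
    qed
    moreover have "distr \<mu> borel ((**) \<gamma>) = \<mu>" if \<gamma>: "\<gamma> \<in> ?K" for \<gamma>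
    proof (rule measure_eqI)
      have o\<gamma>: "orthogonal_transformation ((*v) \<gamma>)" and \<gamma>W: "(*v) \<gamma> ` (V\<^sup>\<bottom>) = V\<^sup>\<bottom>"
        using orthogonal_matrix_imp_transformation[of \<gamma>] fixing_group_image_orthogonal_comp[OF \<gamma>] \<gamma>
        by (simp_all add: fixing_group_def)
      fix A assume "A \<in> sets (distr \<mu> borel ((**) \<gamma>))"
      then have [measurable]: "A \<in> sets borel" by simp
      let ?g = "indicator A :: real^'n^'n \<Rightarrow> ennreal"
      have I: "(\<integral>\<^sup>+x. G x \<partial>\<mu>) = (\<integral>\<^sup>+v. (\<integral>\<^sup>+\<rho>. G (?r v ** \<rho>) \<partial>\<nu>) \<partial>\<sigma>)"
        if [measurable]: "G \<in> borel_measurable borel" for G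
      proof -
        have "(\<integral>\<^sup>+x. G x \<partial>\<mu>) = (\<integral>\<^sup>+p. G (?r (fst p) ** snd p) \<partial>(\<sigma> \<Otimes>\<^sub>M \<nu>))"
          unfolding \<mu>_def by (subst nn_integral_distr) (auto simp: case_prod_beta)
        also have "\<dots> = (\<integral>\<^sup>+v. (\<integral>\<^sup>+\<rho>. G (?r v ** \<rho>) \<partial>\<nu>) \<partial>\<sigma>)"
          by (subst \<nu>.nn_integral_fst[symmetric]) auto
        finally show ?thesis .
      qed
      have "emeasure (distr \<mu> borel ((**) \<gamma>)) A = (\<integral>\<^sup>+x. ?g x \<partial>distr \<mu> borel ((**) \<gamma>))"
        by simp
      also have "\<dots> = (\<integral>\<^sup>+x. ?g (\<gamma> ** x) \<partial>\<mu>)"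
        by (subst nn_integral_distr) (auto simp: \<mu>_def)
      also have "\<dots> = (\<integral>\<^sup>+v. (\<integral>\<^sup>+\<rho>. ?g (\<gamma> ** (?r v ** \<rho>)) \<partial>\<nu>) \<partial>\<sigma>)"
        by (subst I) auto
      also have "\<dots> = (\<integral>\<^sup>+v. (\<integral>\<^sup>+\<rho>. ?g (?r (\<gamma> *v v) ** \<rho>) \<partial>\<nu>) \<partial>\<sigma>)"
      proof (rule nn_integral_cong_AE)
        show "AE v in \<sigma>. (\<integral>\<^sup>+\<rho>. ?g (\<gamma> ** (?r v ** \<rho>)) \<partial>\<nu>) = (\<integral>\<^sup>+\<rho>. ?g (?r (\<gamma> *v v) ** \<rho>) \<partial>\<nu>)"
          using \<sigma>S
        proof eventually_elim
          case (elim v)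
          \<comment> \<open>The discrepancy between \<open>\<gamma> ** ?r v\<close> and
            \<open>?r (\<gamma> *v v)\<close>. It sends \<open>e\<close> to \<open>v\<close>, then
            to \<open>\<gamma> *v v\<close>, then back to \<open>e\<close>; hence it lies in the
            smaller group, and the invariance of \<open>\<nu>\<close> absorbs it.\<close>
          define k where "k = ?r (\<gamma> *v v) ** \<gamma> ** ?r v"
          have gv: "\<gamma> *v v \<in> V\<^sup>\<bottom>" "norm (\<gamma> *v v) = 1"
            using elim \<gamma>W orthogonal_transformation_norm[OF o\<gamma>] by auto
          have "k *v e = e"
            using elim e gv
            by (simp add: k_def matrix_vector_mul_assoc[symmetric] reflection_swap)
          moreover have "k \<in> ?K" unfolding k_def using elim gv r \<gamma> by (intro fixing_group_mult) auto
          ultimately have k: "k \<in> ?KU" by (simp add: fixing_group_def)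
          have "\<gamma> ** (?r v ** \<rho>) = ?r (\<gamma> *v v) ** (k ** \<rho>)" for \<rho> :: "real^'n^'n"
          proof -
            have "?r (\<gamma> *v v) ** (k ** \<rho>) = (?r (\<gamma> *v v) ** ?r (\<gamma> *v v)) ** (\<gamma> ** (?r v ** \<rho>))"
              unfolding k_def by (simp only: matrix_mul_assoc)
            then show ?thesis by (simp add: reflection_involution)
          qed
          then have "(\<integral>\<^sup>+\<rho>. ?g (\<gamma> ** (?r v ** \<rho>)) \<partial>\<nu>) = (\<integral>\<^sup>+\<rho>. ?g (?r (\<gamma> *v v) ** (k ** \<rho>)) \<partial>\<nu>)"
            by simp
          also have "\<dots> = (\<integral>\<^sup>+\<rho>. ?g (?r (\<gamma> *v v) ** \<rho>) \<partial>distr \<nu> borel ((**) k))"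
            by (subst nn_integral_distr) auto
          finally have "(\<integral>\<^sup>+\<rho>. ?g (\<gamma> ** (?r v ** \<rho>)) \<partial>\<nu>) = (\<integral>\<^sup>+\<rho>. ?g (?r (\<gamma> *v v) ** \<rho>) \<partial>distr \<nu> borel ((**) k))" .
          then show ?case by (simp add: \<nu>inv[OF k])
        qed
      qed
      \<comment> \<open>All that is left of \<open>\<gamma>\<close> is the substitution of
        \<open>\<gamma> *v v\<close> for \<open>v\<close>, absorbed by the invariant measure on the
        sphere.\<close>
      also have "\<dots> = (\<integral>\<^sup>+v. (\<integral>\<^sup>+\<rho>. ?g (?r v ** \<rho>) \<partial>\<nu>) \<partial>distr \<sigma> borel ((*v) \<gamma>))"
        by (subst nn_integral_distr) auto
      also have "\<dots> = (\<integral>\<^sup>+x. ?g x \<partial>\<mu>)"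
        by (simp add: \<sigma>inv[OF o\<gamma> \<gamma>W] I)
      also have "\<dots> = emeasure \<mu> A" by (simp add: \<mu>_def)
      finally show "emeasure (distr \<mu> borel ((**) \<gamma>)) A = emeasure \<mu> A" .
    qed (simp add: \<mu>_def)
    ultimately show ?thesis by (intro exI[of _ \<mu>]) (simp add: \<mu>_def)
  qed
qed

section \<open>Haar measure on the group as a space of its own\<close>

definition fixing_borel :: "(real^'n) set \<Rightarrow> (real^'n^'n) measure" where
  "fixing_borel V = restrict_space borel (fixing_group V)"

lemma space_fixing_borel [simp]: "space (fixing_borel V) = fixing_group V"
  by (simp add: fixing_borel_def space_restrict_space)

lemma measurable_fixing_borelI:
  "f \<in> borel_measurable M \<Longrightarrow> (\<And>x. x \<in> space M \<Longrightarrow> f x \<in> fixing_group V) \<Longrightarrow> f \<in> measurable M (fixing_borel V)"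
  unfolding fixing_borel_def by (rule measurable_restrict_space2) auto

lemma measurable_fixing_borel_id: "(\<lambda>x. x) \<in> borel_measurable (fixing_borel V)"
  unfolding fixing_borel_def by (rule measurable_restrict_space1) measurable

lemma measurable_fixing_borelD:
  "f \<in> measurable M (fixing_borel V) \<Longrightarrow> f \<in> borel_measurable M"
  by (drule measurable_compose[OF _ measurable_fixing_borel_id]) simp

lemma measurable_fixing_borel_mult:
  assumes "\<gamma> \<in> fixing_group V"
  shows "(\<lambda>\<rho>. \<gamma> ** \<rho>) \<in> measurable (fixing_borel V) (fixing_borel V)"
    and "(\<lambda>\<rho>. \<rho> ** \<gamma>) \<in> measurable (fixing_borel V) (fixing_borel V)"
  using assms
  by (auto intro!: measurable_fixing_borelI borel_measurable_matrix_mult measurable_fixing_borel_id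
      intro: fixing_group_mult)

text \<open>The definite descriptions speak of measures whose space is the group itself, so the
  measure concentrated on the group is restricted to it.\<close>

lemma fixing_group_left_invariant_exists:
  fixes V :: "(real^'n) set"
  shows "\<exists>\<mu>. prob_space \<mu> \<and> sets \<mu> = sets (fixing_borel V) \<and>
    (\<forall>\<gamma>\<in>fixing_group V. distr \<mu> \<mu> ((**) \<gamma>) = \<mu>)"
proof -
  let ?K = "fixing_group V"
  obtain \<nu> where \<nu>: "prob_space \<nu>" and s [measurable_cong]: "sets \<nu> = sets borel"
    and AE: "AE \<gamma> in \<nu>. \<gamma> \<in> ?K" and inv: "\<And>\<gamma>. \<gamma> \<in> ?K \<Longrightarrow> distr \<nu> borel ((**) \<gamma>) = \<nu>"
    using fixing_group_measure_exists[of V] by blast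
  interpret prob_space \<nu> by fact
  have sp: "space \<nu> = UNIV" using sets_eq_imp_space_eq[OF s] by simp
  have K [measurable]: "?K \<in> sets \<nu>" by (simp add: s fixing_group_borel)
  define \<mu> where "\<mu> = restrict_space \<nu> ?K"
  have s\<mu>: "sets \<mu> = sets (fixing_borel V)"
    unfolding \<mu>_def fixing_borel_def by (rule sets_restrict_space_cong[OF s])
  have e: "emeasure \<mu> A = emeasure \<nu> A" if "A \<subseteq> ?K" for A
    unfolding \<mu>_def using that K sp by (subst emeasure_restrict_space) auto
  have sp\<mu>: "space \<mu> = ?K" using sets_eq_imp_space_eq[OF s\<mu>] by simp
  have "emeasure \<mu> (space \<mu>) = 1"
    using AE by (simp add: sp\<mu> e emeasure_eq_1_AE)
  then have "prob_space \<mu>" by (rule prob_spaceI)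
  moreover have "distr \<mu> \<mu> ((**) \<gamma>) = \<mu>" if \<gamma>: "\<gamma> \<in> ?K" for \<gamma>
  proof (rule measure_eqI)
    fix A assume "A \<in> sets (distr \<mu> \<mu> ((**) \<gamma>))"
    then have A: "A \<in> sets \<mu>" by simp
    then have AK: "A \<subseteq> ?K" using sets.sets_into_space[OF A] by (simp add: sp\<mu>)
    have Ab: "A \<in> sets borel"
      using A unfolding s\<mu> fixing_borel_def
      by (subst (asm) sets_restrict_space_iff) auto
    have m: "(**) \<gamma> \<in> measurable \<mu> \<mu>"
      unfolding measurable_cong_sets[OF s\<mu> s\<mu>]
      by (rule measurable_fixing_borel_mult[OF \<gamma>])
    \<comment> \<open>Closure under inverses puts the preimage taken among all matrices into the
      group.\<close>
    have pre: "(**) \<gamma> -` A \<subseteq> ?K"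
    proof
      fix \<rho> assume "\<rho> \<in> (**) \<gamma> -` A"
      then have "\<gamma> ** \<rho> \<in> ?K" using AK by auto
      then have "transpose \<gamma> ** (\<gamma> ** \<rho>) \<in> ?K"
        by (rule fixing_group_mult[OF fixing_group_transpose[OF \<gamma>]])
      moreover have "orthogonal_matrix \<gamma>" using \<gamma> by (simp add: fixing_group_def)
      ultimately show "\<rho> \<in> ?K" by (simp only: orthogonal_matrix_cancel(1))
    qed
    have "emeasure (distr \<mu> \<mu> ((**) \<gamma>)) A = emeasure \<mu> ((**) \<gamma> -` A)"
      using A m pre by (simp add: emeasure_distr sp\<mu> Int_absorb2)
    also have "\<dots> = emeasure \<nu> ((**) \<gamma> -` A)" by (rule e[OF pre])
    also have "\<dots> = emeasure (distr \<nu> borel ((**) \<gamma>)) A"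
    proof -
      have "(**) \<gamma> \<in> measurable \<nu> borel" by measurable
      then show ?thesis using Ab by (simp add: emeasure_distr sp)
    qed
    also have "\<dots> = emeasure \<mu> A" by (simp add: inv[OF \<gamma>] e[OF AK])
    finally show "emeasure (distr \<mu> \<mu> ((**) \<gamma>)) A = emeasure \<mu> A" .
  qed simp
  ultimately show ?thesis using s\<mu> by blast
qed

text \<open>Integrate the indicator of \<open>A\<close> at \<open>\<rho> ** \<gamma>\<close> over
  both variables: left invariance of \<open>\<mu>\<close> removes \<open>\<rho>\<close>, right
  invariance of \<open>\<nu>\<close> removes \<open>\<gamma>\<close>. This yields uniqueness of Haar
  measure and also identifies a left invariant measure with a right invariant one.\<close>

lemma left_right_invariant_eq:
  assumes \<mu>: "prob_space \<mu>" and s\<mu> [measurable_cong]: "sets \<mu> = sets (fixing_borel V)"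
    and left: "\<And>\<gamma>. \<gamma> \<in> fixing_group V \<Longrightarrow> distr \<mu> \<mu> (\<lambda>\<rho>. \<gamma> ** \<rho>) = \<mu>"
    and \<nu>: "prob_space \<nu>" and s\<nu> [measurable_cong]: "sets \<nu> = sets (fixing_borel V)"
    and right: "\<And>\<gamma>. \<gamma> \<in> fixing_group V \<Longrightarrow> distr \<nu> \<nu> (\<lambda>\<rho>. \<rho> ** \<gamma>) = \<nu>"
  shows "\<mu> = \<nu>"
proof (rule measure_eqI)
  show "sets \<mu> = sets \<nu>" by (simp add: s\<mu> s\<nu>)
  interpret \<mu>: prob_space \<mu> by fact
  interpret \<nu>: prob_space \<nu> by fact
  interpret pair_sigma_finite \<mu> \<nu> ..
  let ?K = "fixing_group V" and ?R = "fixing_borel V"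
  have sp: "space \<mu> = ?K" "space \<nu> = ?K" using sets_eq_imp_space_eq[OF s\<mu>] sets_eq_imp_space_eq[OF s\<nu>] by simp_all
  fix A assume "A \<in> sets \<mu>"
  then have A [measurable]: "A \<in> sets ?R" by (simp add: s\<mu>)
  have "(\<lambda>p. snd p ** fst p) \<in> measurable (?R \<Otimes>\<^sub>M ?R) ?R"
    by (rule measurable_fixing_borelI)
       (auto simp: space_pair_measure intro!: borel_measurable_matrix_mult fixing_group_mult
         measurable_fixing_borelD[OF measurable_fst] measurable_fixing_borelD[OF measurable_snd])
  then have mm: "(\<lambda>p. snd p ** fst p) \<in> measurable (\<mu> \<Otimes>\<^sub>M \<nu>) ?R"
    by (simp add: measurable_cong_sets[OF sets_pair_measure_cong[OF s\<mu> s\<nu>] refl])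
  have m: "(\<lambda>\<rho>. \<gamma> ** \<rho>) \<in> measurable ?R ?R" "(\<lambda>\<rho>. \<rho> ** \<gamma>) \<in> measurable ?R ?R" if "\<gamma> \<in> ?K" for \<gamma>
    using measurable_fixing_borel_mult[OF that] by auto
  have m\<mu>: "(\<lambda>\<rho>. \<gamma> ** \<rho>) \<in> measurable \<mu> \<mu>" and m\<nu>: "(\<lambda>\<rho>. \<rho> ** \<gamma>) \<in> measurable \<nu> \<nu>" if "\<gamma> \<in> ?K" for \<gamma>
    using m[OF that] by (simp_all add: measurable_cong_sets[OF s\<mu> s\<mu>] measurable_cong_sets[OF s\<nu> s\<nu>])
  have "emeasure \<mu> A = (\<integral>\<^sup>+\<rho>. emeasure \<mu> A \<partial>\<nu>)"
    by (simp add: \<nu>.emeasure_space_1)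
  also have "\<dots> = (\<integral>\<^sup>+\<rho>. (\<integral>\<^sup>+\<gamma>. indicator A (\<rho> ** \<gamma>) \<partial>\<mu>) \<partial>\<nu>)"
  proof (rule nn_integral_cong)
    fix \<rho> assume "\<rho> \<in> space \<nu>"
    then have \<rho>: "\<rho> \<in> ?K" by (simp add: sp)
    have "(\<integral>\<^sup>+\<gamma>. indicator A (\<rho> ** \<gamma>) \<partial>\<mu>) = (\<integral>\<^sup>+\<gamma>. indicator A \<gamma> \<partial>distr \<mu> \<mu> (\<lambda>\<gamma>. \<rho> ** \<gamma>))"
      by (subst nn_integral_distr[OF m\<mu>[OF \<rho>]]) auto
    then show "emeasure \<mu> A = (\<integral>\<^sup>+\<gamma>. indicator A (\<rho> ** \<gamma>) \<partial>\<mu>)"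
      by (simp add: left[OF \<rho>])
  qed
  also have "\<dots> = (\<integral>\<^sup>+\<gamma>. (\<integral>\<^sup>+\<rho>. indicator A (\<rho> ** \<gamma>) \<partial>\<nu>) \<partial>\<mu>)"
    using measurable_compose[OF mm borel_measurable_indicator[OF A]]
    by (intro Fubini') (simp add: case_prod_beta')
  also have "\<dots> = (\<integral>\<^sup>+\<gamma>. emeasure \<nu> A \<partial>\<mu>)"
  proof (rule nn_integral_cong)
    fix \<gamma> assume "\<gamma> \<in> space \<mu>"
    then have \<gamma>: "\<gamma> \<in> ?K" by (simp add: sp)
    have "(\<integral>\<^sup>+\<rho>. indicator A (\<rho> ** \<gamma>) \<partial>\<nu>) = (\<integral>\<^sup>+\<rho>. indicator A \<rho> \<partial>distr \<nu> \<nu> (\<lambda>\<rho>. \<rho> ** \<gamma>))"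
      by (subst nn_integral_distr[OF m\<nu>[OF \<gamma>]]) auto
    then show "(\<integral>\<^sup>+\<rho>. indicator A (\<rho> ** \<gamma>) \<partial>\<nu>) = emeasure \<nu> A"
      by (simp add: right[OF \<gamma>])
  qed
  also have "\<dots> = emeasure \<nu> A" by (simp add: \<mu>.emeasure_space_1)
  finally show "emeasure \<mu> A = emeasure \<nu> A" .
qed

text \<open>Transposition is inversion here, so it carries a left invariant measure to a right
  invariant one; the two coincide, hence the measure is invariant on both sides.\<close>

lemma fixing_group_haar_exists:
  fixes V :: "(real^'n) set"
  shows "\<exists>\<mu>. prob_space \<mu> \<and> sets \<mu> = sets (fixing_borel V) \<and>
    (\<forall>\<gamma>\<in>fixing_group V. distr \<mu> \<mu> (\<lambda>\<rho>. \<gamma> ** \<rho>) = \<mu> \<and> distr \<mu> \<mu> (\<lambda>\<rho>. \<rho> ** \<gamma>) = \<mu>)"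
proof -
  let ?K = "fixing_group V" and ?R = "fixing_borel V"
  obtain \<mu> where \<mu>: "prob_space \<mu>" and s [measurable_cong]: "sets \<mu> = sets ?R"
    and left: "\<And>\<gamma>. \<gamma> \<in> ?K \<Longrightarrow> distr \<mu> \<mu> (\<lambda>\<rho>. \<gamma> ** \<rho>) = \<mu>"
    using fixing_group_left_invariant_exists[of V] by blast
  interpret prob_space \<mu> by fact
  have sp: "space \<mu> = ?K" using sets_eq_imp_space_eq[OF s] by simp
  have tm: "transpose \<in> measurable \<mu> \<mu>"
    unfolding measurable_cong_sets[OF s s]
    by (rule measurable_fixing_borelI)
       (auto intro: fixing_group_transpose borel_measurable_transpose measurable_fixing_borel_id)
  have m: "(\<lambda>\<rho>. \<gamma> ** \<rho>) \<in> measurable \<mu> \<mu>" "(\<lambda>\<rho>. \<rho> ** \<gamma>) \<in> measurable \<mu> \<mu>" if "\<gamma> \<in> ?K" for \<gamma>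
    unfolding measurable_cong_sets[OF s s]
    using measurable_fixing_borel_mult[OF that] by auto
  define \<nu> where "\<nu> = distr \<mu> \<mu> transpose"
  have s\<nu>: "sets \<nu> = sets \<mu>" by (simp add: \<nu>_def)
  have right: "distr \<nu> \<nu> (\<lambda>\<rho>. \<rho> ** \<gamma>) = \<nu>" if \<gamma>: "\<gamma> \<in> ?K" for \<gamma>
  proof -
    have t\<gamma>: "transpose \<gamma> \<in> ?K" by (rule fixing_group_transpose[OF \<gamma>])
    have "distr \<nu> \<nu> (\<lambda>\<rho>. \<rho> ** \<gamma>) = distr \<nu> \<mu> (\<lambda>\<rho>. \<rho> ** \<gamma>)" by (rule distr_cong) (auto simp: s\<nu>)
    also have "\<dots> = distr \<mu> \<mu> (\<lambda>\<rho>. transpose \<rho> ** \<gamma>)"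
      unfolding \<nu>_def by (subst distr_distr[OF m(2)[OF \<gamma>] tm]) (simp add: o_def)
    also have "\<dots> = distr \<mu> \<mu> (\<lambda>\<rho>. transpose (transpose \<gamma> ** \<rho>))"
      by (simp add: matrix_transpose_mul)
    also have "\<dots> = distr (distr \<mu> \<mu> (\<lambda>\<rho>. transpose \<gamma> ** \<rho>)) \<mu> transpose"
      by (subst distr_distr[OF tm m(1)[OF t\<gamma>]]) (simp add: o_def)
    also have "\<dots> = \<nu>" by (simp add: left[OF t\<gamma>] \<nu>_def)
    finally show ?thesis .
  qed
  have "\<mu> = \<nu>"
    by (rule left_right_invariant_eq[OF \<mu> s left _ _ right])
       (auto simp: \<nu>_def s intro: prob_space_distr tm)
  with right left \<mu> s show ?thesis by metis
qed

lemma fixing_borel_empty: "fixing_borel {} = orthogonal_group_borel"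
  by (simp add: fixing_borel_def fixing_group_def orthogonal_group_borel_def)

lemma orthogonal_haar_borel_invariant:
  "prob_space (orthogonal_haar_borel :: (real^'n^'n) measure) \<and>
   sets (orthogonal_haar_borel :: (real^'n^'n) measure) = sets orthogonal_group_borel \<and>
   (\<forall>\<gamma> :: real^'n^'n. orthogonal_matrix \<gamma> \<longrightarrow>
      distr orthogonal_haar_borel orthogonal_haar_borel (\<lambda>\<rho>. \<gamma> ** \<rho>) = orthogonal_haar_borel \<and>
      distr orthogonal_haar_borel orthogonal_haar_borel (\<lambda>\<rho>. \<rho> ** \<gamma>) = orthogonal_haar_borel)"
  unfolding orthogonal_haar_borel_def
proof (rule theI')
  let ?P = "\<lambda>\<mu> :: (real^'n^'n) measure. prob_space \<mu> \<and> sets \<mu> = sets orthogonal_group_borel \<and>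
     (\<forall>\<gamma>. orthogonal_matrix \<gamma> \<longrightarrow> distr \<mu> \<mu> (\<lambda>\<rho>. \<gamma> ** \<rho>) = \<mu> \<and> distr \<mu> \<mu> (\<lambda>\<rho>. \<rho> ** \<gamma>) = \<mu>)"
  have K: "\<gamma> \<in> fixing_group {} \<longleftrightarrow> orthogonal_matrix \<gamma>" for \<gamma> :: "real^'n^'n" by (simp add: fixing_group_def)
  show "\<exists>!\<mu>. ?P \<mu>"
  proof (rule ex_ex1I)
    show "\<exists>\<mu>. ?P \<mu>"
      using fixing_group_haar_exists[of "{} :: (real^'n) set"] by (simp add: Ball_def K fixing_borel_empty)
    fix \<mu> \<nu> assume \<mu>: "?P \<mu>" and \<nu>: "?P \<nu>"
    show "\<mu> = \<nu>"
      by (rule left_right_invariant_eq[where V = "{}"])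
         (use \<mu> \<nu> in \<open>auto simp: K fixing_borel_empty\<close>)
  qed
qed

section \<open>The invariant measure on a Grassmannian\<close>

declare transpose_matrix_vector [simp del]

lemma grassmannian_inD:
  assumes "\<xi> \<in> grassmannian_in j W"
  shows "subspace \<xi>" "\<xi> \<subseteq> W" "dim \<xi> = j"
  using assms by (auto simp: grassmannian_in_def)

lemma space_grassmannian_borel [simp]: "space (grassmannian_borel j W) = grassmannian_in j W"
  by (simp add: grassmannian_borel_def)

lemma measurable_projection_matrix:
  "(\<lambda>\<xi>. matrix (closest_point \<xi>)) \<in> borel_measurable (grassmannian_borel j W)"
  unfolding grassmannian_borel_def by (rule measurable_vimage_algebra1) auto

lemma measurable_grassmannian_borelI:
  assumes "\<And>x. x \<in> space M \<Longrightarrow> f x \<in> grassmannian_in j W"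
    and "(\<lambda>x. matrix (closest_point (f x))) \<in> borel_measurable M"
  shows "f \<in> measurable M (grassmannian_borel j W)"
  unfolding grassmannian_borel_def using assms by (intro measurable_vimage_algebra2) auto

text \<open>Conjugation is polynomial in the entries of \<open>\<gamma>\<close> and of the
  projection matrix, which is what makes the action on subspaces measurable.\<close>

lemma projection_matrix_image:
  fixes \<gamma> :: "real^'n^'n"
  assumes \<gamma>: "orthogonal_matrix \<gamma>" and S: "subspace S"
  shows "matrix (closest_point ((*v) \<gamma> ` S)) = \<gamma> ** matrix (closest_point S) ** transpose \<gamma>"
proof -
  have "matrix (closest_point ((*v) \<gamma> ` S)) *v z = \<gamma> *v (matrix (closest_point S) *v (transpose \<gamma> *v z))" for z
  proof -
    have "subspace ((*v) \<gamma> ` S)" using S by (intro linear_subspace_image) auto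
    then have "matrix (closest_point ((*v) \<gamma> ` S)) *v z = closest_point ((*v) \<gamma> ` S) (\<gamma> *v (transpose \<gamma> *v z))"
      by (simp only: matrix_closest_point orthogonal_matrix_cancel(6)[OF \<gamma>])
    also have "\<dots> = \<gamma> *v closest_point S (transpose \<gamma> *v z)"
      by (rule closest_point_image[OF orthogonal_matrix_imp_transformation[OF \<gamma>] S])
    finally show ?thesis by (simp only: matrix_closest_point[OF S])
  qed
  then show ?thesis unfolding matrix_eq by (simp only: matrix_vector_mul_assoc[symmetric]) blast
qed

lemma grassmannian_in_image:
  fixes \<gamma> :: "real^'n^'n"
  assumes \<gamma>: "orthogonal_matrix \<gamma>" and \<xi>: "\<xi> \<in> grassmannian_in j W"
  shows "(*v) \<gamma> ` \<xi> \<in> grassmannian_in j ((*v) \<gamma> ` W)"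
proof -
  have "inj ((*v) \<gamma>)"
    using orthogonal_transformation_inj[OF orthogonal_matrix_imp_transformation[OF \<gamma>]] .
  then have "dim ((*v) \<gamma> ` \<xi>) = dim \<xi>"
    by (intro dim_image_eq) (auto intro: inj_on_subset)
  then show ?thesis
    using \<xi> by (auto simp: grassmannian_in_def intro: linear_subspace_image)
qed

lemma fixing_group_image:
  assumes W: "subspace W" and "\<gamma> \<in> fixing_group (W\<^sup>\<bottom>)"
  shows "(*v) \<gamma> ` W = W"
  using fixing_group_image_orthogonal_comp[OF assms(2)] by (simp add: orthogonal_comp_self[OF W])

lemma measurable_grassmannian_image:
  fixes \<gamma> :: "real^'n^'n"
  assumes \<gamma>: "orthogonal_matrix \<gamma>"
  shows "(\<lambda>\<xi>. (*v) \<gamma> ` \<xi>) \<in> measurable (grassmannian_borel j W) (grassmannian_borel j ((*v) \<gamma> ` W))"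
proof (rule measurable_grassmannian_borelI)
  fix \<xi> assume "\<xi> \<in> space (grassmannian_borel j W)"
  then show "(*v) \<gamma> ` \<xi> \<in> grassmannian_in j ((*v) \<gamma> ` W)"
    using grassmannian_in_image[OF \<gamma>] by simp
next
  note measurable_projection_matrix[measurable]
  have "(\<lambda>\<xi>. \<gamma> ** matrix (closest_point \<xi>) ** transpose \<gamma>) \<in> borel_measurable (grassmannian_borel j W)"
    by measurable
  then show "(\<lambda>\<xi>. matrix (closest_point ((*v) \<gamma> ` \<xi>))) \<in> borel_measurable (grassmannian_borel j W)"
    by (rule measurable_cong[THEN iffD1, rotated])
       (simp add: projection_matrix_image[OF \<gamma>] grassmannian_inD)
qed

text \<open>Joint measurability for exchanging integrals over the group and over the Grassmannian;
  the transpose is the inverse, matching the average used for uniqueness.\<close>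

lemma measurable_fixing_group_action:
  fixes W :: "(real^'n) set"
  assumes W: "subspace W"
  shows "(\<lambda>(\<rho>, \<xi>). (*v) (transpose \<rho>) ` \<xi>) \<in>
    measurable (fixing_borel (W\<^sup>\<bottom>) \<Otimes>\<^sub>M grassmannian_borel j W) (grassmannian_borel j W)"
    (is "?f \<in> measurable ?M _")
proof (rule measurable_grassmannian_borelI)
  fix p :: "(real^'n^'n) \<times> (real^'n) set" assume "p \<in> space ?M"
  then obtain \<rho> \<xi> where p: "p = (\<rho>, \<xi>)" "\<rho> \<in> fixing_group (W\<^sup>\<bottom>)" "\<xi> \<in> grassmannian_in j W"
    by (auto simp: space_pair_measure)
  then have t: "transpose \<rho> \<in> fixing_group (W\<^sup>\<bottom>)" by (intro fixing_group_transpose)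
  then have "(*v) (transpose \<rho>) ` \<xi> \<in> grassmannian_in j ((*v) (transpose \<rho>) ` W)"
    using p by (intro grassmannian_in_image) (simp_all add: fixing_group_def)
  then show "?f p \<in> grassmannian_in j W"
    by (simp only: fixing_group_image[OF W t]) (simp only: p prod.case)
next
  have [measurable]: "fst \<in> borel_measurable ?M" by (rule measurable_fixing_borelD[OF measurable_fst])
  have [measurable]: "(\<lambda>p. matrix (closest_point (snd p))) \<in> borel_measurable ?M"
    by (rule measurable_compose[OF measurable_snd measurable_projection_matrix])
  have "(\<lambda>p. transpose (fst p) ** matrix (closest_point (snd p)) ** fst p) \<in> borel_measurable ?M"
    by measurable
  then show "(\<lambda>p. matrix (closest_point (?f p))) \<in> borel_measurable ?M"
    by (rule measurable_cong[THEN iffD1, rotated])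
       (auto simp: space_pair_measure fixing_group_def projection_matrix_image grassmannian_inD
          simp del: transpose_matrix_vector)
qed

text \<open>An isometry of \<open>\<xi>\<^sub>1\<close> onto \<open>\<xi>\<^sub>2\<close>, one
  between their complements within \<open>W\<close>, and the identity on
  \<open>W\<^sup>\<bottom>\<close> are glued along the orthogonal decomposition; Pythagoras before
  and after the map shows that norms are preserved.\<close>

lemma fixing_group_transitive:
  fixes W :: "(real^'n) set"
  assumes W: "subspace W" and 1: "\<xi>\<^sub>1 \<in> grassmannian_in j W" and 2: "\<xi>\<^sub>2 \<in> grassmannian_in j W"
  shows "\<exists>\<gamma>\<in>fixing_group (W\<^sup>\<bottom>). (*v) \<gamma> ` \<xi>\<^sub>1 = \<xi>\<^sub>2"
proof -
  let ?U = "\<lambda>\<xi>. W \<inter> \<xi>\<^sup>\<bottom>"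
  note g1 = grassmannian_inD[OF 1] and g2 = grassmannian_inD[OF 2]
  have sU: "subspace (?U \<xi>)" for \<xi>
    using W subspace_orthogonal_comp by (rule subspace_inter)
  have dU: "dim (?U \<xi>) + j = dim W" if "\<xi> \<in> grassmannian_in j W" for \<xi>
  proof -
    have "{y \<in> W. \<forall>x\<in>\<xi>. orthogonal x y} = ?U \<xi>" by (auto simp: orthogonal_comp_def)
    then show ?thesis
      using dim_subspace_orthogonal_to_vectors[OF _ W, of \<xi>] grassmannian_inD[OF that] by simp
  qed
  \<comment> \<open>Equal dimensions of the subspaces and of their relative complements supply both
    isometries.\<close>
  have "dim \<xi>\<^sub>1 = dim \<xi>\<^sub>2" "dim (?U \<xi>\<^sub>1) = dim (?U \<xi>\<^sub>2)"
    using dU[OF 1] dU[OF 2] g1 g2 by auto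
  then obtain f g where f: "linear f" "f ` \<xi>\<^sub>1 = \<xi>\<^sub>2" "\<And>x. x \<in> \<xi>\<^sub>1 \<Longrightarrow> norm (f x) = norm x"
    and g: "linear g" "g ` ?U \<xi>\<^sub>1 = ?U \<xi>\<^sub>2" "\<And>x. x \<in> ?U \<xi>\<^sub>1 \<Longrightarrow> norm (g x) = norm x"
    using isometries_subspaces[OF g1(1) g2(1)] isometries_subspaces[OF sU[of \<xi>\<^sub>1] sU[of \<xi>\<^sub>2]] by metis
  let ?P = "closest_point \<xi>\<^sub>1" and ?Q = "closest_point (?U \<xi>\<^sub>1)" and ?R = "closest_point (W\<^sup>\<bottom>)"
  note p = closest_point_subspace[OF g1(1)] and q = closest_point_subspace[OF sU[of \<xi>\<^sub>1]]
    and r = closest_point_subspace[OF subspace_orthogonal_comp[of W]]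
  define T where "T z = f (?P z) + g (?Q z) + ?R z" for z
  have lT: "linear T"
    unfolding T_def
    by (intro linear_compose_add linear_compose[unfolded o_def, OF linear_closest_point f(1)]
        linear_compose[unfolded o_def, OF linear_closest_point g(1)] linear_closest_point sU g1 subspace_orthogonal_comp)
  have dec: "z = ?P z + ?Q z + ?R z" for z
  proof -
    have "?U \<xi>\<^sub>1 \<subseteq> \<xi>\<^sub>1\<^sup>\<bottom>" by simp
    from closest_point_set_plus[OF g1(1) sU this]
    have PQ: "closest_point (\<xi>\<^sub>1 + ?U \<xi>\<^sub>1) z = ?P z + ?Q z" .
    have "\<xi>\<^sub>1 + ?U \<xi>\<^sub>1 = W"
    proof
      show "\<xi>\<^sub>1 + ?U \<xi>\<^sub>1 \<subseteq> W" using g1 W by (auto elim!: set_plus_elim intro: subspace_add)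
      show "W \<subseteq> \<xi>\<^sub>1 + ?U \<xi>\<^sub>1"
      proof
        fix w assume w: "w \<in> W"
        have "w - ?P w \<in> ?U \<xi>\<^sub>1" using p[of w] w g1 W by (auto intro: subspace_diff)
        then have "?P w + (w - ?P w) \<in> \<xi>\<^sub>1 + ?U \<xi>\<^sub>1" using p by (intro set_plus_intro) auto
        then show "w \<in> \<xi>\<^sub>1 + ?U \<xi>\<^sub>1" by simp
      qed
    qed
    then have "?P z + ?Q z = closest_point W z" using PQ by simp
    moreover have "?R z = z - closest_point W z"
      using closest_point_subspace[OF W, of z]
      by (intro closest_point_subspace_unique subspace_orthogonal_comp) (simp_all add: orthogonal_comp_self[OF W])
    ultimately show ?thesis by simp
  qed
  have pyth: "norm (a + b + c) ^ 2 = norm a ^ 2 + norm b ^ 2 + norm c ^ 2"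
    if "a \<in> \<xi>" "b \<in> ?U \<xi>" "c \<in> W\<^sup>\<bottom>" "\<xi> \<in> grassmannian_in j W" for a b c \<xi>
  proof -
    have "orthogonal a b" "orthogonal a c" "orthogonal b c"
      using that grassmannian_inD[OF that(4)] by (auto simp: orthogonal_comp_def)
    then show ?thesis
      by (simp add: power2_norm_eq_inner inner_add_left inner_add_right orthogonal_def inner_commute)
  qed
  have fP: "f (?P z) \<in> \<xi>\<^sub>2" and gQ: "g (?Q z) \<in> ?U \<xi>\<^sub>2" for z
    using p q f(2) g(2) by blast+
  have nT: "norm (T z) = norm z" for z
  proof -
    have "norm (T z) ^ 2 = norm (f (?P z)) ^ 2 + norm (g (?Q z)) ^ 2 + norm (?R z) ^ 2"
      unfolding T_def by (rule pyth[OF fP gQ _ 2]) (rule r)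
    also have "\<dots> = norm (?P z) ^ 2 + norm (?Q z) ^ 2 + norm (?R z) ^ 2"
      using f(3) g(3) p q by simp
    also have "\<dots> = norm (?P z + ?Q z + ?R z) ^ 2"
      by (rule pyth[OF _ _ _ 1, symmetric]) (rule p q r)+
    finally show ?thesis using dec[of z] by simp
  qed
  let ?\<gamma> = "matrix T"
  have mT: "?\<gamma> *v z = T z" for z using lT by (simp add: matrix_works)
  have "orthogonal_matrix ?\<gamma>"
    using lT nT orthogonal_transformation_matrix[of T] by (simp add: orthogonal_transformation)
  moreover have "T z = z" if "z \<in> W\<^sup>\<bottom>" for z
  proof -
    have z: "z \<in> \<xi>\<^sub>1\<^sup>\<bottom>" "z \<in> (?U \<xi>\<^sub>1)\<^sup>\<bottom>"
      using that orthogonal_comp_anti_mono[of _ W] g1(2) by (blast, metis inf_le1 subsetD)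
    have "?P z = 0" "?Q z = 0" "?R z = z"
      using z that sU g1 subspace_orthogonal_comp subspace_0
      by (auto intro!: closest_point_subspace_unique simp: closest_point_self)
    then show ?thesis using f g by (simp add: T_def linear_0)
  qed
  ultimately have "?\<gamma> \<in> fixing_group (W\<^sup>\<bottom>)" by (simp add: fixing_group_def mT)
  moreover have "(*v) ?\<gamma> ` \<xi>\<^sub>1 = \<xi>\<^sub>2"
  proof -
    have "T z = f z" if z: "z \<in> \<xi>\<^sub>1" for z
    proof -
      have "?P z = z" using z by (rule closest_point_self)
      moreover have "?Q z = 0"
        using z sU subspace_0 by (intro closest_point_subspace_unique) (auto simp: orthogonal_comp_def orthogonal_commute orthogonal_clauses)
      moreover have "?R z = 0"
        using z g1(2) subspace_orthogonal_comp subspace_0 orthogonal_comp_subset[of W]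
        by (intro closest_point_subspace_unique) auto
      ultimately show ?thesis using g by (simp add: T_def linear_0)
    qed
    then have "(*v) ?\<gamma> ` \<xi>\<^sub>1 = f ` \<xi>\<^sub>1" by (intro image_cong) (simp_all add: mT)
    then show ?thesis using f(2) by simp
  qed
  ultimately show ?thesis by blast
qed

text \<open>The predicate under the definite description in
  \<open>grassmannian_measure_borel\<close>.\<close>

definition grassmannian_invariant :: "nat \<Rightarrow> (real^'n) set \<Rightarrow> (real^'n) set measure \<Rightarrow> bool" where
  "grassmannian_invariant j W \<mu> \<longleftrightarrow> prob_space \<mu> \<and> sets \<mu> = sets (grassmannian_borel j W) \<and>
     (\<forall>\<gamma>. orthogonal_matrix \<gamma> \<and> (*v) \<gamma> ` W = W \<longrightarrow> distr \<mu> \<mu> (\<lambda>\<xi>. (*v) \<gamma> ` \<xi>) = \<mu>)"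

lemma matrix_image_mult: "(*v) (\<gamma> ** \<rho>) ` S = (*v) \<gamma> ` (*v) \<rho> ` S"
proof -
  have "(*v) (\<gamma> ** \<rho>) = (*v) \<gamma> \<circ> (*v) \<rho>" by (simp add: fun_eq_iff matrix_vector_mul_assoc)
  then show ?thesis by (simp only: image_comp)
qed

lemma matrix_image_transpose:
  "orthogonal_matrix \<gamma> \<Longrightarrow> (*v) (transpose \<gamma>) ` (*v) \<gamma> ` S = S"
  "orthogonal_matrix \<gamma> \<Longrightarrow> (*v) \<gamma> ` (*v) (transpose \<gamma>) ` S = S"
  unfolding image_image by (simp_all only: orthogonal_matrix_cancel(5,6) image_ident)

text \<open>Averaging over the inverses makes the inner integral constant on the orbits by left
  invariance alone.\<close>

lemma grassmannian_invariant_emeasure: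
  fixes W :: "(real^'n) set"
  assumes W: "subspace W" and \<xi>\<^sub>1: "\<xi>\<^sub>1 \<in> grassmannian_in j W" and \<mu>: "grassmannian_invariant j W \<mu>"
    and m: "prob_space m" "sets m = sets (fixing_borel (W\<^sup>\<bottom>))"
    and left: "\<And>\<gamma>. \<gamma> \<in> fixing_group (W\<^sup>\<bottom>) \<Longrightarrow> distr m m (\<lambda>\<rho>. \<gamma> ** \<rho>) = m"
    and A: "A \<in> sets (grassmannian_borel j W)"
  shows "emeasure \<mu> A = (\<integral>\<^sup>+\<rho>. indicator A ((*v) (transpose \<rho>) ` \<xi>\<^sub>1) \<partial>m)"
proof -
  let ?K = "fixing_group (W\<^sup>\<bottom>)" and ?G = "grassmannian_borel j W"
  let ?g = "\<lambda>\<xi>. (\<integral>\<^sup>+\<rho>. indicator A ((*v) (transpose \<rho>) ` \<xi>) \<partial>m) :: ennreal"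
  have s: "sets \<mu> = sets ?G" and inv: "\<And>\<gamma>. orthogonal_matrix \<gamma> \<Longrightarrow> (*v) \<gamma> ` W = W \<Longrightarrow> distr \<mu> \<mu> (\<lambda>\<xi>. (*v) \<gamma> ` \<xi>) = \<mu>"
    using \<mu> by (auto simp: grassmannian_invariant_def)
  interpret \<mu>: prob_space \<mu> using \<mu> by (simp add: grassmannian_invariant_def)
  interpret m: prob_space m by fact
  interpret pair_sigma_finite m \<mu> ..
  have sp: "space \<mu> = grassmannian_in j W" "space m = ?K"
    using sets_eq_imp_space_eq[OF s] sets_eq_imp_space_eq[OF m(2)] by simp_all
  have act: "(\<lambda>(\<rho>, \<xi>). (*v) (transpose \<rho>) ` \<xi>) \<in> measurable (m \<Otimes>\<^sub>M \<mu>) ?G"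
    using measurable_fixing_group_action[OF W, of j]
    by (simp add: measurable_cong_sets[OF sets_pair_measure_cong[OF m(2) s] refl])
  have ind: "(\<lambda>(\<rho>, \<xi>). indicator A ((*v) (transpose \<rho>) ` \<xi>) :: ennreal) \<in> borel_measurable (m \<Otimes>\<^sub>M \<mu>)"
    using measurable_compose[OF act borel_measurable_indicator[OF A]] by (simp add: case_prod_beta')
  have O: "orthogonal_matrix \<gamma>" if "\<gamma> \<in> ?K" for \<gamma> using that by (simp add: fixing_group_def)
  have mt: "(\<lambda>\<rho>. (*v) (transpose \<rho>) ` \<xi>) \<in> measurable m ?G" if "\<xi> \<in> grassmannian_in j W" for \<xi>
    using measurable_compose[OF measurable_Pair2'[of \<xi> \<mu> m] act] that by (simp add: sp)
  have g_inv: "?g ((*v) \<gamma> ` \<xi>) = ?g \<xi>" if \<gamma>: "\<gamma> \<in> ?K" and \<xi>: "\<xi> \<in> grassmannian_in j W" for \<gamma> \<xi>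
  proof -
    have t\<gamma>: "transpose \<gamma> \<in> ?K" by (rule fixing_group_transpose[OF \<gamma>])
    have "?g ((*v) \<gamma> ` \<xi>) = (\<integral>\<^sup>+\<rho>. indicator A ((*v) (transpose (transpose \<gamma> ** \<rho>)) ` \<xi>) \<partial>m)"
      by (simp only: matrix_transpose_mul transpose_transpose matrix_image_mult)
    also have "\<dots> = (\<integral>\<^sup>+\<rho>. indicator A ((*v) (transpose \<rho>) ` \<xi>) \<partial>distr m m (\<lambda>\<rho>. transpose \<gamma> ** \<rho>))"
    proof (rule nn_integral_distr[symmetric])
      show "(\<lambda>\<rho>. transpose \<gamma> ** \<rho>) \<in> measurable m m"
        unfolding measurable_cong_sets[OF m(2) m(2)] by (rule measurable_fixing_borel_mult[OF t\<gamma>])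
      show "(\<lambda>\<rho>. indicator A ((*v) (transpose \<rho>) ` \<xi>) :: ennreal)
          \<in> borel_measurable (distr m m (\<lambda>\<rho>. transpose \<gamma> ** \<rho>))"
        using measurable_compose[OF mt[OF \<xi>] borel_measurable_indicator[OF A]]
        by (simp only: measurable_distr_eq1)
    qed
    also have "\<dots> = ?g \<xi>" by (simp only: left[OF t\<gamma>])
    finally show ?thesis .
  qed
  have "emeasure \<mu> A = (\<integral>\<^sup>+\<rho>. emeasure \<mu> A \<partial>m)" by (simp add: m.emeasure_space_1)
  also have "\<dots> = (\<integral>\<^sup>+\<rho>. (\<integral>\<^sup>+\<xi>. indicator A ((*v) (transpose \<rho>) ` \<xi>) \<partial>\<mu>) \<partial>m)"
  proof (rule nn_integral_cong)
    fix \<rho> assume "\<rho> \<in> space m"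
    then have t: "transpose \<rho> \<in> ?K" by (simp add: sp fixing_group_transpose)
    note tW = fixing_group_image[OF W t]
    have "(\<lambda>\<xi>. (*v) (transpose \<rho>) ` \<xi>) \<in> measurable \<mu> \<mu>"
      using measurable_grassmannian_image[OF O[OF t], of j W]
      by (simp only: tW measurable_cong_sets[OF s s])
    then have "(\<integral>\<^sup>+\<xi>. indicator A ((*v) (transpose \<rho>) ` \<xi>) \<partial>\<mu>) = (\<integral>\<^sup>+\<xi>. indicator A \<xi> \<partial>distr \<mu> \<mu> (\<lambda>\<xi>. (*v) (transpose \<rho>) ` \<xi>))"
      using A s by (subst nn_integral_distr) auto
    also have "\<dots> = emeasure \<mu> A" using A s by (simp only: inv[OF O[OF t] tW] nn_integral_indicator)
    finally show "emeasure \<mu> A = (\<integral>\<^sup>+\<xi>. indicator A ((*v) (transpose \<rho>) ` \<xi>) \<partial>\<mu>)" by simp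
  qed
  also have "\<dots> = (\<integral>\<^sup>+\<xi>. ?g \<xi> \<partial>\<mu>)" by (rule Fubini'[symmetric, OF ind])
  \<comment> \<open>By transitivity there is a single orbit, so the integrand is constant, and
    \<open>\<mu>\<close> has mass 1.\<close>
  also have "\<dots> = (\<integral>\<^sup>+\<xi>. ?g \<xi>\<^sub>1 \<partial>\<mu>)"
  proof (rule nn_integral_cong)
    fix \<xi> assume "\<xi> \<in> space \<mu>"
    then have "\<xi> \<in> grassmannian_in j W" by (simp add: sp)
    then obtain \<gamma> where "\<gamma> \<in> ?K" "(*v) \<gamma> ` \<xi>\<^sub>1 = \<xi>"
      using fixing_group_transitive[OF W \<xi>\<^sub>1] by blast
    then show "?g \<xi> = ?g \<xi>\<^sub>1" using g_inv[OF _ \<xi>\<^sub>1] by metis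
  qed
  also have "\<dots> = ?g \<xi>\<^sub>1" by (simp add: \<mu>.emeasure_space_1)
  finally show ?thesis .
qed

section \<open>Uniqueness, existence and covariance of the invariant measure\<close>

lemma grassmannian_in_nonempty:
  assumes "subspace W" "j \<le> dim W"
  shows "\<exists>\<xi>. \<xi> \<in> grassmannian_in j W"
proof -
  obtain T where "subspace T" "T \<subseteq> span W" "dim T = j"
    using choose_subspace_of_subspace[OF assms(2)] .
  moreover have "span W = W" using assms(1) by (simp only: span_eq_iff)
  ultimately show ?thesis by (auto simp: grassmannian_in_def)
qed

text \<open>The formula for \<open>emeasure \<mu> A\<close> involves only a base point and a measure
  on the group, so all invariant measures share its value. The bound on \<open>j\<close> provides
  the base point.\<close>

lemma grassmannian_invariant_unique:
  assumes W: "subspace W" and j: "j \<le> dim W"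
    and "grassmannian_invariant j W \<mu>" "grassmannian_invariant j W \<nu>"
  shows "\<mu> = \<nu>"
proof (rule measure_eqI)
  obtain \<xi> where \<xi>: "\<xi> \<in> grassmannian_in j W" using grassmannian_in_nonempty[OF W j] by blast
  obtain m where m: "prob_space m" "sets m = sets (fixing_borel (W\<^sup>\<bottom>))"
    "\<And>\<gamma>. \<gamma> \<in> fixing_group (W\<^sup>\<bottom>) \<Longrightarrow> distr m m (\<lambda>\<rho>. \<gamma> ** \<rho>) = m"
    using fixing_group_left_invariant_exists[of "W\<^sup>\<bottom>"] by blast
  show "sets \<mu> = sets \<nu>" using assms by (simp add: grassmannian_invariant_def)
  fix A assume "A \<in> sets \<mu>"
  then have "A \<in> sets (grassmannian_borel j W)" using assms by (simp add: grassmannian_invariant_def)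
  then show "emeasure \<mu> A = emeasure \<nu> A"
    using grassmannian_invariant_emeasure[OF W \<xi> _ m] assms by simp
qed

text \<open>Invariance is demanded for every orthogonal matrix preserving \<open>W\<close>, whatever
  it does on \<open>W\<^sup>\<bottom>\<close>. Putting the identity there leaves its action on
  subspaces of \<open>W\<close> unchanged and lands in the group that carries the Haar
  measure.\<close>

lemma orthogonal_matrix_restrict:
  fixes W :: "(real^'n) set"
  assumes W: "subspace W" and \<gamma>: "orthogonal_matrix \<gamma>" and \<gamma>W: "(*v) \<gamma> ` W = W"
  shows "\<exists>\<gamma>'\<in>fixing_group (W\<^sup>\<bottom>). \<forall>z\<in>W. \<gamma>' *v z = \<gamma> *v z"
proof -
  let ?P = "closest_point W"
  note o = subspace_orthogonal_comp[of W]
  note p = closest_point_subspace[OF W] and lP = linear_closest_point[OF W]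
  define T where "T z = \<gamma> *v ?P z + (z - ?P z)" for z
  have lT: "linear T"
    unfolding T_def
    by (intro linear_compose_add linear_compose_sub linear_ident lP linear_compose[unfolded o_def, OF lP]) simp
  have pyth: "norm (a + b) ^ 2 = norm a ^ 2 + norm b ^ 2" if "a \<in> W" "b \<in> W\<^sup>\<bottom>" for a b
    using that by (intro norm_add_Pythagorean) (auto simp: orthogonal_comp_def)
  have nT: "norm (T z) = norm z" for z
  proof -
    have "norm (T z) ^ 2 = norm (\<gamma> *v ?P z) ^ 2 + norm (z - ?P z) ^ 2"
      unfolding T_def using p \<gamma>W by (intro pyth) blast+
    also have "\<dots> = norm (?P z) ^ 2 + norm (z - ?P z) ^ 2"
      using orthogonal_transformation_norm[OF orthogonal_matrix_imp_transformation[OF \<gamma>]] by simp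
    also have "\<dots> = norm (?P z + (z - ?P z)) ^ 2"
      using p by (intro pyth[symmetric])
    finally show ?thesis by simp
  qed
  have mT: "matrix T *v z = T z" for z using lT by (simp add: matrix_works)
  have "orthogonal_matrix (matrix T)"
    using lT nT orthogonal_transformation_matrix[of T] by (simp add: orthogonal_transformation)
  moreover have "T z = z" if "z \<in> W\<^sup>\<bottom>" for z
  proof -
    have "?P z = 0" using that W subspace_0 by (intro closest_point_subspace_unique) auto
    then show ?thesis by (simp add: T_def)
  qed
  moreover have "T z = \<gamma> *v z" if "z \<in> W" for z using closest_point_self[OF that] by (simp add: T_def)
  ultimately show ?thesis by (intro bexI[of _ "matrix T"]) (auto simp: fixing_group_def mT)
qed

text \<open>The orbit map of a base point pushes the left invariant measure of the group forward;
  acting on the orbit is left multiplication in the group.\<close>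

lemma grassmannian_invariant_exists:
  fixes W :: "(real^'n) set"
  assumes W: "subspace W" and j: "j \<le> dim W"
  shows "\<exists>\<mu>. grassmannian_invariant j W \<mu>"
proof -
  let ?K = "fixing_group (W\<^sup>\<bottom>)" and ?G = "grassmannian_borel j W"
  obtain \<xi> where \<xi>: "\<xi> \<in> grassmannian_in j W" using grassmannian_in_nonempty[OF W j] by blast
  obtain m where m: "prob_space m" "sets m = sets (fixing_borel (W\<^sup>\<bottom>))"
    "\<And>\<gamma>. \<gamma> \<in> ?K \<Longrightarrow> distr m m (\<lambda>\<rho>. \<gamma> ** \<rho>) = m"
    using fixing_group_left_invariant_exists[of "W\<^sup>\<bottom>"] by blast
  interpret m: prob_space m by fact
  have sp: "space m = ?K" using sets_eq_imp_space_eq[OF m(2)] by simp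
  have O: "orthogonal_matrix \<gamma>" if "\<gamma> \<in> ?K" for \<gamma> using that by (simp add: fixing_group_def)
  let ?f = "\<lambda>\<rho>. (*v) \<rho> ` \<xi>"
  have f: "?f \<in> measurable m ?G"
    unfolding measurable_cong_sets[OF m(2) refl]
  proof (rule measurable_grassmannian_borelI)
    fix \<rho> assume "\<rho> \<in> space (fixing_borel (W\<^sup>\<bottom>))"
    then have \<rho>: "\<rho> \<in> ?K" by simp
    show "(*v) \<rho> ` \<xi> \<in> grassmannian_in j W"
      using grassmannian_in_image[OF O[OF \<rho>] \<xi>] by (simp only: fixing_group_image[OF W \<rho>])
  next
    have "(\<lambda>\<rho>. \<rho> ** matrix (closest_point \<xi>) ** transpose \<rho>) \<in> borel_measurable (fixing_borel (W\<^sup>\<bottom>))"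
      by (intro borel_measurable_matrix_mult borel_measurable_transpose measurable_fixing_borel_id borel_measurable_const)
    then show "(\<lambda>\<rho>. matrix (closest_point (?f \<rho>))) \<in> borel_measurable (fixing_borel (W\<^sup>\<bottom>))"
      by (rule measurable_cong[THEN iffD1, rotated])
         (simp add: projection_matrix_image[OF O] grassmannian_inD[OF \<xi>])
  qed
  define \<mu> where "\<mu> = distr m ?G ?f"
  have "prob_space \<mu>" unfolding \<mu>_def by (rule m.prob_space_distr[OF f])
  moreover have "distr \<mu> \<mu> (\<lambda>\<xi>. (*v) \<gamma> ` \<xi>) = \<mu>" if \<gamma>: "orthogonal_matrix \<gamma>" "(*v) \<gamma> ` W = W" for \<gamma>
  proof -
    obtain \<gamma>' where \<gamma>': "\<gamma>' \<in> ?K" "\<And>z. z \<in> W \<Longrightarrow> \<gamma>' *v z = \<gamma> *v z"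
      using orthogonal_matrix_restrict[OF W \<gamma>] by blast
    have eq: "(*v) \<gamma> ` ?f \<rho> = ?f (\<gamma>' ** \<rho>)" if "\<rho> \<in> ?K" for \<rho>
    proof -
      have "?f \<rho> \<subseteq> W" using grassmannian_inD(2)[OF \<xi>] fixing_group_image[OF W that] by blast
      then have "(*v) \<gamma> ` ?f \<rho> = (*v) \<gamma>' ` ?f \<rho>" using \<gamma>'(2) by (intro image_cong) auto
      then show ?thesis by (simp only: matrix_image_mult)
    qed
    have g: "(\<lambda>\<xi>. (*v) \<gamma> ` \<xi>) \<in> measurable ?G ?G"
      using measurable_grassmannian_image[OF \<gamma>(1), of j W] by (simp only: \<gamma>(2))
    have mm: "(\<lambda>\<rho>. \<gamma>' ** \<rho>) \<in> measurable m m"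
      unfolding measurable_cong_sets[OF m(2) m(2)] by (rule measurable_fixing_borel_mult[OF \<gamma>'(1)])
    have "distr \<mu> \<mu> (\<lambda>\<xi>. (*v) \<gamma> ` \<xi>) = distr \<mu> ?G (\<lambda>\<xi>. (*v) \<gamma> ` \<xi>)"
      by (rule distr_cong) (auto simp: \<mu>_def)
    also have "\<dots> = distr m ?G (\<lambda>\<rho>. (*v) \<gamma> ` ?f \<rho>)"
      unfolding \<mu>_def by (subst distr_distr[OF g f]) (simp add: o_def)
    also have "\<dots> = distr m ?G (\<lambda>\<rho>. ?f (\<gamma>' ** \<rho>))"
      by (rule distr_cong) (simp_all only: sp eq)
    also have "\<dots> = distr (distr m m (\<lambda>\<rho>. \<gamma>' ** \<rho>)) ?G ?f"
      by (subst distr_distr[OF f mm]) (simp add: o_def)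
    also have "\<dots> = \<mu>" by (simp add: m(3)[OF \<gamma>'(1)] \<mu>_def)
    finally show ?thesis .
  qed
  ultimately show ?thesis by (intro exI[of _ \<mu>]) (simp add: grassmannian_invariant_def \<mu>_def)
qed

lemma grassmannian_invariant_measure_borel:
  assumes "subspace W" "j \<le> dim W"
  shows "grassmannian_invariant j W (grassmannian_measure_borel j W)"
proof -
  have "\<exists>!\<mu>. grassmannian_invariant j W \<mu>"
    using grassmannian_invariant_exists[OF assms] grassmannian_invariant_unique[OF assms] by blast
  then show ?thesis
    unfolding grassmannian_measure_borel_def grassmannian_invariant_def[symmetric] by (rule theI')
qed

text \<open>By uniqueness: a matrix \<open>\<delta>\<close> preserving the image of \<open>W\<close>
  is conjugate under \<open>\<gamma>\<close> to one preserving \<open>W\<close>, so the push-forward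
  is invariant. Averages over the complement of a rotated plane thereby become averages over one
  fixed Grassmannian.\<close>

lemma grassmannian_measure_borel_image:
  fixes \<gamma> :: "real^'n^'n"
  assumes W: "subspace W" and j: "j \<le> dim W" and \<gamma>: "orthogonal_matrix \<gamma>"
  shows "grassmannian_measure_borel j ((*v) \<gamma> ` W) =
    distr (grassmannian_measure_borel j W) (grassmannian_borel j ((*v) \<gamma> ` W)) (\<lambda>\<xi>. (*v) \<gamma> ` \<xi>)"
proof -
  let ?W = "(*v) \<gamma> ` W" and ?\<mu> = "grassmannian_measure_borel j W"
  let ?G = "grassmannian_borel j ?W"
  have W': "subspace ?W" using W by (intro linear_subspace_image) auto
  have "inj ((*v) \<gamma>)"
    using orthogonal_transformation_inj[OF orthogonal_matrix_imp_transformation[OF \<gamma>]] .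
  then have "dim ?W = dim W" by (intro dim_image_eq) (auto intro: inj_on_subset)
  with j have j': "j \<le> dim ?W" by simp
  have \<mu>: "grassmannian_invariant j W ?\<mu>" by (rule grassmannian_invariant_measure_borel[OF W j])
  interpret prob_space ?\<mu> using \<mu> by (simp add: grassmannian_invariant_def)
  have s: "sets ?\<mu> = sets (grassmannian_borel j W)" using \<mu> by (simp add: grassmannian_invariant_def)
  have f: "(\<lambda>\<xi>. (*v) \<gamma> ` \<xi>) \<in> measurable ?\<mu> ?G"
    unfolding measurable_cong_sets[OF s refl] by (rule measurable_grassmannian_image[OF \<gamma>])
  let ?\<nu> = "distr ?\<mu> ?G (\<lambda>\<xi>. (*v) \<gamma> ` \<xi>)"
  have "distr ?\<nu> ?\<nu> (\<lambda>\<xi>. (*v) \<delta> ` \<xi>) = ?\<nu>" if \<delta>: "orthogonal_matrix \<delta>" "(*v) \<delta> ` ?W = ?W" for \<delta>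
  proof -
    let ?\<delta> = "transpose \<gamma> ** \<delta> ** \<gamma>"
    have o: "orthogonal_matrix ?\<delta>" using \<gamma> \<delta> by (intro orthogonal_matrix_mul) simp_all
    have "(*v) ?\<delta> ` W = W"
      by (simp only: matrix_image_mult \<delta>(2) matrix_image_transpose[OF \<gamma>])
    with \<mu> o have inv: "distr ?\<mu> ?\<mu> (\<lambda>\<xi>. (*v) ?\<delta> ` \<xi>) = ?\<mu>"
      unfolding grassmannian_invariant_def by blast
    have m\<delta>: "(\<lambda>\<xi>. (*v) ?\<delta> ` \<xi>) \<in> measurable ?\<mu> ?\<mu>"
      using measurable_grassmannian_image[OF o, of j W]
      by (simp only: \<open>(*v) ?\<delta> ` W = W\<close> measurable_cong_sets[OF s s])
    have g: "(\<lambda>\<xi>. (*v) \<delta> ` \<xi>) \<in> measurable ?G ?G"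
      using measurable_grassmannian_image[OF \<delta>(1), of j ?W] by (simp only: \<delta>(2))
    have "distr ?\<nu> ?\<nu> (\<lambda>\<xi>. (*v) \<delta> ` \<xi>) = distr ?\<nu> ?G (\<lambda>\<xi>. (*v) \<delta> ` \<xi>)"
      by (rule distr_cong) auto
    also have "\<dots> = distr ?\<mu> ?G (\<lambda>\<xi>. (*v) \<delta> ` (*v) \<gamma> ` \<xi>)"
      by (subst distr_distr[OF g f]) (simp add: o_def)
    also have "\<dots> = distr ?\<mu> ?G (\<lambda>\<xi>. (*v) \<gamma> ` (*v) ?\<delta> ` \<xi>)"
      by (simp only: matrix_image_mult matrix_image_transpose[OF \<gamma>])
    also have "\<dots> = distr (distr ?\<mu> ?\<mu> (\<lambda>\<xi>. (*v) ?\<delta> ` \<xi>)) ?G (\<lambda>\<xi>. (*v) \<gamma> ` \<xi>)"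
      by (subst distr_distr[OF f m\<delta>]) (simp add: o_def)
    also have "\<dots> = ?\<nu>" by (simp only: inv)
    finally show ?thesis .
  qed
  then have "grassmannian_invariant j ?W ?\<nu>"
    unfolding grassmannian_invariant_def using prob_space_distr[OF f] by simp
  then show ?thesis
    by (rule grassmannian_invariant_unique[OF W' j' grassmannian_invariant_measure_borel[OF W' j']])
qed

section \<open>Polar coordinates\<close>

text \<open>Adds the radius 0, that is, that the origin is null, so that the distribution function
  of the norm is known at every radius.\<close>

lemma emeasure_subspace_lborel_cball':
  fixes S :: "(real^'n) set"
  assumes S: "subspace S" and d: "dim S > 0" and "r \<ge> 0"
  shows "emeasure (subspace_lborel S) (cball 0 r) = ennreal (unit_ball_vol (real (dim S)) * r ^ dim S)"
proof (cases "r = 0")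
  case True
  let ?w = "unit_ball_vol (real (dim S))" and ?e = "emeasure (subspace_lborel S) (cball 0 0)"
  have "?e \<le> 0 + ennreal \<epsilon>" if "\<epsilon> > 0" for \<epsilon>
  proof -
    \<comment> \<open>Since \<open>t \<le> 1\<close>, the power of \<open>t\<close> in the ball
      volume is at most \<open>t\<close>, and the second bound then brings the volume below
      \<open>\<epsilon>\<close>.\<close>
    define t where "t = min 1 (\<epsilon> / ?w)"
    have w: "?w > 0" by simp
    then have t: "0 < t" "t \<le> 1" "?w * t \<le> \<epsilon>"
      using that by (auto simp: t_def min_def field_simps)
    have "?e \<le> emeasure (subspace_lborel S) (cball 0 t)"
      using t by (intro emeasure_mono) auto
    also have "\<dots> = ennreal (?w * t ^ dim S)" by (rule emeasure_subspace_lborel_cball[OF S t(1)])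
    also have "\<dots> \<le> ennreal (?w * t ^ 1)"
      using t d w by (intro ennreal_leI mult_left_mono power_decreasing) auto
    also have "\<dots> \<le> ennreal \<epsilon>" using t by (intro ennreal_leI) simp
    finally show ?thesis by simp
  qed
  then have "?e \<le> 0" by (rule ennreal_le_epsilon)
  then show ?thesis using True d by simp
next
  case False
  then show ?thesis using assms by (intro emeasure_subspace_lborel_cball) auto
qed

text \<open>Both measures have the ball volumes as distribution function, the density being its
  derivative; half-lines form an intersection-stable generator.\<close>

lemma distr_subspace_lborel_norm:
  fixes S :: "(real^'n) set"
  assumes S: "subspace S" and d: "dim S > 0"
  shows "distr (subspace_lborel S) borel norm =
    density lborel (\<lambda>r. ennreal (unit_ball_vol (real (dim S)) * (real (dim S) * r ^ (dim S - 1))) * indicator {0..} r)"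
    (is "?M = ?N")
proof -
  let ?w = "unit_ball_vol (real (dim S))" and ?d = "dim S"
  have eM: "emeasure ?M {..r} = (if r < 0 then 0 else ennreal (?w * r ^ ?d))" for r
  proof -
    have "norm -` {..r} = (cball 0 r :: (real^'n) set)" by auto
    then have "emeasure ?M {..r} = emeasure (subspace_lborel S) (cball 0 r)"
      by (subst emeasure_distr) auto
    also have "\<dots> = (if r < 0 then 0 else ennreal (?w * r ^ ?d))"
      using emeasure_subspace_lborel_cball'[OF S d, of r] by (auto simp: cball_empty)
    finally show ?thesis .
  qed
  have eN: "emeasure ?N {..r} = (if r < 0 then 0 else ennreal (?w * r ^ ?d))" for r
  proof (cases "r < 0")
    case True
    have "emeasure ?N {..r} = (\<integral>\<^sup>+x. ennreal (?w * (real ?d * x ^ (?d - 1))) * indicator {0..} x * indicator {..r} x \<partial>lborel)"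
      by (subst emeasure_density) auto
    also have "\<dots> = (\<integral>\<^sup>+(x::real). 0 \<partial>lborel)"
      using True by (intro nn_integral_cong) (auto split: split_indicator)
    finally show ?thesis using True by simp
  next
    case False
    have "emeasure ?N {..r} = (\<integral>\<^sup>+x. ennreal (?w * (real ?d * x ^ (?d - 1))) * indicator {0..r} x \<partial>lborel)"
      by (subst emeasure_density) (auto intro!: nn_integral_cong split: split_indicator)
    also have "\<dots> = ennreal (?w * r ^ ?d - ?w * 0 ^ ?d)"
    proof (rule nn_integral_FTC_Icc)
      fix x :: real
      show "((\<lambda>x. ?w * x ^ ?d) has_real_derivative ?w * (real ?d * x ^ (?d - 1))) (at x)"
        by (auto intro!: derivative_eq_intros)
    qed (use False in auto)
    finally show ?thesis using False d by simp
  qed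
  show ?thesis
  proof (rule measure_eqI_generator_eq[where E = "range atMost" and \<Omega> = UNIV and A = "\<lambda>i. {..real i}"])
    show "sets ?M = sigma_sets UNIV (range atMost)" "sets ?N = sigma_sets UNIV (range atMost)"
      by (simp_all add: borel_eq_atMost)
    show "(\<Union>i. {..real i}) = UNIV" using real_arch_simple by auto
    show "emeasure ?M X = emeasure ?N X" if "X \<in> range atMost" for X
      using that by (elim rangeE) (simp only: eM eN)
    show "emeasure ?M {..real i} \<noteq> \<infinity>" for i
      by (simp only: eM) simp
  qed (auto simp: Int_stable_def)
qed

lemma nn_integral_subspace_lborel_radial:
  fixes S :: "(real^'n) set"
  assumes S: "subspace S" and d: "dim S > 0" and [measurable]: "a \<in> borel_measurable borel"
  shows "(\<integral>\<^sup>+z. a (norm z) \<partial>subspace_lborel S) =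
    (\<integral>\<^sup>+r. ennreal (unit_ball_vol (real (dim S)) * (real (dim S) * r ^ (dim S - 1))) * indicator {0..} r * a r \<partial>lborel)"
proof -
  have "(\<integral>\<^sup>+z. a (norm z) \<partial>subspace_lborel S) = (\<integral>\<^sup>+r. a r \<partial>distr (subspace_lborel S) borel norm)"
    by (subst nn_integral_distr) auto
  then show ?thesis
    unfolding distr_subspace_lborel_norm[OF S d] by (subst (asm) nn_integral_density) auto
qed

text \<open>\<open>d\<close> times the unit ball volume is the area of the unit sphere in dimension
  \<open>d\<close>, so this is a quotient of two sphere areas.\<close>

definition averaging_constant :: "nat \<Rightarrow> nat \<Rightarrow> real" where
  "averaging_constant n d = (real d * unit_ball_vol (real d)) / (real n * unit_ball_vol (real n))"

lemma averaging_constant_nonneg: "averaging_constant n d \<ge> 0"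
  by (simp add: averaging_constant_def)

lemma riesz_kernel_nonneg: "riesz_kernel \<alpha> y \<ge> 0"
  by (simp add: riesz_kernel_def)

lemma borel_measurable_riesz_kernel [measurable]: "riesz_kernel \<alpha> \<in> borel_measurable borel"
  unfolding riesz_kernel_def by measurable

lemma nn_integral_subspace_lborel_radial_riesz:
  fixes S :: "(real^'n) set"
  assumes S: "subspace S" and d: "dim S > 0" and [measurable]: "a \<in> borel_measurable borel"
  shows "(\<integral>\<^sup>+z. a (norm z) \<partial>subspace_lborel S) =
    (\<integral>\<^sup>+y. ennreal (averaging_constant CARD('n) (dim S) * riesz_kernel (real (dim S)) (y :: real^'n)) * a (norm y) \<partial>lborel)"
proof -
  let ?d = "dim S" and ?n = "CARD('n)"
  let ?C = "averaging_constant ?n ?d" and ?k = "\<lambda>r. 1 / r powr (real ?n - real ?d)"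
  have dn: "?d \<le> ?n" using dim_subset_UNIV[of S] by simp
  have n0: "?n > 0" by simp
  have "(\<integral>\<^sup>+y. ennreal (?C * riesz_kernel (real ?d) (y :: real^'n)) * a (norm y) \<partial>lborel)
    = (\<integral>\<^sup>+y. ennreal (?C * ?k (norm (y :: real^'n))) * a (norm y) \<partial>subspace_lborel UNIV)"
    by (simp add: subspace_lborel_UNIV riesz_kernel_def)
  also have "\<dots> = (\<integral>\<^sup>+r. ennreal (unit_ball_vol (real ?n) * (real ?n * r ^ (?n - 1))) * indicator {0..} r * (ennreal (?C * ?k r) * a r) \<partial>lborel)"
    using nn_integral_subspace_lborel_radial[of "UNIV :: (real^'n) set" "\<lambda>r. ennreal (?C * ?k r) * a r"]
    by simp
  also have "\<dots> = (\<integral>\<^sup>+r. ennreal (unit_ball_vol (real ?d) * (real ?d * r ^ (?d - 1))) * indicator {0..} r * a r \<partial>lborel)"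
  proof (rule nn_integral_cong_AE)
    \<comment> \<open>The kernel lowers the radial power from n - 1 to d - 1, and the constant
      exchanges the two sphere areas.\<close>
    have "unit_ball_vol (real ?n) * (real ?n * r ^ (?n - 1)) * (?C * ?k r) = unit_ball_vol (real ?d) * (real ?d * r ^ (?d - 1))"
      if "r > 0" for r :: real
    proof -
      have "r powr (real ?n - real ?d) = r ^ (?n - ?d)"
        using that dn by (simp add: powr_realpow[symmetric] of_nat_diff)
      moreover have "r ^ (?n - 1) = r ^ (?d - 1) * r ^ (?n - ?d)"
        using d dn by (simp add: power_add[symmetric])
      moreover have "unit_ball_vol (real ?n) \<noteq> 0" using unit_ball_vol_pos[of "real ?n"] by linarith
      ultimately show ?thesis using that n0 by (simp add: averaging_constant_def field_simps)
    qed
    then have "ennreal (unit_ball_vol (real ?n) * (real ?n * r ^ (?n - 1))) * indicator {0..} r * (ennreal (?C * ?k r) * a r)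
      = ennreal (unit_ball_vol (real ?d) * (real ?d * r ^ (?d - 1))) * indicator {0..} r * a r" if "r \<noteq> 0" for r :: real
      using that averaging_constant_nonneg[of ?n ?d]
      by (auto simp: ennreal_mult'[symmetric] mult.assoc[symmetric] split: split_indicator)
    then show "AE r in lborel. ennreal (unit_ball_vol (real ?n) * (real ?n * r ^ (?n - 1))) * indicator {0..} r * (ennreal (?C * ?k r) * a r)
      = ennreal (unit_ball_vol (real ?d) * (real ?d * r ^ (?d - 1))) * indicator {0..} r * a r"
      \<comment> \<open>At 0 the kernel is 0 by the conventions for \<open>powr\<close> and
        division, so the densities may disagree there; a single radius is null.\<close>
      using AE_lborel_singleton[of "0::real"] by (auto elim!: eventually_mono)
  qed
  also have "\<dots> = (\<integral>\<^sup>+z. a (norm z) \<partial>subspace_lborel S)"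
    by (rule nn_integral_subspace_lborel_radial[OF S d, symmetric]) measurable
  finally show ?thesis ..
qed

section \<open>Averages over the orthogonal group\<close>

lemma prob_space_orthogonal_haar_borel: "prob_space orthogonal_haar_borel"
  using orthogonal_haar_borel_invariant by blast

lemma sets_orthogonal_haar_borel: "sets orthogonal_haar_borel = sets (fixing_borel {})"
  using orthogonal_haar_borel_invariant by (auto simp: fixing_borel_empty)

lemma space_orthogonal_haar_borel [simp]: "space (orthogonal_haar_borel :: (real^'n^'n) measure) = {\<gamma>. orthogonal_matrix \<gamma>}"
  using sets_eq_imp_space_eq[OF sets_orthogonal_haar_borel] by (simp add: fixing_group_def)

lemma measurable_orthogonal_haar_borel_id: "(\<lambda>\<gamma>. \<gamma>) \<in> borel_measurable orthogonal_haar_borel"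
  using measurable_fixing_borel_id[of "{}"] by (simp only: measurable_cong_sets[OF sets_orthogonal_haar_borel refl])

text \<open>The reflection exchanging \<open>z\<close> and \<open>w\<close> is absorbed by right
  invariance; hence averages over the group are radial.\<close>

lemma nn_integral_haar_orbit:
  fixes F :: "real^'n \<Rightarrow> ennreal"
  assumes [measurable]: "F \<in> borel_measurable borel" and "norm z = norm w"
  shows "(\<integral>\<^sup>+\<gamma>. F (\<gamma> *v z) \<partial>orthogonal_haar_borel) = (\<integral>\<^sup>+\<gamma>. F (\<gamma> *v w) \<partial>orthogonal_haar_borel)"
proof -
  let ?h = "orthogonal_haar_borel :: (real^'n^'n) measure"
  note measurable_orthogonal_haar_borel_id[measurable]
  let ?r = "reflection (z - w)"
  have r: "?r \<in> fixing_group {}" by (simp add: fixing_group_def orthogonal_matrix_reflection)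
  have m: "(\<lambda>\<rho>. \<rho> ** ?r) \<in> measurable ?h ?h"
    using measurable_fixing_borel_mult(2)[OF r]
    by (simp only: measurable_cong_sets[OF sets_orthogonal_haar_borel sets_orthogonal_haar_borel])
  have "(\<integral>\<^sup>+\<gamma>. F (\<gamma> *v z) \<partial>?h) = (\<integral>\<^sup>+\<gamma>. F (\<gamma> *v z) \<partial>distr ?h ?h (\<lambda>\<rho>. \<rho> ** ?r))"
    using orthogonal_haar_borel_invariant orthogonal_matrix_reflection by metis
  also have "\<dots> = (\<integral>\<^sup>+\<gamma>. F ((\<gamma> ** ?r) *v z) \<partial>?h)"
    by (rule nn_integral_distr[OF m]) (simp only: measurable_distr_eq1, measurable)
  also have "\<dots> = (\<integral>\<^sup>+\<gamma>. F (\<gamma> *v w) \<partial>?h)"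
    using reflection_swap(1)[OF assms(2)] by (simp add: matrix_vector_mul_assoc[symmetric])
  finally show ?thesis .
qed

text \<open>After averaging over the group only a radial profile \<open>a\<close> remains, and the
  comparison in polar coordinates moves it from \<open>S\<close> to the whole space. There the
  average is undone, because Lebesgue measure and the kernel are both rotation invariant.\<close>

lemma nn_integral_haar_subspace:
  fixes S :: "(real^'n) set" and F :: "real^'n \<Rightarrow> ennreal"
  assumes S: "subspace S" and d: "dim S > 0" and [measurable]: "F \<in> borel_measurable borel"
  shows "(\<integral>\<^sup>+\<gamma>. (\<integral>\<^sup>+z. F (\<gamma> *v z) \<partial>subspace_lborel S) \<partial>orthogonal_haar_borel) =
    (\<integral>\<^sup>+y. ennreal (averaging_constant CARD('n) (dim S) * riesz_kernel (real (dim S)) y) * F y \<partial>lborel)"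
proof -
  let ?h = "orthogonal_haar_borel :: (real^'n^'n) measure"
  let ?K = "\<lambda>y :: real^'n. ennreal (averaging_constant CARD('n) (dim S) * riesz_kernel (real (dim S)) y)"
  interpret h: prob_space ?h by (rule prob_space_orthogonal_haar_borel)
  interpret S: sigma_finite_measure "subspace_lborel S" by (rule sigma_finite_subspace_lborel[OF S])
  interpret hS: pair_sigma_finite ?h "subspace_lborel S" ..
  interpret hl: pair_sigma_finite ?h lborel ..
  have m1: "fst \<in> borel_measurable (?h \<Otimes>\<^sub>M N)" for N :: "(real^'n) measure"
    by (rule measurable_compose[OF measurable_fst measurable_orthogonal_haar_borel_id])
  note m1[measurable] measurable_orthogonal_haar_borel_id[measurable]
  define e :: "real^'n" where "e = axis undefined 1"
  have e: "norm e = 1" by (simp add: e_def norm_axis_1)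
  define a where "a r = (\<integral>\<^sup>+\<gamma>. F (\<gamma> *v (r *\<^sub>R e)) \<partial>?h)" for r :: real
  have [measurable]: "a \<in> borel_measurable borel"
  proof -
    have [measurable]: "snd \<in> borel_measurable ((borel :: real measure) \<Otimes>\<^sub>M ?h)"
      by (rule measurable_compose[OF measurable_snd measurable_orthogonal_haar_borel_id])
    have "(\<lambda>(r, \<gamma>). F (\<gamma> *v (r *\<^sub>R e))) \<in> borel_measurable ((borel :: real measure) \<Otimes>\<^sub>M ?h)"
      by (simp add: case_prod_beta')
    then show ?thesis unfolding a_def by (rule h.borel_measurable_nn_integral)
  qed
  have a: "(\<integral>\<^sup>+\<gamma>. F (\<gamma> *v z) \<partial>?h) = a (norm z)" for z
    unfolding a_def by (rule nn_integral_haar_orbit) (auto simp: e)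
  have "(\<integral>\<^sup>+\<gamma>. (\<integral>\<^sup>+z. F (\<gamma> *v z) \<partial>subspace_lborel S) \<partial>?h) = (\<integral>\<^sup>+z. (\<integral>\<^sup>+\<gamma>. F (\<gamma> *v z) \<partial>?h) \<partial>subspace_lborel S)"
    by (rule hS.Fubini'[symmetric]) (simp add: case_prod_beta')
  also have "\<dots> = (\<integral>\<^sup>+y. ?K y * a (norm y) \<partial>lborel)"
    unfolding a by (rule nn_integral_subspace_lborel_radial_riesz[OF S d]) measurable
  also have "\<dots> = (\<integral>\<^sup>+y. (\<integral>\<^sup>+\<gamma>. ?K y * F (\<gamma> *v y) \<partial>?h) \<partial>lborel)"
    unfolding a[symmetric] by (intro nn_integral_cong nn_integral_cmult[symmetric]) measurable
  also have "\<dots> = (\<integral>\<^sup>+\<gamma>. (\<integral>\<^sup>+y. ?K y * F (\<gamma> *v y) \<partial>lborel) \<partial>?h)"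
    by (rule hl.Fubini') (simp add: case_prod_beta')
  also have "\<dots> = (\<integral>\<^sup>+\<gamma>. (\<integral>\<^sup>+y. ?K y * F y \<partial>lborel) \<partial>?h)"
  proof (rule nn_integral_cong)
    fix \<gamma> assume "\<gamma> \<in> space ?h"
    then have o: "orthogonal_transformation ((*v) \<gamma>)" by (simp add: orthogonal_matrix_imp_transformation)
    have "(\<integral>\<^sup>+y. ?K y * F (\<gamma> *v y) \<partial>lborel) = (\<integral>\<^sup>+y. ?K (\<gamma> *v y) * F (\<gamma> *v y) \<partial>lborel)"
      using orthogonal_transformation_norm[OF o] by (simp add: riesz_kernel_def)
    also have "\<dots> = (\<integral>\<^sup>+y. ?K y * F y \<partial>distr lborel borel ((*v) \<gamma>))"
      by (subst nn_integral_distr) auto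
    also have "\<dots> = (\<integral>\<^sup>+y. ?K y * F y \<partial>lborel)"
      by (simp only: distr_lborel_orthogonal_transformation[OF o])
    finally show "(\<integral>\<^sup>+y. ?K y * F (\<gamma> *v y) \<partial>lborel) = (\<integral>\<^sup>+y. ?K y * F y \<partial>lborel)" .
  qed
  also have "\<dots> = (\<integral>\<^sup>+y. ?K y * F y \<partial>lborel)" by (simp add: h.emeasure_space_1[simplified])
  finally show ?thesis .
qed

text \<open>The nonnegative identity determines the image of Haar measure times Lebesgue measure on
  \<open>S\<close> under the action. Complex integrals are transported through this image measure,
  with \<open>fin\<close> giving integrability on the product.\<close>

lemma integral_haar_subspace:
  fixes S :: "(real^'n) set" and g :: "real^'n \<Rightarrow> complex"
  assumes S: "subspace S" and d: "dim S > 0" and g [measurable]: "g \<in> borel_measurable borel"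
    and fin: "(\<integral>\<^sup>+y. ennreal (averaging_constant CARD('n) (dim S) * riesz_kernel (real (dim S)) y) * norm (g y) \<partial>lborel) < \<infinity>"
  shows "(\<integral>\<gamma>. (\<integral>z. g (\<gamma> *v z) \<partial>subspace_lborel S) \<partial>orthogonal_haar_borel) =
    (\<integral>y. (averaging_constant CARD('n) (dim S) * riesz_kernel (real (dim S)) y) *\<^sub>R g y \<partial>lborel)"
proof -
  let ?h = "orthogonal_haar_borel :: (real^'n^'n) measure" and ?L = "subspace_lborel S"
  let ?k = "\<lambda>y :: real^'n. averaging_constant CARD('n) (dim S) * riesz_kernel (real (dim S)) y"
  interpret h: prob_space ?h by (rule prob_space_orthogonal_haar_borel)
  interpret S: sigma_finite_measure ?L by (rule sigma_finite_subspace_lborel[OF S])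
  interpret hS: pair_sigma_finite ?h ?L ..
  have m1: "fst \<in> borel_measurable (?h \<Otimes>\<^sub>M ?L)"
    by (rule measurable_compose[OF measurable_fst measurable_orthogonal_haar_borel_id])
  note m1[measurable]
  let ?\<Psi> = "\<lambda>p :: (real^'n^'n) \<times> (real^'n). fst p *v snd p"
  have [measurable]: "?\<Psi> \<in> borel_measurable (?h \<Otimes>\<^sub>M ?L)" by measurable
  have nn: "(\<integral>\<^sup>+p. F (?\<Psi> p) \<partial>(?h \<Otimes>\<^sub>M ?L)) = (\<integral>\<^sup>+y. ennreal (?k y) * F y \<partial>lborel)"
    if [measurable]: "F \<in> borel_measurable borel" for F
    by (subst S.nn_integral_fst[symmetric])
       (simp_all add: nn_integral_haar_subspace[OF S d])
  have D: "distr (?h \<Otimes>\<^sub>M ?L) borel ?\<Psi> = density lborel (\<lambda>y. ennreal (?k y))"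
  proof (rule measure_eqI)
    fix A assume "A \<in> sets (distr (?h \<Otimes>\<^sub>M ?L) borel ?\<Psi>)"
    then have [measurable]: "A \<in> sets borel" by simp
    have "emeasure (distr (?h \<Otimes>\<^sub>M ?L) borel ?\<Psi>) A = (\<integral>\<^sup>+p. indicator A (?\<Psi> p) \<partial>(?h \<Otimes>\<^sub>M ?L))"
      by (subst nn_integral_indicator[symmetric], simp, subst nn_integral_distr) auto
    also have "\<dots> = emeasure (density lborel (\<lambda>y. ennreal (?k y))) A"
      by (subst nn) (auto simp: emeasure_density)
    finally show "emeasure (distr (?h \<Otimes>\<^sub>M ?L) borel ?\<Psi>) A = emeasure (density lborel (\<lambda>y. ennreal (?k y))) A" .
  qed simp
  have int: "integrable (?h \<Otimes>\<^sub>M ?L) (\<lambda>p. g (?\<Psi> p))"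
    using fin nn[of "\<lambda>y. ennreal (norm (g y))"] by (intro integrableI_bounded) auto
  have "(\<integral>\<gamma>. (\<integral>z. g (\<gamma> *v z) \<partial>?L) \<partial>?h) = (\<integral>p. g (?\<Psi> p) \<partial>(?h \<Otimes>\<^sub>M ?L))"
    using hS.integral_fst'[OF int] by simp
  also have "\<dots> = (\<integral>y. g y \<partial>density lborel (\<lambda>y. ennreal (?k y)))"
    unfolding D[symmetric] by (rule integral_distr[symmetric]) auto
  also have "\<dots> = (\<integral>y. ?k y *\<^sub>R g y \<partial>lborel)"
    by (rule integral_density) (auto simp: averaging_constant_nonneg riesz_kernel_nonneg)
  finally show ?thesis .
qed

section \<open>Integration over affine planes\<close>

text \<open>The transforms agree with explicit Borel integrals only almost everywhere; in a
  completion such agreement already makes \<open>f\<close> measurable.\<close>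

lemma integral_completion_AE:
  fixes f :: "'a \<Rightarrow> 'b::{banach, second_countable_topology}"
  assumes f0: "f0 \<in> borel_measurable M" and ae: "AE x in M. f x = f0 x"
  shows "integral\<^sup>L (completion M) f = integral\<^sup>L M f0"
proof -
  have ae': "AE x in completion M. f x = f0 x" using ae by (rule AE_completion)
  have f0': "f0 \<in> borel_measurable (completion M)" using f0 by (rule measurable_completion)
  have "f \<in> borel_measurable (completion M)"
  proof (rule borel_measurableI)
    fix U :: "'b set" assume "open U"
    have "AE x in completion M. x \<in> f0 -` U \<inter> space (completion M) \<longleftrightarrow> x \<in> f -` U \<inter> space (completion M)"
      using ae' by eventually_elim auto
    then show "f -` U \<inter> space (completion M) \<in> sets (completion M)"
      by (rule completion.in_sets_AE[OF _ measurable_sets[OF f0' borel_open[OF \<open>open U\<close>]]]) simp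
  qed
  then have "integral\<^sup>L (completion M) f = integral\<^sup>L (completion M) f0"
    using f0' ae' by (intro integral_cong_AE)
  then show ?thesis using f0 by (simp add: integral_completion)
qed

text \<open>Differences of its points recover the direction of a plane. Subtracting from the base
  point its projection moves it within the plane to the one point orthogonal to the direction, which
  is the offset.\<close>

lemma direction_translation:
  fixes S :: "(real^'n) set"
  assumes S: "subspace S"
  shows "direction ((\<lambda>y. y + a) ` S) = S"
    and "offset ((\<lambda>y. y + a) ` S) = a - closest_point S a"
proof -
  let ?p = "closest_point S a"
  have p: "?p \<in> S" by (rule closest_point_subspace[OF S])
  have eq: "(\<lambda>y. y + a) ` S = (\<lambda>y. y + (a - ?p)) ` S"
  proof
    show "(\<lambda>y. y + a) ` S \<subseteq> (\<lambda>y. y + (a - ?p)) ` S"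
    proof (rule image_subsetI)
      fix y assume "y \<in> S"
      then show "y + a \<in> (\<lambda>y. y + (a - ?p)) ` S"
        using p by (intro image_eqI[of _ _ "y + ?p"] subspace_add S) auto
    qed
    show "(\<lambda>y. y + (a - ?p)) ` S \<subseteq> (\<lambda>y. y + a) ` S"
    proof (rule image_subsetI)
      fix y assume "y \<in> S"
      then show "y + (a - ?p) \<in> (\<lambda>y. y + a) ` S"
        using p by (intro image_eqI[of _ _ "y - ?p"] subspace_diff S) auto
    qed
  qed
  have o: "a - closest_point S a \<in> S\<^sup>\<bottom>" by (rule closest_point_subspace[OF S])
  have T: "T = S" if T: "subspace T" and e: "(\<lambda>y. y + a) ` S = (\<lambda>y. y + v) ` T" for T v
  proof -
    have diff: "{p - q |p q. p \<in> (\<lambda>y. y + w) ` R \<and> q \<in> (\<lambda>y. y + w) ` R} = R"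
      if R: "subspace R" for R :: "(real^'n) set" and w
    proof
      show "{p - q |p q. p \<in> (\<lambda>y. y + w) ` R \<and> q \<in> (\<lambda>y. y + w) ` R} \<subseteq> R"
        using R by (auto intro: subspace_diff)
      show "R \<subseteq> {p - q |p q. p \<in> (\<lambda>y. y + w) ` R \<and> q \<in> (\<lambda>y. y + w) ` R}"
      proof
        fix r assume "r \<in> R"
        then have "r = (r + w) - (0 + w)" "r + w \<in> (\<lambda>y. y + w) ` R" "0 + w \<in> (\<lambda>y. y + w) ` R"
          using subspace_0[OF R] by auto
        then show "r \<in> {p - q |p q. p \<in> (\<lambda>y. y + w) ` R \<and> q \<in> (\<lambda>y. y + w) ` R}" by blast
      qed
    qed
    show ?thesis using diff[OF S, of a] diff[OF T, of v] e by simp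
  qed
  show d: "direction ((\<lambda>y. y + a) ` S) = S"
    unfolding direction_def
    by (rule the_equality) (use S o eq T in blast)+
  show "offset ((\<lambda>y. y + a) ` S) = a - closest_point S a"
    unfolding offset_def d
  proof (rule the_equality)
    show "a - closest_point S a \<in> S\<^sup>\<bottom> \<and> (\<lambda>y. y + a) ` S = (\<lambda>y. y + (a - closest_point S a)) ` S"
      using o eq by blast
    fix v assume v: "v \<in> S\<^sup>\<bottom> \<and> (\<lambda>y. y + a) ` S = (\<lambda>y. y + v) ` S"
    then have "0 + a \<in> (\<lambda>y. y + v) ` S" using subspace_0[OF S] by (metis image_eqI)
    then have "a - v \<in> S" by auto
    then have "closest_point S a = a - v" using v by (intro closest_point_subspace_unique[OF S]) auto
    then show "v = a - closest_point S a" by simp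
  qed
qed

lemma translation_in_affine_planes:
  fixes S :: "(real^'n) set"
  assumes "subspace S" "dim S = d"
  shows "(\<lambda>y. y + a) ` S \<in> affine_planes d"
proof -
  have eq: "(\<lambda>y. y + a) ` S = (+) a ` S" by (simp add: add.commute)
  show ?thesis
    unfolding affine_planes_def eq mem_Collect_eq
    using assms by (simp add: affine_translation[symmetric] subspace_imp_affine aff_dim_translation_eq aff_dim_subspace)
qed

lemma AE_subspace_lborel_translation:
  assumes S: "subspace S" and "a - b \<in> S" and [measurable]: "N \<in> sets borel"
    and ae: "AE z in subspace_lborel S. z + a \<notin> N"
  shows "AE z in subspace_lborel S. z + b \<notin> N"
proof -
  have "AE z in distr (subspace_lborel S) borel ((+) (a - b)). z + b \<notin> N"
    using ae by (subst AE_distr_iff) (auto simp: algebra_simps)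
  then show ?thesis by (simp only: distr_subspace_lborel_translation[OF S assms(2)])
qed

lemma integral_subspace_lborel_translation:
  fixes g :: "real^'n \<Rightarrow> 'b::{banach, second_countable_topology}"
  assumes S: "subspace S" and "a - b \<in> S" and [measurable]: "g \<in> borel_measurable borel"
  shows "(\<integral>z. g (z + a) \<partial>subspace_lborel S) = (\<integral>z. g (z + b) \<partial>subspace_lborel S)"
proof -
  have "(\<integral>z. g (z + b) \<partial>distr (subspace_lborel S) borel ((+) (a - b))) = (\<integral>z. g (z + a) \<partial>subspace_lborel S)"
    by (subst integral_distr) (auto simp: algebra_simps)
  then show ?thesis by (simp only: distr_subspace_lborel_translation[OF S assms(2)])
qed

text \<open>Sheds the encoding of \<open>plane_measure\<close>: the restricted Borel space, the
  completion, and the offset as base point, which translation invariance exchanges for an arbitrary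
  point \<open>a\<close> of the plane. The set \<open>N\<close> is where \<open>h\<close> may differ
  from its Borel version.\<close>

lemma integral_plane_measure:
  fixes S :: "(real^'n) set" and h h0 :: "real^'n \<Rightarrow> complex"
  assumes S: "subspace S" and N [measurable]: "N \<in> sets borel" and h0 [measurable]: "h0 \<in> borel_measurable borel"
    and h: "\<And>y. y \<notin> N \<Longrightarrow> h y = h0 y" and ae: "AE z in subspace_lborel S. z + a \<notin> N"
  shows "(\<integral>y. h y \<partial>plane_measure ((\<lambda>y. y + a) ` S)) = (\<integral>z. h0 (z + a) \<partial>subspace_lborel S)"
proof -
  define B where "B = (SOME B. orthonormal_basis_of B S)"
  have B: "orthonormal_basis_of B S"
    unfolding B_def by (rule someI_ex, rule orthonormal_basis_of_exists[OF S])
  have L: "subspace_lborel S = distr (Pi\<^sub>M B (\<lambda>_. lborel)) borel (\<lambda>c. \<Sum>b\<in>B. c b *\<^sub>R b)"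
    by (simp add: subspace_lborel_def basis_lborel_def B_def)
  let ?\<zeta> = "(\<lambda>y. y + a) ` S" and ?v = "a - closest_point S a"
  let ?P = "Pi\<^sub>M B (\<lambda>_. lborel :: real measure)" and ?R = "restrict_space borel ?\<zeta> :: (real^'n) measure"
  let ?s = "\<lambda>c. \<Sum>b\<in>B. c b *\<^sub>R b"
  let ?\<phi> = "\<lambda>c. ?s c + ?v"
  have [measurable]: "?s \<in> borel_measurable ?P" by measurable
  have pm: "plane_measure ?\<zeta> = completion (distr ?P ?R ?\<phi>)"
    by (simp add: plane_measure_def direction_translation[OF S] B_def[symmetric])
  have av: "a - ?v \<in> S" using closest_point_subspace[OF S, of a] by simp
  have in\<zeta>: "?\<phi> c \<in> ?\<zeta>" for c
  proof -
    have "?s c \<in> span B" by (intro span_sum span_scale span_base)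
    then have "?s c \<in> S" using B by (simp add: orthonormal_basis_of_def)
    then have "?s c - closest_point S a \<in> S" using closest_point_subspace[OF S] S by (auto intro: subspace_diff)
    then show ?thesis by (intro image_eqI[of _ _ "?s c - closest_point S a"]) auto
  qed
  have \<phi>: "?\<phi> \<in> measurable ?P ?R"
    by (rule measurable_restrict_space2) (auto simp: in\<zeta>)
  have id: "(\<lambda>x. x) \<in> measurable ?R borel" by (rule measurable_restrict_space1) simp
  have h0R: "h0 \<in> borel_measurable ?R" using measurable_compose[OF id h0] by simp
  have "AE z in subspace_lborel S. z + ?v \<notin> N" by (rule AE_subspace_lborel_translation[OF S av N ae])
  then have "AE c in ?P. ?\<phi> c \<notin> N" unfolding L by (subst (asm) AE_distr_iff) auto
  moreover have "{y \<in> space ?R. y \<notin> N} \<in> sets ?R"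
  proof -
    have "(\<lambda>x. x) -` (- N) \<inter> space ?R \<in> sets ?R" by (rule measurable_sets[OF id]) auto
    also have "(\<lambda>x. x) -` (- N) \<inter> space ?R = {y \<in> space ?R. y \<notin> N}" by auto
    finally show ?thesis .
  qed
  ultimately have "AE y in distr ?P ?R ?\<phi>. y \<notin> N" by (subst AE_distr_iff[OF \<phi>]) auto
  then have "AE y in distr ?P ?R ?\<phi>. h y = h0 y" by eventually_elim (rule h)
  then have "(\<integral>y. h y \<partial>plane_measure ?\<zeta>) = (\<integral>y. h0 y \<partial>distr ?P ?R ?\<phi>)"
    unfolding pm using h0R by (intro integral_completion_AE) auto
  also have "\<dots> = (\<integral>c. h0 (?s c + ?v) \<partial>?P)" by (rule integral_distr[OF \<phi> h0R])
  also have "\<dots> = (\<integral>z. h0 (z + ?v) \<partial>subspace_lborel S)"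
    unfolding L by (rule integral_distr[symmetric]) auto
  also have "\<dots> = (\<integral>z. h0 (z + a) \<partial>subspace_lborel S)"
    by (rule integral_subspace_lborel_translation[OF S av h0, symmetric])
  finally show ?thesis .
qed

section \<open>Measurable dependence on the subspace\<close>

text \<open>The cylinder formula makes the measure on \<open>Z \<omega>\<close> the image of a
  weighted Lebesgue measure under the projection matrix. The parameter enters through this matrix
  alone, so measurability of parametrized integrals applies; the constant dimension keeps the
  normalization fixed.\<close>

lemma measurable_subspace_lborel_integrals:
  fixes Z :: "'a \<Rightarrow> (real^'n) set" and F :: "real^'n \<Rightarrow> ennreal"
    and g :: "real^'n \<Rightarrow> 'b::{banach, second_countable_topology}"
  assumes Z: "\<And>\<omega>. \<omega> \<in> space M \<Longrightarrow> subspace (Z \<omega>)" "\<And>\<omega>. \<omega> \<in> space M \<Longrightarrow> dim (Z \<omega>) = d"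
    and P [measurable]: "(\<lambda>\<omega>. matrix (closest_point (Z \<omega>))) \<in> borel_measurable M"
  shows "F \<in> borel_measurable borel \<Longrightarrow> (\<lambda>\<omega>. \<integral>\<^sup>+z. F z \<partial>subspace_lborel (Z \<omega>)) \<in> borel_measurable M"
    and "g \<in> borel_measurable borel \<Longrightarrow> (\<lambda>\<omega>. \<integral>z. g z \<partial>subspace_lborel (Z \<omega>)) \<in> borel_measurable M"
proof -
  let ?w = "unit_ball_vol (real (CARD('n) - d))" and ?P = "\<lambda>\<omega>. matrix (closest_point (Z \<omega>))"
  have w: "?w > 0" by simp
  \<comment> \<open>Density of the unit cylinder about the subspace with projection matrix
    \<open>P\<close>, normalized by the volume of its cross-section.\<close>
  define q where "q P z = indicator (cball 0 1) (z - P *v z) / ?w" for P :: "real^'n^'n" and z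
  have q0: "q P z \<ge> 0" for P z using w by (simp add: q_def)
  have [measurable]: "(cball 0 1 :: (real^'n) set) \<in> sets borel" by simp
  have q [measurable]: "(\<lambda>p. q (f p) (g p)) \<in> borel_measurable N"
    if [measurable]: "f \<in> borel_measurable N" "g \<in> borel_measurable N" for N :: "'c measure" and f g
    unfolding q_def by measurable
  have nn: "(\<integral>\<^sup>+z. G z \<partial>subspace_lborel (Z \<omega>)) = (\<integral>\<^sup>+z. ennreal (q (?P \<omega>) z) * G (?P \<omega> *v z) \<partial>lborel)"
    if \<omega>: "\<omega> \<in> space M" and [measurable]: "G \<in> borel_measurable borel" for \<omega> G
  proof -
    have qe: "ennreal (q (?P \<omega>) z) * G (?P \<omega> *v z)
        = ennreal (1 / ?w) * (G (closest_point (Z \<omega>) z) * indicator (cball 0 1) (z - closest_point (Z \<omega>) z))" for z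
      by (auto simp: q_def matrix_closest_point[OF Z(1)[OF \<omega>]] mult.commute split: split_indicator)
    have [measurable]: "closest_point (Z \<omega>) \<in> borel_measurable borel"
      using linear_closest_point[OF Z(1)[OF \<omega>]]
      by (intro borel_measurable_continuous_onI linear_continuous_on) (simp add: linear_conv_bounded_linear)
    have "(\<integral>\<^sup>+z. ennreal (q (?P \<omega>) z) * G (?P \<omega> *v z) \<partial>lborel)
        = ennreal (1 / ?w) * (\<integral>\<^sup>+z. G (closest_point (Z \<omega>) z) * indicator (cball 0 1) (z - closest_point (Z \<omega>) z) \<partial>lborel)"
      unfolding qe by (rule nn_integral_cmult) measurable
    also have "\<dots> = ennreal (1 / ?w) * (ennreal ?w * (\<integral>\<^sup>+z. G z \<partial>subspace_lborel (Z \<omega>)))"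
      by (subst nn_integral_subspace_lborel_eq_lborel) (auto simp: Z \<omega>)
    also have "\<dots> = (\<integral>\<^sup>+z. G z \<partial>subspace_lborel (Z \<omega>))"
      using w by (simp add: mult.assoc[symmetric] ennreal_mult[symmetric] del: unit_ball_vol_pos)
    finally show ?thesis by simp
  qed
  have fs [measurable]: "(\<lambda>p. ?P (fst p)) \<in> borel_measurable (M \<Otimes>\<^sub>M (lborel :: (real^'n) measure))"
    by (rule measurable_compose[OF measurable_fst P])
  show "(\<lambda>\<omega>. \<integral>\<^sup>+z. F z \<partial>subspace_lborel (Z \<omega>)) \<in> borel_measurable M"
    if [measurable]: "F \<in> borel_measurable borel"
  proof -
    have "(\<lambda>(\<omega>, z). ennreal (q (?P \<omega>) z) * F (?P \<omega> *v z)) \<in> borel_measurable (M \<Otimes>\<^sub>M (lborel :: (real^'n) measure))"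
      by (simp add: case_prod_beta')
    then have "(\<lambda>\<omega>. \<integral>\<^sup>+z. ennreal (q (?P \<omega>) z) * F (?P \<omega> *v z) \<partial>lborel) \<in> borel_measurable M"
      by (rule lborel.borel_measurable_nn_integral)
    then show ?thesis by (rule measurable_cong[THEN iffD1, rotated]) (simp add: nn)
  qed
  show "(\<lambda>\<omega>. \<integral>z. g z \<partial>subspace_lborel (Z \<omega>)) \<in> borel_measurable M"
    if [measurable]: "g \<in> borel_measurable borel"
  proof -
    have D: "subspace_lborel (Z \<omega>) = distr (density lborel (\<lambda>z. ennreal (q (?P \<omega>) z))) borel ((*v) (?P \<omega>))"
      if \<omega>: "\<omega> \<in> space M" for \<omega>
    proof (rule measure_eqI)
      fix A assume "A \<in> sets (subspace_lborel (Z \<omega>))"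
      then have [measurable]: "A \<in> sets borel" by simp
      have "emeasure (subspace_lborel (Z \<omega>)) A = (\<integral>\<^sup>+z. indicator A z \<partial>subspace_lborel (Z \<omega>))" by simp
      also have "\<dots> = (\<integral>\<^sup>+z. ennreal (q (?P \<omega>) z) * indicator A (?P \<omega> *v z) \<partial>lborel)"
        by (rule nn[OF \<omega>]) measurable
      also have "\<dots> = (\<integral>\<^sup>+z. indicator A (?P \<omega> *v z) \<partial>density lborel (\<lambda>z. ennreal (q (?P \<omega>) z)))"
        by (rule nn_integral_density[symmetric]) measurable
      also have "\<dots> = (\<integral>\<^sup>+z. indicator A z \<partial>distr (density lborel (\<lambda>z. ennreal (q (?P \<omega>) z))) borel ((*v) (?P \<omega>)))"
        by (rule nn_integral_distr[symmetric]) auto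
      finally show "emeasure (subspace_lborel (Z \<omega>)) A
          = emeasure (distr (density lborel (\<lambda>z. ennreal (q (?P \<omega>) z))) borel ((*v) (?P \<omega>))) A" by simp
    qed simp
    have i: "(\<integral>z. g z \<partial>subspace_lborel (Z \<omega>)) = (\<integral>z. q (?P \<omega>) z *\<^sub>R g (?P \<omega> *v z) \<partial>lborel)"
      if \<omega>: "\<omega> \<in> space M" for \<omega>
    proof -
      have "(\<integral>z. g z \<partial>subspace_lborel (Z \<omega>)) = (\<integral>z. g (?P \<omega> *v z) \<partial>density lborel (\<lambda>z. ennreal (q (?P \<omega>) z)))"
        unfolding D[OF \<omega>] by (rule integral_distr) auto
      also have "\<dots> = (\<integral>z. q (?P \<omega>) z *\<^sub>R g (?P \<omega> *v z) \<partial>lborel)"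
        by (rule integral_density) (auto simp: q0)
      finally show ?thesis .
    qed
    have "(\<lambda>(\<omega>, z). q (?P \<omega>) z *\<^sub>R g (?P \<omega> *v z)) \<in> borel_measurable (M \<Otimes>\<^sub>M (lborel :: (real^'n) measure))"
      by (simp add: case_prod_beta')
    then have "(\<lambda>\<omega>. \<integral>z. q (?P \<omega>) z *\<^sub>R g (?P \<omega> *v z) \<partial>lborel) \<in> borel_measurable M"
      by (rule lborel.borel_measurable_lebesgue_integral)
    then show ?thesis by (rule measurable_cong[THEN iffD1, rotated]) (simp add: i)
  qed
qed

text \<open>The push-forward form of the iterated integral transports null sets and complex
  integrals as well.\<close>

lemma distr_subspace_lborel_add:
  assumes S: "subspace S" and T: "subspace T" and ST: "T \<subseteq> S\<^sup>\<bottom>"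
  shows "distr (subspace_lborel S \<Otimes>\<^sub>M subspace_lborel T) borel (\<lambda>p. fst p + snd p) = subspace_lborel (S + T)"
    (is "?M = _")
proof (rule measure_eqI)
  interpret T: sigma_finite_measure "subspace_lborel T" by (rule sigma_finite_subspace_lborel[OF T])
  fix A assume "A \<in> sets ?M"
  then have [measurable]: "A \<in> sets borel" by simp
  have "emeasure ?M A = (\<integral>\<^sup>+p. indicator A (fst p + snd p) \<partial>(subspace_lborel S \<Otimes>\<^sub>M subspace_lborel T))"
    by (subst nn_integral_indicator[symmetric], simp, subst nn_integral_distr) auto
  also have "\<dots> = (\<integral>\<^sup>+x. (\<integral>\<^sup>+y. indicator A (x + y) \<partial>subspace_lborel T) \<partial>subspace_lborel S)"
    by (subst T.nn_integral_fst[symmetric]) auto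
  also have "\<dots> = emeasure (subspace_lborel (S + T)) A"
    by (subst nn_integral_subspace_lborel_set_plus[OF S T ST, symmetric]) auto
  finally show "emeasure ?M A = emeasure (subspace_lborel (S + T)) A" .
qed simp

lemma dim_set_plus:
  fixes S T :: "(real^'n) set"
  assumes S: "subspace S" and T: "subspace T" and ST: "T \<subseteq> S\<^sup>\<bottom>"
  shows "dim (S + T) = dim S + dim T"
proof -
  have "S \<inter> T \<subseteq> {0}"
    using ST orthogonal_self by (fastforce simp: orthogonal_comp_def)
  then have "dim (S \<inter> T) = 0" by (simp add: dim_eq_0)
  moreover have "S + T = {x + y |x y. x \<in> S \<and> y \<in> T}" by (auto simp: set_plus_def)
  ultimately show ?thesis using dim_sums_Int[OF S T] by (simp only: add_0_right)
qed

lemma matrix_closest_point_set_plus: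
  fixes S T :: "(real^'n) set"
  assumes S: "subspace S" and T: "subspace T" and ST: "T \<subseteq> S\<^sup>\<bottom>"
  shows "matrix (closest_point (S + T)) = matrix (closest_point S) + matrix (closest_point T)"
  unfolding matrix_eq
  by (simp add: matrix_vector_mult_add_rdistrib matrix_closest_point closest_point_set_plus assms subspace_set_plus)

section \<open>The mixed transform\<close>

text \<open>Fubini on \<eta> times \<xi>. The transform over the plane shifted by \<open>u\<close>
  is controlled only for almost every \<open>u\<close>, and since \<open>\<eta> + \<xi>\<close>
  contains \<open>x - v\<close>, the offset \<open>v\<close> can be traded for the point
  \<open>x\<close>.\<close>

lemma integral_plane_transform:
  fixes h h0 :: "real^'n \<Rightarrow> complex" and \<eta> \<xi> N :: "(real^'n) set"
  assumes \<eta>: "subspace \<eta>" and \<xi>: "\<xi> \<in> grassmannian_in j (\<eta>\<^sup>\<bottom>)" and xv: "x - v \<in> \<eta>"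
    and N [measurable]: "N \<in> sets borel" and h0 [measurable]: "h0 \<in> borel_measurable borel"
    and h: "\<And>y. y \<notin> N \<Longrightarrow> h y = h0 y"
    and ae: "AE z in subspace_lborel (\<eta> + \<xi>). z + x \<notin> N"
    and int: "integrable (subspace_lborel (\<eta> + \<xi>)) (\<lambda>z. h0 (z + x))"
  shows "(\<integral>u. plane_transform j h ((\<lambda>y. y + u + v) ` \<xi>) \<partial>plane_measure \<eta>) = (\<integral>z. h0 (z + x) \<partial>subspace_lborel (\<eta> + \<xi>))"
proof -
  note g = grassmannian_inD[OF \<xi>]
  let ?A = "subspace_lborel \<eta>" and ?B = "subspace_lborel \<xi>" and ?Z = "\<eta> + \<xi>"
  interpret A: sigma_finite_measure ?A by (rule sigma_finite_subspace_lborel[OF \<eta>])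
  interpret B: sigma_finite_measure ?B by (rule sigma_finite_subspace_lborel[OF g(1)])
  interpret pair_sigma_finite ?A ?B ..
  have Z: "subspace ?Z" by (rule subspace_set_plus[OF \<eta> g(1)])
  note D = distr_subspace_lborel_add[OF \<eta> g(1,2)]
  have xvZ: "x - v \<in> ?Z" using set_plus_intro[OF xv subspace_0[OF g(1)]] by simp
  have aev: "AE z in subspace_lborel ?Z. z + v \<notin> N"
    by (rule AE_subspace_lborel_translation[OF Z xvZ N ae])
  have intv: "integrable (subspace_lborel ?Z) (\<lambda>z. h0 (z + v))"
  proof -
    have "integrable (distr (subspace_lborel ?Z) borel ((+) (x - v))) (\<lambda>z. h0 (z + v))"
      using int by (subst integrable_distr_eq) (auto simp: algebra_simps)
    then show ?thesis by (simp only: distr_subspace_lborel_translation[OF Z xvZ])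
  qed
  have "AE p in ?A \<Otimes>\<^sub>M ?B. fst p + snd p + v \<notin> N"
    using aev unfolding D[symmetric] by (subst (asm) AE_distr_iff) auto
  then have ae2: "AE u in ?A. AE y in ?B. y + (u + v) \<notin> N"
    by (auto dest!: AE_pair simp: algebra_simps)
  have int2: "integrable (?A \<Otimes>\<^sub>M ?B) (\<lambda>p. h0 (fst p + snd p + v))"
    using intv unfolding D[symmetric] by (subst (asm) integrable_distr_eq) auto
  \<comment> \<open>The shifts whose plane does not avoid \<open>N\<close> almost everywhere: a
    Borel set, being given by an integral of the indicator of \<open>N\<close>, and null by
    \<open>ae2\<close>.\<close>
  define N' where "N' = {u. \<not> (AE y in ?B. y + (u + v) \<notin> N)}"
  have N': "N' \<in> sets borel"
  proof -
    have "(AE y in ?B. y + (u + v) \<notin> N) \<longleftrightarrow> (\<integral>\<^sup>+y. indicator N (y + (u + v)) \<partial>?B) = 0" for u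
      by (subst nn_integral_0_iff_AE) (auto simp: indicator_def)
    then have "N' = {u \<in> space borel. (\<integral>\<^sup>+y. indicator N (y + (u + v)) \<partial>?B) \<noteq> 0}"
      by (auto simp: N'_def)
    also have "\<dots> \<in> sets borel" by measurable
    finally show ?thesis .
  qed
  let ?G0 = "\<lambda>u. \<integral>y. h0 (y + (u + v)) \<partial>?B"
  have G0: "?G0 \<in> borel_measurable borel" by measurable
  have G: "plane_transform j h ((\<lambda>y. y + u + v) ` \<xi>) = ?G0 u" if "u \<notin> N'" for u
  proof -
    have "(\<lambda>y. y + u + v) ` \<xi> = (\<lambda>y. y + (u + v)) ` \<xi>" by (simp add: add.assoc)
    moreover have "AE y in ?B. y + (u + v) \<notin> N" using that by (simp add: N'_def)
    ultimately show ?thesis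
      using translation_in_affine_planes[OF g(1,3)] integral_plane_measure[OF g(1) N h0 h]
      by (simp add: plane_transform_def)
  qed
  have \<eta>0: "\<eta> = (\<lambda>y. y + 0) ` \<eta>" by simp
  have "(\<integral>u. plane_transform j h ((\<lambda>y. y + u + v) ` \<xi>) \<partial>plane_measure ((\<lambda>y. y + 0) ` \<eta>)) = (\<integral>u. ?G0 (u + 0) \<partial>?A)"
    using ae2 by (intro integral_plane_measure[OF \<eta> N' G0 G]) (simp_all add: N'_def)
  then have "(\<integral>u. plane_transform j h ((\<lambda>y. y + u + v) ` \<xi>) \<partial>plane_measure \<eta>) = (\<integral>u. ?G0 u \<partial>?A)" by simp
  also have "\<dots> = (\<integral>p. h0 (fst p + snd p + v) \<partial>(?A \<Otimes>\<^sub>M ?B))"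
    using integral_fst'[OF int2] by (simp add: algebra_simps)
  also have "\<dots> = (\<integral>z. h0 (z + v) \<partial>subspace_lborel ?Z)"
    unfolding D[symmetric] by (rule integral_distr[symmetric]) auto
  also have "\<dots> = (\<integral>z. h0 (z + x) \<partial>subspace_lborel ?Z)"
    by (rule integral_subspace_lborel_translation[OF Z xvZ h0, symmetric])
  finally show ?thesis .
qed

lemma measurable_grassmannian_integrals:
  fixes \<eta> :: "(real^'n) set" and F :: "real^'n \<Rightarrow> ennreal" and g :: "real^'n \<Rightarrow> complex"
  assumes \<eta>: "subspace \<eta>"
  shows "F \<in> borel_measurable borel \<Longrightarrow>
      (\<lambda>\<xi>. \<integral>\<^sup>+z. F z \<partial>subspace_lborel (\<eta> + \<xi>)) \<in> borel_measurable (grassmannian_borel j (\<eta>\<^sup>\<bottom>))"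
    and "g \<in> borel_measurable borel \<Longrightarrow>
      (\<lambda>\<xi>. \<integral>z. g z \<partial>subspace_lborel (\<eta> + \<xi>)) \<in> borel_measurable (grassmannian_borel j (\<eta>\<^sup>\<bottom>))"
proof -
  let ?M = "grassmannian_borel j (\<eta>\<^sup>\<bottom>)"
  note measurable_projection_matrix[measurable]
  have "(\<lambda>\<xi>. matrix (closest_point \<eta>) + matrix (closest_point \<xi>)) \<in> borel_measurable ?M" by measurable
  then have P: "(\<lambda>\<xi>. matrix (closest_point (\<eta> + \<xi>))) \<in> borel_measurable ?M"
    by (rule measurable_cong[THEN iffD1, rotated])
       (simp add: matrix_closest_point_set_plus[OF \<eta>] grassmannian_inD)
  have Z: "subspace (\<eta> + \<xi>)" "dim (\<eta> + \<xi>) = dim \<eta> + j" if "\<xi> \<in> space ?M" for \<xi>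
    using that grassmannian_inD[of \<xi>] by (simp_all add: subspace_set_plus dim_set_plus \<eta>)
  show "F \<in> borel_measurable borel \<Longrightarrow> (\<lambda>\<xi>. \<integral>\<^sup>+z. F z \<partial>subspace_lborel (\<eta> + \<xi>)) \<in> borel_measurable ?M"
    "g \<in> borel_measurable borel \<Longrightarrow> (\<lambda>\<xi>. \<integral>z. g z \<partial>subspace_lborel (\<eta> + \<xi>)) \<in> borel_measurable ?M"
    using measurable_subspace_lborel_integrals[where M = ?M and Z = "\<lambda>\<xi>. \<eta> + \<xi>", OF Z P] by blast+
qed

text \<open>Letting \<open>F\<close> be \<infinity> on \<open>N\<close> packs two requirements into
  one: a finite integral of \<open>F\<close> says both that \<open>\<eta> + \<xi>\<close>, shifted
  by \<open>x\<close>, meets \<open>N\<close> in a null set and that \<open>h0\<close> is integrable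
  over it.\<close>

lemma mixed_radon_transform_plane_transform:
  fixes h h0 :: "real^'n \<Rightarrow> complex" and \<eta> N :: "(real^'n) set"
  defines "F \<equiv> \<lambda>y. if y \<in> N then \<infinity> else ennreal (norm (h0 y))"
  assumes \<eta>: "subspace \<eta>" "dim \<eta> = k" and j: "j \<le> dim (\<eta>\<^sup>\<bottom>)"
    and N [measurable]: "N \<in> sets borel" and h0 [measurable]: "h0 \<in> borel_measurable borel"
    and h: "\<And>y. y \<notin> N \<Longrightarrow> h y = h0 y"
    and fin: "AE \<xi> in grassmannian_measure_borel j (\<eta>\<^sup>\<bottom>). (\<integral>\<^sup>+z. F (z + x) \<partial>subspace_lborel (\<eta> + \<xi>)) \<noteq> \<infinity>"
  shows "mixed_radon_transform j k (plane_transform j h) ((\<lambda>y. y + x) ` \<eta>) =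
    (\<integral>\<xi>. (\<integral>z. h0 (z + x) \<partial>subspace_lborel (\<eta> + \<xi>)) \<partial>grassmannian_measure_borel j (\<eta>\<^sup>\<bottom>))"
proof -
  let ?\<mu> = "grassmannian_measure_borel j (\<eta>\<^sup>\<bottom>)" and ?v = "x - closest_point \<eta> x"
  have [measurable]: "F \<in> borel_measurable borel" unfolding F_def by measurable
  have s: "sets ?\<mu> = sets (grassmannian_borel j (\<eta>\<^sup>\<bottom>))"
    using grassmannian_invariant_measure_borel[OF subspace_orthogonal_comp j]
    by (simp add: grassmannian_invariant_def)
  have sp: "space ?\<mu> = grassmannian_in j (\<eta>\<^sup>\<bottom>)" using sets_eq_imp_space_eq[OF s] by simp
  have xv: "x - ?v \<in> \<eta>" using closest_point_subspace[OF \<eta>(1), of x] by simp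
  have eq: "(\<integral>u. plane_transform j h ((\<lambda>y. y + u + ?v) ` \<xi>) \<partial>plane_measure \<eta>) = (\<integral>z. h0 (z + x) \<partial>subspace_lborel (\<eta> + \<xi>))"
    if \<xi>: "\<xi> \<in> grassmannian_in j (\<eta>\<^sup>\<bottom>)" and f: "(\<integral>\<^sup>+z. F (z + x) \<partial>subspace_lborel (\<eta> + \<xi>)) \<noteq> \<infinity>" for \<xi>
  proof (rule integral_plane_transform[OF \<eta>(1) \<xi> xv N h0 h])
    have "AE z in subspace_lborel (\<eta> + \<xi>). F (z + x) \<noteq> \<infinity>"
      using f by (intro nn_integral_PInf_AE) auto
    then show "AE z in subspace_lborel (\<eta> + \<xi>). z + x \<notin> N"
      by eventually_elim (auto simp: F_def split: if_splits)
    have "(\<integral>\<^sup>+z. ennreal (norm (h0 (z + x))) \<partial>subspace_lborel (\<eta> + \<xi>)) \<le> (\<integral>\<^sup>+z. F (z + x) \<partial>subspace_lborel (\<eta> + \<xi>))"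
      by (intro nn_integral_mono) (auto simp: F_def)
    then show "integrable (subspace_lborel (\<eta> + \<xi>)) (\<lambda>z. h0 (z + x))"
      using f by (intro integrableI_bounded) (auto simp: less_top[symmetric] top_unique)
  qed
  have ae: "AE \<xi> in ?\<mu>. (\<integral>u. plane_transform j h ((\<lambda>y. y + u + ?v) ` \<xi>) \<partial>plane_measure \<eta>)
      = (\<integral>z. h0 (z + x) \<partial>subspace_lborel (\<eta> + \<xi>))"
    using fin AE_space by eventually_elim (auto simp: sp intro: eq)
  have m: "(\<lambda>\<xi>. \<integral>z. h0 (z + x) \<partial>subspace_lborel (\<eta> + \<xi>)) \<in> borel_measurable ?\<mu>"
    unfolding measurable_cong_sets[OF s refl]
    by (rule measurable_grassmannian_integrals(2)[OF \<eta>(1)]) measurable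
  have "mixed_radon_transform j k (plane_transform j h) ((\<lambda>y. y + x) ` \<eta>)
    = (\<integral>\<xi>. (\<integral>u. plane_transform j h ((\<lambda>y. y + u + ?v) ` \<xi>) \<partial>plane_measure \<eta>) \<partial>grassmannian_measure j (\<eta>\<^sup>\<bottom>))"
    using translation_in_affine_planes[OF \<eta>]
    by (simp add: mixed_radon_transform_def direction_translation[OF \<eta>(1)])
  then show ?thesis
    unfolding grassmannian_measure_def using integral_completion_AE[OF m ae] by simp
qed

section \<open>The composed transform at a point\<close>

lemma matrix_image_set_plus: "(*v) \<gamma> ` (S + T) = (*v) \<gamma> ` S + (*v) \<gamma> ` T" for \<gamma> :: "real^'n^'n"
proof
  show "(*v) \<gamma> ` (S + T) \<subseteq> (*v) \<gamma> ` S + (*v) \<gamma> ` T"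
    by (auto elim!: set_plus_elim simp: matrix_vector_right_distrib intro!: set_plus_intro)
  show "(*v) \<gamma> ` S + (*v) \<gamma> ` T \<subseteq> (*v) \<gamma> ` (S + T)"
    by (auto elim!: set_plus_elim simp: matrix_vector_right_distrib[symmetric] intro!: imageI set_plus_intro)
qed

text \<open>All subspaces are written as rotations of \<open>\<eta>\<^sub>0 + \<xi>\<close> with
  \<xi> in one fixed Grassmannian, so that \<gamma> and \<xi> become independent variables. Tonelli
  for \<open>F\<close> finds the good pairs; Fubini for \<open>h0\<close> then puts the rotation
  average inside.\<close>

lemma dual_plane_transform_mixed_radon_transform:
  fixes h h0 :: "real^'n \<Rightarrow> complex" and \<eta>\<^sub>0 N :: "(real^'n) set"
  assumes j: "0 < j" and k: "0 < k" and jk: "j + k < CARD('n)" and \<eta>\<^sub>0: "\<eta>\<^sub>0 \<in> grassmannian k"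
    and N [measurable]: "N \<in> sets borel" and null: "AE y in lborel. y \<notin> N"
    and h0 [measurable]: "h0 \<in> borel_measurable borel" and h: "\<And>y. y \<notin> N \<Longrightarrow> h y = h0 y"
    and fin: "(\<integral>\<^sup>+y. ennreal (averaging_constant CARD('n) (j + k) * riesz_kernel (real (j + k)) y) * norm (h0 (y + x)) \<partial>lborel) < \<infinity>"
  shows "dual_plane_transform \<eta>\<^sub>0 (mixed_radon_transform j k (plane_transform j h)) x =
    (\<integral>y. (averaging_constant CARD('n) (j + k) * riesz_kernel (real (j + k)) y) *\<^sub>R h0 (y + x) \<partial>lborel)"
proof -
  let ?h = "orthogonal_haar_borel :: (real^'n^'n) measure"
  let ?W = "\<eta>\<^sub>0\<^sup>\<bottom>" and ?G = "grassmannian_in j (\<eta>\<^sub>0\<^sup>\<bottom>)"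
  let ?\<mu> = "grassmannian_measure_borel j ?W"
  let ?\<kappa> = "\<lambda>y :: real^'n. averaging_constant CARD('n) (j + k) * riesz_kernel (real (j + k)) y"
  note e = grassmannian_inD[OF \<eta>\<^sub>0]
  have W: "subspace ?W" by (rule subspace_orthogonal_comp)
  have jW: "j \<le> dim ?W" using dim_orthogonal_comp[OF e(1)] e(3) jk by simp
  have inv: "grassmannian_invariant j ?W ?\<mu>" by (rule grassmannian_invariant_measure_borel[OF W jW])
  have s\<mu>: "sets ?\<mu> = sets (grassmannian_borel j ?W)" using inv by (simp add: grassmannian_invariant_def)
  have sp: "space ?\<mu> = ?G" using sets_eq_imp_space_eq[OF s\<mu>] by simp
  interpret h: prob_space ?h by (rule prob_space_orthogonal_haar_borel)
  interpret \<mu>: prob_space ?\<mu> using inv by (simp add: grassmannian_invariant_def)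
  interpret P: pair_sigma_finite ?h ?\<mu> ..
  define F where "F y = (if y \<in> N then \<infinity> else ennreal (norm (h0 y)))" for y
  have F [measurable]: "F \<in> borel_measurable borel" unfolding F_def by measurable
  define Z where "Z \<gamma> \<xi> = (*v) \<gamma> ` (\<eta>\<^sub>0 + \<xi>)" for \<gamma> :: "real^'n^'n" and \<xi>
  define J where "J \<gamma> \<xi> = (\<integral>\<^sup>+z. F (z + x) \<partial>subspace_lborel (Z \<gamma> \<xi>))" for \<gamma> \<xi>
  define T where "T \<gamma> \<xi> = (\<integral>z. h0 (z + x) \<partial>subspace_lborel (Z \<gamma> \<xi>))" for \<gamma> \<xi>
  have S: "subspace (\<eta>\<^sub>0 + \<xi>)" "dim (\<eta>\<^sub>0 + \<xi>) = j + k" if "\<xi> \<in> ?G" for \<xi>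
    using grassmannian_inD[OF that] e by (simp_all add: subspace_set_plus dim_set_plus)
  have SZ: "subspace (Z \<gamma> \<xi>)" if "\<xi> \<in> ?G" for \<gamma> \<xi>
    unfolding Z_def using S[OF that] by (intro linear_subspace_image) auto
  have dZ: "dim (Z \<gamma> \<xi>) = j + k" if "orthogonal_matrix \<gamma>" "\<xi> \<in> ?G" for \<gamma> \<xi>
  proof -
    have "\<eta>\<^sub>0 + \<xi> \<in> grassmannian (j + k)" using S[OF that(2)] by (simp add: grassmannian_in_def)
    from grassmannian_inD(3)[OF grassmannian_in_image[OF that(1) this]] show ?thesis by (simp add: Z_def)
  qed
  have L: "subspace_lborel (Z \<gamma> \<xi>) = distr (subspace_lborel (\<eta>\<^sub>0 + \<xi>)) borel ((*v) \<gamma>)"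
    if "orthogonal_matrix \<gamma>" "\<xi> \<in> ?G" for \<gamma> \<xi>
    unfolding Z_def
    by (rule distr_subspace_lborel_image[OF orthogonal_matrix_imp_transformation S(1), symmetric]) (use that in auto)
  have J_eq: "J \<gamma> \<xi> = (\<integral>\<^sup>+z. F (\<gamma> *v z + x) \<partial>subspace_lborel (\<eta>\<^sub>0 + \<xi>))"
    and T_eq: "T \<gamma> \<xi> = (\<integral>z. h0 (\<gamma> *v z + x) \<partial>subspace_lborel (\<eta>\<^sub>0 + \<xi>))"
    if "orthogonal_matrix \<gamma>" "\<xi> \<in> ?G" for \<gamma> \<xi>
    unfolding J_def T_def L[OF that] by (subst nn_integral_distr, auto, subst integral_distr, auto)
  have PZ: "(\<lambda>p. matrix (closest_point (Z (fst p) (snd p)))) \<in> borel_measurable (?h \<Otimes>\<^sub>M ?\<mu>)"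
  proof -
    have m1: "fst \<in> borel_measurable (?h \<Otimes>\<^sub>M ?\<mu>)"
      by (rule measurable_compose[OF measurable_fst measurable_orthogonal_haar_borel_id])
    have "(\<lambda>\<xi>. matrix (closest_point \<xi>)) \<in> borel_measurable ?\<mu>"
      unfolding measurable_cong_sets[OF s\<mu> refl] by (rule measurable_projection_matrix)
    then have m2: "(\<lambda>p. matrix (closest_point (snd p))) \<in> borel_measurable (?h \<Otimes>\<^sub>M ?\<mu>)"
      by (rule measurable_compose[OF measurable_snd])
    note m1[measurable] m2[measurable]
    have "(\<lambda>p. fst p ** (matrix (closest_point \<eta>\<^sub>0) + matrix (closest_point (snd p))) ** transpose (fst p))
        \<in> borel_measurable (?h \<Otimes>\<^sub>M ?\<mu>)"
      by measurable
    then show ?thesis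
      by (rule measurable_cong[THEN iffD1, rotated])
         (auto simp: space_pair_measure sp Z_def projection_matrix_image S matrix_closest_point_set_plus e grassmannian_inD)
  qed
  have Zp: "subspace (Z (fst p) (snd p))" "dim (Z (fst p) (snd p)) = j + k" if "p \<in> space (?h \<Otimes>\<^sub>M ?\<mu>)" for p
    using that SZ dZ by (auto simp: space_pair_measure sp)
  have mJ: "(\<lambda>p. J (fst p) (snd p)) \<in> borel_measurable (?h \<Otimes>\<^sub>M ?\<mu>)"
    unfolding J_def by (rule measurable_subspace_lborel_integrals(1)[OF Zp PZ]) auto
  have mT: "(\<lambda>p. T (fst p) (snd p)) \<in> borel_measurable (?h \<Otimes>\<^sub>M ?\<mu>)"
    unfolding T_def by (rule measurable_subspace_lborel_integrals(2)[OF Zp PZ]) auto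

  have aeF: "AE y in lborel. y + x \<notin> N"
    using AE_subspace_lborel_translation[OF subspace_UNIV _ N, of 0 x] null
    unfolding subspace_lborel_UNIV by simp
  \<comment> \<open>On the whole space \<open>N\<close> is null, so the infinite values of
    \<open>F\<close> do not count.\<close>
  have finF: "(\<integral>\<^sup>+y. ennreal (?\<kappa> y) * F (y + x) \<partial>lborel) < \<infinity>"
  proof -
    have "(\<integral>\<^sup>+y. ennreal (?\<kappa> y) * F (y + x) \<partial>lborel) = (\<integral>\<^sup>+y. ennreal (?\<kappa> y) * norm (h0 (y + x)) \<partial>lborel)"
      using aeF by (intro nn_integral_cong_AE) (auto elim!: eventually_mono simp: F_def)
    then show ?thesis using fin by simp
  qed
  \<comment> \<open>Nonnegativity allows the exchange before anything is known about single planes;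
    for each \<xi> the rotation average is then an integral over the whole space.\<close>
  have "(\<integral>\<^sup>+\<gamma>. (\<integral>\<^sup>+\<xi>. J \<gamma> \<xi> \<partial>?\<mu>) \<partial>?h) = (\<integral>\<^sup>+\<xi>. (\<integral>\<^sup>+\<gamma>. J \<gamma> \<xi> \<partial>?h) \<partial>?\<mu>)"
    using mJ by (intro P.Fubini'[symmetric]) (simp add: case_prod_beta')
  also have "\<dots> = (\<integral>\<^sup>+\<xi>. (\<integral>\<^sup>+y. ennreal (?\<kappa> y) * F (y + x) \<partial>lborel) \<partial>?\<mu>)"
  proof (rule nn_integral_cong)
    fix \<xi> assume "\<xi> \<in> space ?\<mu>"
    then have \<xi>: "\<xi> \<in> ?G" by (simp add: sp)
    have "(\<integral>\<^sup>+\<gamma>. J \<gamma> \<xi> \<partial>?h) = (\<integral>\<^sup>+\<gamma>. (\<integral>\<^sup>+z. F (\<gamma> *v z + x) \<partial>subspace_lborel (\<eta>\<^sub>0 + \<xi>)) \<partial>?h)"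
      by (intro nn_integral_cong J_eq \<xi>) simp
    also have "\<dots> = (\<integral>\<^sup>+y. ennreal (?\<kappa> y) * F (y + x) \<partial>lborel)"
      using nn_integral_haar_subspace[OF S(1)[OF \<xi>], of "\<lambda>y. F (y + x)"] j by (simp add: S[OF \<xi>])
    finally show "(\<integral>\<^sup>+\<gamma>. J \<gamma> \<xi> \<partial>?h) = (\<integral>\<^sup>+y. ennreal (?\<kappa> y) * F (y + x) \<partial>lborel)" .
  qed
  also have "\<dots> < \<infinity>" using finF by (simp add: \<mu>.emeasure_space_1)
  finally have finJ: "(\<integral>\<^sup>+\<gamma>. (\<integral>\<^sup>+\<xi>. J \<gamma> \<xi> \<partial>?\<mu>) \<partial>?h) < \<infinity>" .

  have intT: "integrable (?h \<Otimes>\<^sub>M ?\<mu>) (\<lambda>p. T (fst p) (snd p))"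
  proof (rule integrableI_bounded[OF mT])
    \<comment> \<open>Where \<open>h0\<close> is not integrable, \<open>T\<close> is 0 by the
      convention for the Bochner integral, so the bound persists.\<close>
    have "norm (T \<gamma> \<xi>) \<le> J \<gamma> \<xi>" for \<gamma> \<xi>
    proof (cases "integrable (subspace_lborel (Z \<gamma> \<xi>)) (\<lambda>z. h0 (z + x))")
      case True
      then have "ennreal (norm (T \<gamma> \<xi>)) \<le> (\<integral>\<^sup>+z. norm (h0 (z + x)) \<partial>subspace_lborel (Z \<gamma> \<xi>))"
        unfolding T_def by (rule integral_norm_bound_ennreal)
      also have "\<dots> \<le> J \<gamma> \<xi>" unfolding J_def by (intro nn_integral_mono) (auto simp: F_def)
      finally show ?thesis .
    qed (simp add: T_def not_integrable_integral_eq)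
    then have "(\<integral>\<^sup>+p. norm (T (fst p) (snd p)) \<partial>(?h \<Otimes>\<^sub>M ?\<mu>)) \<le> (\<integral>\<^sup>+p. J (fst p) (snd p) \<partial>(?h \<Otimes>\<^sub>M ?\<mu>))"
      by (intro nn_integral_mono) auto
    also have "\<dots> = (\<integral>\<^sup>+\<gamma>. (\<integral>\<^sup>+\<xi>. J \<gamma> \<xi> \<partial>?\<mu>) \<partial>?h)"
      using \<mu>.nn_integral_fst[OF mJ] by simp
    also note finJ
    finally show "(\<integral>\<^sup>+p. norm (T (fst p) (snd p)) \<partial>(?h \<Otimes>\<^sub>M ?\<mu>)) < \<infinity>" .
  qed

  \<comment> \<open>For a good rotation, the average over the complement of the rotated plane is
    pulled back to the complement of \<open>\<eta>\<^sub>0\<close>.\<close>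
  have mix: "mixed_radon_transform j k (plane_transform j h) ((\<lambda>y. \<gamma> *v y + x) ` \<eta>\<^sub>0) = (\<integral>\<xi>. T \<gamma> \<xi> \<partial>?\<mu>)"
    if \<gamma>: "orthogonal_matrix \<gamma>" and ae: "AE \<xi> in ?\<mu>. J \<gamma> \<xi> \<noteq> \<infinity>" for \<gamma>
  proof -
    let ?\<eta> = "(*v) \<gamma> ` \<eta>\<^sub>0"
    have \<eta>: "subspace ?\<eta>" "dim ?\<eta> = k"
      using grassmannian_in_image[OF \<gamma> \<eta>\<^sub>0] by (auto simp: grassmannian_in_def)
    have \<eta>W: "?\<eta>\<^sup>\<bottom> = (*v) \<gamma> ` ?W"
      by (rule orthogonal_comp_image[OF orthogonal_matrix_imp_transformation[OF \<gamma>]])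
    have j\<eta>: "j \<le> dim (?\<eta>\<^sup>\<bottom>)" using dim_orthogonal_comp[OF \<eta>(1)] \<eta>(2) jk by simp
    let ?\<nu> = "grassmannian_measure_borel j (?\<eta>\<^sup>\<bottom>)" and ?B = "grassmannian_borel j (?\<eta>\<^sup>\<bottom>)"
    have act: "(\<lambda>\<xi>. (*v) \<gamma> ` \<xi>) \<in> measurable ?\<mu> ?B"
      unfolding measurable_cong_sets[OF s\<mu> refl] \<eta>W by (rule measurable_grassmannian_image[OF \<gamma>])
    have \<nu>: "?\<nu> = distr ?\<mu> ?B (\<lambda>\<xi>. (*v) \<gamma> ` \<xi>)"
      unfolding \<eta>W by (rule grassmannian_measure_borel_image[OF W jW \<gamma>])
    have Z\<gamma>: "?\<eta> + (*v) \<gamma> ` \<xi> = Z \<gamma> \<xi>" for \<xi> by (simp add: Z_def matrix_image_set_plus)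
    have mF: "(\<lambda>\<xi>. \<integral>\<^sup>+z. F (z + x) \<partial>subspace_lborel (?\<eta> + \<xi>)) \<in> borel_measurable ?B"
      by (rule measurable_grassmannian_integrals(1)[OF \<eta>(1)]) measurable
    have mh: "(\<lambda>\<xi>. \<integral>z. h0 (z + x) \<partial>subspace_lborel (?\<eta> + \<xi>)) \<in> borel_measurable ?B"
      by (rule measurable_grassmannian_integrals(2)[OF \<eta>(1)]) measurable
    have "AE \<xi> in ?\<nu>. (\<integral>\<^sup>+z. F (z + x) \<partial>subspace_lborel (?\<eta> + \<xi>)) \<noteq> \<infinity>"
      unfolding \<nu>
    proof (subst AE_distr_iff[OF act])
      show "{\<xi> \<in> space ?B. (\<integral>\<^sup>+z. F (z + x) \<partial>subspace_lborel (?\<eta> + \<xi>)) \<noteq> \<infinity>} \<in> sets ?B"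
        using mF by measurable
      show "AE \<xi> in ?\<mu>. (\<integral>\<^sup>+z. F (z + x) \<partial>subspace_lborel (?\<eta> + (*v) \<gamma> ` \<xi>)) \<noteq> \<infinity>"
        using ae by (simp add: Z\<gamma> J_def)
    qed
    then have "mixed_radon_transform j k (plane_transform j h) ((\<lambda>y. y + x) ` ?\<eta>)
        = (\<integral>\<xi>. (\<integral>z. h0 (z + x) \<partial>subspace_lborel (?\<eta> + \<xi>)) \<partial>?\<nu>)"
      unfolding F_def by (intro mixed_radon_transform_plane_transform[OF \<eta> j\<eta> N h0 h])
    also have "\<dots> = (\<integral>\<xi>. T \<gamma> \<xi> \<partial>?\<mu>)"
      unfolding \<nu> by (subst integral_distr[OF act mh]) (simp only: Z\<gamma> T_def[symmetric])
    also have "(\<lambda>y. y + x) ` ?\<eta> = (\<lambda>y. \<gamma> *v y + x) ` \<eta>\<^sub>0" by (simp add: image_image)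
    finally show ?thesis .
  qed
  have mT': "(\<lambda>\<gamma>. \<integral>\<xi>. T \<gamma> \<xi> \<partial>?\<mu>) \<in> borel_measurable ?h"
    using mT by (intro \<mu>.borel_measurable_lebesgue_integral) (simp add: case_prod_beta')
  have mJ': "(\<lambda>\<gamma>. \<integral>\<^sup>+\<xi>. J \<gamma> \<xi> \<partial>?\<mu>) \<in> borel_measurable ?h"
    using mJ by (intro \<mu>.borel_measurable_nn_integral) (simp add: case_prod_beta')
  \<comment> \<open>A finite average of \<open>J\<close> leaves almost every rotation good for
    almost every \<xi>.\<close>
  have "AE \<gamma> in ?h. (\<integral>\<^sup>+\<xi>. J \<gamma> \<xi> \<partial>?\<mu>) \<noteq> \<infinity>"
    using finJ by (intro nn_integral_PInf_AE[OF mJ']) simp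
  then have "AE \<gamma> in ?h. mixed_radon_transform j k (plane_transform j h) ((\<lambda>y. \<gamma> *v y + x) ` \<eta>\<^sub>0) = (\<integral>\<xi>. T \<gamma> \<xi> \<partial>?\<mu>)"
    using AE_space
  proof eventually_elim
    case (elim \<gamma>)
    have "J \<gamma> \<in> borel_measurable ?\<mu>"
      using measurable_compose[OF measurable_Pair1'[OF elim(2)] mJ] by simp
    then have "AE \<xi> in ?\<mu>. J \<gamma> \<xi> \<noteq> \<infinity>"
      using elim(1) by (intro nn_integral_PInf_AE)
    then show ?case using elim(2) by (intro mix) simp_all
  qed
  then have "dual_plane_transform \<eta>\<^sub>0 (mixed_radon_transform j k (plane_transform j h)) x = (\<integral>\<gamma>. (\<integral>\<xi>. T \<gamma> \<xi> \<partial>?\<mu>) \<partial>?h)"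
    unfolding dual_plane_transform_def orthogonal_haar_def by (rule integral_completion_AE[OF mT'])
  \<comment> \<open>The rotation average has the same value for every \<xi>, so the probability
    measure on the Grassmannian drops out.\<close>
  also have "\<dots> = (\<integral>\<xi>. (\<integral>\<gamma>. T \<gamma> \<xi> \<partial>?h) \<partial>?\<mu>)"
    using intT by (intro P.Fubini_integral[symmetric]) (simp add: case_prod_beta')
  also have "\<dots> = (\<integral>\<xi>. (\<integral>y. ?\<kappa> y *\<^sub>R h0 (y + x) \<partial>lborel) \<partial>?\<mu>)"
  proof (rule Bochner_Integration.integral_cong[OF refl])
    fix \<xi> assume "\<xi> \<in> space ?\<mu>"
    then have \<xi>: "\<xi> \<in> ?G" by (simp add: sp)
    have "(\<integral>\<gamma>. T \<gamma> \<xi> \<partial>?h) = (\<integral>\<gamma>. (\<integral>z. h0 (\<gamma> *v z + x) \<partial>subspace_lborel (\<eta>\<^sub>0 + \<xi>)) \<partial>?h)"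
      by (intro Bochner_Integration.integral_cong refl T_eq \<xi>) simp
    also have "\<dots> = (\<integral>y. ?\<kappa> y *\<^sub>R h0 (y + x) \<partial>lborel)"
      using integral_haar_subspace[OF S(1)[OF \<xi>], of "\<lambda>y. h0 (y + x)"] j fin by (simp add: S[OF \<xi>])
    finally show "(\<integral>\<gamma>. T \<gamma> \<xi> \<partial>?h) = (\<integral>y. ?\<kappa> y *\<^sub>R h0 (y + x) \<partial>lborel)" .
  qed
  also have "\<dots> = (\<integral>y. ?\<kappa> y *\<^sub>R h0 (y + x) \<partial>lborel)" by (simp add: \<mu>.prob_space)
  finally show ?thesis .
qed

section \<open>The Riesz potential\<close>

lemma completion_ex_borel_measurable_complex:
  fixes g :: "'a \<Rightarrow> complex"
  assumes g: "g \<in> borel_measurable (completion M)"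
  shows "\<exists>g'\<in>borel_measurable M. AE x in M. g x = g' x"
proof -
  have "(\<lambda>x. Re (g x)) \<in> borel_measurable (completion M)" "(\<lambda>x. Im (g x)) \<in> borel_measurable (completion M)"
    using g by measurable
  then obtain a b where [measurable]: "a \<in> borel_measurable M" "b \<in> borel_measurable M"
    and ae: "AE x in M. Re (g x) = a x" "AE x in M. Im (g x) = b x"
    by (elim completion_ex_borel_measurable_real[THEN bexE]) auto
  show ?thesis
  proof (intro bexI)
    show "(\<lambda>x. of_real (a x) + \<i> * of_real (b x)) \<in> borel_measurable M" by measurable
    show "AE x in M. g x = of_real (a x) + \<i> * of_real (b x)"
      using ae by eventually_elim (simp add: complex_eq_iff)
  qed
qed

text \<open>The sphere area d \<omega>_d equals 2 \<pi>^(d/2) / \<Gamma>(d/2); on the right the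
  powers of 2 and the Gamma factors at (n - m)/2 cancel.\<close>

lemma averaging_constant_riesz_constant:
  assumes "0 < m" "m < n"
  shows "averaging_constant n m = (2 ^ m * pi powr (real m / 2) * Gamma (real n / 2) / Gamma ((real n - real m) / 2))
      / riesz_constant n (real m)"
proof -
  have G: "Gamma (real n / 2) > 0" "Gamma (real m / 2) > 0" "Gamma ((real n - real m) / 2) > 0"
    using assms by (auto intro!: Gamma_real_pos)
  note G' = G[THEN less_imp_neq, symmetric]
  have ball: "real d * unit_ball_vol (real d) = 2 * pi powr (real d / 2) / Gamma (real d / 2)" if "d > 0" for d
  proof -
    have G1: "Gamma (real d / 2 + 1) = (real d / 2) * Gamma (real d / 2)"
      using that by (intro Gamma_plus1) auto
    show ?thesis unfolding unit_ball_vol_def G1 using that by simp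
  qed
  have "(2::real) powr real m = 2 ^ m" by (simp add: powr_realpow)
  then show ?thesis
    using assms by (simp add: averaging_constant_def riesz_constant_def ball G' field_simps)
qed

text \<open>What is known to be measurable is the product of the kernel and \<open>h\<close>. Its
  Borel version divided by the kernel serves as \<open>h0\<close>, which is legitimate where the
  kernel does not vanish, that is, off \<open>x\<close>.\<close>

lemma dual_mixed_plane_eq_riesz_potential:
  fixes h :: "real^'n \<Rightarrow> complex"
  assumes j: "0 < j" and k: "0 < k" and jk: "j + k < CARD('n)" and \<eta>\<^sub>0: "\<eta>\<^sub>0 \<in> grassmannian k"
    and ex: "riesz_potential_exists (real (j + k)) h x"
  shows "dual_plane_transform \<eta>\<^sub>0 (mixed_radon_transform j k (plane_transform j h)) x =
    (2 ^ (j + k) * pi powr (real (j + k) / 2) * Gamma (real CARD('n) / 2)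
       / Gamma ((real CARD('n) - real j - real k) / 2)) *\<^sub>R riesz_potential (real (j + k)) h x"
proof -
  let ?m = "j + k"
  let ?K = "riesz_kernel (real ?m) :: real^'n \<Rightarrow> real" and ?C = "averaging_constant CARD('n) ?m"
  have Kpos: "?K y > 0" if "y \<noteq> 0" for y using that by (simp add: riesz_kernel_def)
  have Keven: "?K (x - y) = ?K (y - x)" for y by (simp add: riesz_kernel_def norm_minus_commute)
  let ?g = "\<lambda>y. ?K (x - y) *\<^sub>R h y"
  have intg: "integrable lebesgue ?g" using ex by (simp add: riesz_potential_exists_def)
  then obtain g0 where g0 [measurable]: "g0 \<in> borel_measurable lborel" and ae: "AE y in lborel. ?g y = g0 y"
    using completion_ex_borel_measurable_complex[OF borel_measurable_integrable[OF intg]] by blast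
  obtain N0 where N0: "{y \<in> space lborel. ?g y \<noteq> g0 y} \<subseteq> N0" "N0 \<in> null_sets lborel"
    using ae by (auto simp: eventually_ae_filter)
  \<comment> \<open>At \<open>x\<close> the kernel is 0 by convention and says nothing about
    \<open>h x\<close>, so this point joins the exceptional set.\<close>
  define N where "N = insert x N0"
  have N [measurable]: "N \<in> sets borel" and null: "AE y in lborel. y \<notin> N"
  proof -
    have "{x} \<in> null_sets lborel" by (simp add: null_sets_def)
    then have "{x} \<union> N0 \<in> null_sets lborel" using N0(2) by (rule null_sets.Un)
    then have "N \<in> null_sets lborel" by (simp add: N_def)
    then show "N \<in> sets borel" "AE y in lborel. y \<notin> N"
      by (auto dest: null_setsD2 AE_not_in)
  qed
  define h0 where "h0 y = g0 y /\<^sub>R ?K (x - y)" for y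
  have h0 [measurable]: "h0 \<in> borel_measurable borel" unfolding h0_def using g0 by measurable
  have hN: "h y = h0 y" and gN: "?K (y - x) *\<^sub>R h0 y = g0 y" "?g y = g0 y" if "y \<notin> N" for y
  proof -
    have y: "?g y = g0 y" "y \<noteq> x" using that N0(1) by (auto simp: N_def)
    then have "?K (x - y) \<noteq> 0" using Kpos[of "x - y"] by simp
    then show "h y = h0 y" "?K (y - x) *\<^sub>R h0 y = g0 y"
      unfolding Keven[symmetric] h0_def y(1)[symmetric] by simp_all
    show "?g y = g0 y" by (rule y)
  qed
  have aeg: "AE y in lborel. ?K (y - x) *\<^sub>R h0 y = g0 y"
    using null by eventually_elim (rule gN)
  have tr: "distr lborel borel (\<lambda>y. y + x) = (lborel :: (real^'n) measure)"
    using lborel_distr_plus[of x] by (simp only: add.commute[of _ x])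
  have intg0: "integrable lborel g0"
  proof -
    have "?g \<in> borel_measurable lebesgue" "g0 \<in> borel_measurable lebesgue"
      using borel_measurable_integrable[OF intg] measurable_completion[OF g0] .
    then have "integrable lebesgue g0"
      using intg AE_completion[OF ae] integrable_cong_AE by blast
    then show ?thesis using g0 by (simp add: integrable_completion)
  qed
  \<comment> \<open>Recentring at \<open>x\<close> turns the weighted integral of \<open>h0\<close>
    into that of the integrable \<open>g0\<close>.\<close>
  have "(\<integral>\<^sup>+y. ennreal (?C * ?K y) * norm (h0 (y + x)) \<partial>lborel)
      = (\<integral>\<^sup>+y. ennreal (?C * ?K (y - x)) * norm (h0 y) \<partial>distr lborel borel (\<lambda>y. y + x))"
    by (subst nn_integral_distr) auto
  also have "\<dots> = (\<integral>\<^sup>+y. ennreal ?C * norm (g0 y) \<partial>lborel)"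
    unfolding tr
  proof (rule nn_integral_cong_AE)
    show "AE y in lborel. ennreal (?C * ?K (y - x)) * norm (h0 y) = ennreal ?C * norm (g0 y)"
      using aeg
    proof eventually_elim
      case (elim y)
      have "norm (g0 y) = ?K (y - x) * norm (h0 y)"
        unfolding elim[symmetric] by (simp add: riesz_kernel_nonneg)
      then show ?case
        by (simp add: ennreal_mult[symmetric] averaging_constant_nonneg riesz_kernel_nonneg mult.assoc)
    qed
  qed
  also have "\<dots> < \<infinity>"
    using intg0 by (subst nn_integral_cmult) (auto simp: integrable_iff_bounded ennreal_mult_less_top)
  finally have fin: "(\<integral>\<^sup>+y. ennreal (?C * ?K y) * norm (h0 (y + x)) \<partial>lborel) < \<infinity>" .
  have "dual_plane_transform \<eta>\<^sub>0 (mixed_radon_transform j k (plane_transform j h)) x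
      = (\<integral>y. (?C * ?K y) *\<^sub>R h0 (y + x) \<partial>lborel)"
    by (rule dual_plane_transform_mixed_radon_transform[OF j k jk \<eta>\<^sub>0 N null h0 hN fin])
  also have "\<dots> = (\<integral>y. (?C * ?K (y - x)) *\<^sub>R h0 y \<partial>distr lborel borel (\<lambda>y. y + x))"
    by (subst integral_distr) auto
  also have "\<dots> = (\<integral>y. ?C *\<^sub>R g0 y \<partial>lborel)"
    unfolding tr
  proof (rule integral_cong_AE)
    show "AE y in lborel. (?C * ?K (y - x)) *\<^sub>R h0 y = ?C *\<^sub>R g0 y"
      using aeg by eventually_elim (simp only: scaleR_scaleR[symmetric])
  qed (use g0 in measurable)
  also have "\<dots> = ?C *\<^sub>R (\<integral>y. g0 y \<partial>lborel)" by simp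
  also have "(\<integral>y. g0 y \<partial>lborel) = (\<integral>y. ?g y \<partial>lebesgue)"
    using g0 ae by (intro integral_completion_AE[symmetric])
  also have "?C *\<^sub>R \<dots> = (2 ^ ?m * pi powr (real ?m / 2) * Gamma (real CARD('n) / 2)
       / Gamma ((real CARD('n) - real ?m) / 2)) *\<^sub>R riesz_potential (real ?m) h x"
    using j jk by (simp add: averaging_constant_riesz_constant riesz_potential_def)
  finally show ?thesis by (simp add: diff_diff_eq)
qed

theorem theorem6p3:
  fixes h :: "real^'n \<Rightarrow> complex" and x :: "real^'n"
    and j k :: nat and \<xi>\<^sub>0 \<eta>\<^sub>0 :: "(real^'n) set" and c :: real
  assumes "j > 0" and "k > 0" and "j + k < CARD('n)"
    and "\<xi>\<^sub>0 \<in> grassmannian j" and "\<eta>\<^sub>0 \<in> grassmannian k"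
    and "c = 2 ^ (j + k) * pi powr (real (j + k) / 2) * Gamma (real CARD('n) / 2)
               / Gamma ((real CARD('n) - real j - real k) / 2)"
    and "riesz_potential_exists (real (j + k)) h x"
  shows "dual_plane_transform \<eta>\<^sub>0 (mixed_radon_transform j k (plane_transform j h)) x
           = dual_plane_transform \<xi>\<^sub>0 (mixed_radon_transform k j (plane_transform k h)) x
       \<and> dual_plane_transform \<xi>\<^sub>0 (mixed_radon_transform k j (plane_transform k h)) x
           = c *\<^sub>R riesz_potential (real (j + k)) h x"
proof -
  have "dual_plane_transform \<eta>\<^sub>0 (mixed_radon_transform j k (plane_transform j h)) x
      = c *\<^sub>R riesz_potential (real (j + k)) h x"
    unfolding \<open>c = _\<close> using assms by (intro dual_mixed_plane_eq_riesz_potential)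
  \<comment> \<open>The same identity with \<open>j\<close> and \<open>k\<close> exchanged; the
    constant and the order of the potential are symmetric in them.\<close>
  moreover have "dual_plane_transform \<xi>\<^sub>0 (mixed_radon_transform k j (plane_transform k h)) x
      = c *\<^sub>R riesz_potential (real (j + k)) h x"
  proof -
    have c: "c = 2 ^ (k + j) * pi powr (real (k + j) / 2) * Gamma (real CARD('n) / 2)
        / Gamma ((real CARD('n) - real k - real j) / 2)"
      unfolding assms(6) by (simp only: add.commute[of j k] cancel_ab_semigroup_add_class.diff_right_commute[of _ "real j"])
    show ?thesis
      unfolding c add.commute[of j k] using assms
      by (intro dual_mixed_plane_eq_riesz_potential) (simp_all add: add.commute)
  qed
  ultimately show ?thesis by simp
qed

end
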